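(* Let $\alpha\in[g,G]$. The measure-preserving transformation $(I_\alpha,\mathcal B_{I_\alpha},\varphi_\alpha,\nu_\alpha)$ is exact, and in particular it is mixing of all orders.
   Context: $g=\frac12(\sqrt5-1)$, $G=\frac12(\sqrt5+1)$, $[\cdot]$ in the formula for $d_\alpha$ is the integer part (floor); $\mathcal B_C$ is the Borel $\sigma$-algebra on $C$. $I_\alpha=[\alpha-2,\alpha)$. For $x\ne0$, $d_\alpha(x)=2\left[\frac1{2|x|}+\frac{1-\alpha}2\right]+1$ and $\varphi_\alpha(x)=\frac1{|x|}-d_\alpha(x)$, with $\varphi_\alpha(0)=0$; the same formulas at $x=\alpha$ define $\varphi_\alpha(\alpha)=\frac1\alpha-d_\alpha(\alpha)$. For $g<\alpha<G$, $$\Omega_\alpha=\big(I_\alpha\times[0,2-G)\big)\cup\big((\varphi_\alpha(\alpha),\alpha)\times(2-G,1]\big)\cup\big([\varphi_\alpha(\alpha-2),\alpha)\times[1,G)\big),$$ while $\Omega_g=\big([g-2,g)\times[0,1-g)\big)\cup\big([\frac{g-1}{2-g},g)\times[1,G)\big)$ and $\Omega_G=[G-2,G)\times[0,1)$. Let $d\mu_\alpha=(1+xy)^{-2}dx\,dy$ on $\Omega_\alpha$ (total mass $3\log G$), $\tilde\mu_\alpha=(3\log G)^{-1}\mu_\alpha$; the $\varphi_\alpha$-invariant probability measure $\nu_\alpha$ is $\nu_\alpha(E)=\tilde\mu_\alpha(\{(x,y)\in\Omega_\alpha:x\in E\})$, $E\in\mathcal B_{I_\alpha}$. Exact (in the sense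 of Rohlin) means that the tail $\sigma$-algebra $\bigcap_{n=0}^\infty\varphi_\alpha^{-n}\mathcal B_{I_\alpha}$ consists only of sets that are null or co-null. *)

theory Defs
  imports "HOL-Probability.Probability"
begin

definition measure_preserving :: "'a measure \<Rightarrow> ('a \<Rightarrow> 'a) \<Rightarrow> bool" where
  "measure_preserving M T \<longleftrightarrow> prob_space M \<and> T \<in> measurable M M \<and> distr M M T = M"

definition tail_sigma_algebra :: "'a measure \<Rightarrow> ('a \<Rightarrow> 'a) \<Rightarrow> 'a set set" where
  "tail_sigma_algebra M T = (\<Inter>n. {(T ^^ n) -` A \<inter> space M |A. A \<in> sets M})"

definition exact_transformation :: "'a measure \<Rightarrow> ('a \<Rightarrow> 'a) \<Rightarrow> bool" where
  "exact_transformation M T \<longleftrightarrow>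
     (\<forall>A\<in>tail_sigma_algebra M T. emeasure M A = 0 \<or> emeasure M (space M - A) = 0)"

text \<open>
  For all measurable sets \<open>A 0, \<dots>, A r\<close>, the measure of
  \<open>A 0 \<inter> T\<^sup>-\<^sup>n\<^sup>1 (A 1) \<inter> \<dots> \<inter> T\<^sup>-\<^sup>n\<^sup>r (A r)\<close> tends to the product of the measures
  of the \<open>A i\<close> as all the gaps \<open>n 1, n 2 - n 1, \<dots>, n r - n (r - 1)\<close> tend to infinity.
\<close>
definition mixing_of_order :: "nat \<Rightarrow> 'a measure \<Rightarrow> ('a \<Rightarrow> 'a) \<Rightarrow> bool" where
  "mixing_of_order r M T \<longleftrightarrow>
     (\<forall>A. (\<forall>i\<le>r. A i \<in> sets M) \<longrightarrow>
       (\<forall>e>0. \<exists>N. \<forall>n :: nat \<Rightarrow> nat. n 0 = 0 \<and> (\<forall>i<r. n i + N \<le> n (Suc i)) \<longrightarrow>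
          \<bar>measure M (\<Inter>i\<le>r. (T ^^ n i) -` A i \<inter> space M) - (\<Prod>i\<le>r. measure M (A i))\<bar> < e))"

definition mixing_of_all_orders :: "'a measure \<Rightarrow> ('a \<Rightarrow> 'a) \<Rightarrow> bool" where
  "mixing_of_all_orders M T \<longleftrightarrow> (\<forall>r\<ge>1. mixing_of_order r M T)"

definition golden_g :: real where
  "golden_g = (sqrt 5 - 1) / 2"

definition golden_G :: real where
  "golden_G = (sqrt 5 + 1) / 2"

definition I\<^sub>\<alpha> :: "real \<Rightarrow> real set" where
  "I\<^sub>\<alpha> \<alpha> = {\<alpha> - 2..<\<alpha>}"

definition d\<^sub>\<alpha> :: "real \<Rightarrow> real \<Rightarrow> int" where
  "d\<^sub>\<alpha> \<alpha> x = 2 * \<lfloor>1 / (2 * \<bar>x\<bar>) + (1 - \<alpha>) / 2\<rfloor> + 1"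

text \<open>Defined on the whole real line, since its value at the excluded endpoint \<open>\<alpha>\<close> is also used.\<close>
definition \<phi>\<^sub>\<alpha> :: "real \<Rightarrow> real \<Rightarrow> real" where
  "\<phi>\<^sub>\<alpha> \<alpha> x = (if x = 0 then 0 else 1 / \<bar>x\<bar> - real_of_int (d\<^sub>\<alpha> \<alpha> x))"

text \<open>Only meaningful for \<open>golden_g \<le> \<alpha> \<le> golden_G\<close>.\<close>
definition \<Omega>\<^sub>\<alpha> :: "real \<Rightarrow> (real \<times> real) set" where
  "\<Omega>\<^sub>\<alpha> \<alpha> =
     (if \<alpha> = golden_g then
        {golden_g - 2..<golden_g} \<times> {0..<1 - golden_g} \<union>
        {(golden_g - 1) / (2 - golden_g)..<golden_g} \<times> {1..<golden_G}
      else if \<alpha> = golden_G then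
        {golden_G - 2..<golden_G} \<times> {0..<1}
      else
        I\<^sub>\<alpha> \<alpha> \<times> {0..<2 - golden_G} \<union>
        {\<phi>\<^sub>\<alpha> \<alpha> \<alpha><..<\<alpha>} \<times> {2 - golden_G<..1} \<union>
        {\<phi>\<^sub>\<alpha> \<alpha> (\<alpha> - 2)..<\<alpha>} \<times> {1..<golden_G})"

definition \<mu>\<^sub>\<alpha> :: "real \<Rightarrow> (real \<times> real) measure" where
  "\<mu>\<^sub>\<alpha> \<alpha> = density (restrict_space lborel (\<Omega>\<^sub>\<alpha> \<alpha>)) (\<lambda>(x, y). ennreal (1 / (1 + x * y)\<^sup>2))"

definition normalized_\<mu>\<^sub>\<alpha> :: "real \<Rightarrow> (real \<times> real) measure" where
  "normalized_\<mu>\<^sub>\<alpha> \<alpha> = scale_measure (ennreal (1 / (3 * ln golden_G))) (\<mu>\<^sub>\<alpha> \<alpha>)"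

definition \<nu>\<^sub>\<alpha> :: "real \<Rightarrow> real measure" where
  "\<nu>\<^sub>\<alpha> \<alpha> = distr (normalized_\<mu>\<^sub>\<alpha> \<alpha>) (restrict_space borel (I\<^sub>\<alpha> \<alpha>)) fst"

lemma \<phi>\<^sub>\<alpha>_in_I\<^sub>\<alpha>:
  assumes "x \<noteq> 0"
  shows "\<phi>\<^sub>\<alpha> \<alpha> x \<in> I\<^sub>\<alpha> \<alpha>"
proof -
  define t where "t = 1 / (2 * \<bar>x\<bar>) + (1 - \<alpha>) / 2"
  have "1 / \<bar>x\<bar> = 2 * t - 1 + \<alpha>"
    by (simp add: t_def field_simps)
  then have "\<phi>\<^sub>\<alpha> \<alpha> x = 2 * (t - real_of_int \<lfloor>t\<rfloor>) + \<alpha> - 2"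
    using assms by (simp add: \<phi>\<^sub>\<alpha>_def d\<^sub>\<alpha>_def t_def)
  moreover have "real_of_int \<lfloor>t\<rfloor> \<le> t" "t < real_of_int \<lfloor>t\<rfloor> + 1"
    by linarith+
  ultimately show ?thesis
    unfolding I\<^sub>\<alpha>_def atLeastLessThan_iff by argo
qed

lemma golden_bounds: "0 < golden_g" "golden_g < 1" "1 < golden_G" "golden_G < 2"
proof -
  have "2 < sqrt 5" "sqrt 5 < 3"
    by (auto intro!: real_less_rsqrt real_less_lsqrt)
  then show "0 < golden_g" "golden_g < 1" "1 < golden_G" "golden_G < 2"
    by (simp_all add: golden_g_def golden_G_def)
qed

lemma \<Omega>\<^sub>\<alpha>_fst_in_I\<^sub>\<alpha>:
  assumes "\<alpha> \<in> {golden_g..golden_G}" "p \<in> \<Omega>\<^sub>\<alpha> \<alpha>"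
  shows "fst p \<in> I\<^sub>\<alpha> \<alpha>"
proof -
  have g: "golden_g - 2 \<le> (golden_g - 1) / (2 - golden_g)"
  proof -
    have "(golden_g - 1) * 1 \<le> (golden_g - 1) / (2 - golden_g)"
      using golden_bounds(1,2) zero_le_square[of "golden_g - 1"] by (simp add: field_simps)
    then show ?thesis by simp
  qed
  have "\<phi>\<^sub>\<alpha> \<alpha> \<alpha> \<in> I\<^sub>\<alpha> \<alpha>" "\<phi>\<^sub>\<alpha> \<alpha> (\<alpha> - 2) \<in> I\<^sub>\<alpha> \<alpha>"
    using assms(1) golden_bounds by (auto intro!: \<phi>\<^sub>\<alpha>_in_I\<^sub>\<alpha>)
  then show ?thesis
    using assms(2) g by (auto simp: \<Omega>\<^sub>\<alpha>_def I\<^sub>\<alpha>_def split: if_splits)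
qed

lemma emeasure_\<nu>\<^sub>\<alpha>:
  assumes "\<alpha> \<in> {golden_g..golden_G}" "E \<in> sets (restrict_space borel (I\<^sub>\<alpha> \<alpha>))"
  shows "emeasure (\<nu>\<^sub>\<alpha> \<alpha>) E = emeasure (normalized_\<mu>\<^sub>\<alpha> \<alpha>) {(x, y) \<in> \<Omega>\<^sub>\<alpha> \<alpha>. x \<in> E}"
proof -
  have sp: "space (normalized_\<mu>\<^sub>\<alpha> \<alpha>) = \<Omega>\<^sub>\<alpha> \<alpha>"
    by (simp add: normalized_\<mu>\<^sub>\<alpha>_def \<mu>\<^sub>\<alpha>_def space_restrict_space space_scale_measure)
  have "fst \<in> measurable (restrict_space lborel (\<Omega>\<^sub>\<alpha> \<alpha>)) (restrict_space borel (I\<^sub>\<alpha> \<alpha>))"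
    using \<Omega>\<^sub>\<alpha>_fst_in_I\<^sub>\<alpha>[OF assms(1)]
    by (intro measurable_restrict_space2 measurable_restrict_space1)
       (auto simp: space_restrict_space borel_prod[symmetric])
  moreover have "sets (normalized_\<mu>\<^sub>\<alpha> \<alpha>) = sets (restrict_space lborel (\<Omega>\<^sub>\<alpha> \<alpha>))"
    by (simp add: normalized_\<mu>\<^sub>\<alpha>_def \<mu>\<^sub>\<alpha>_def)
  ultimately have "fst \<in> measurable (normalized_\<mu>\<^sub>\<alpha> \<alpha>) (restrict_space borel (I\<^sub>\<alpha> \<alpha>))"
    by (simp cong: measurable_cong_sets)
  then have "emeasure (\<nu>\<^sub>\<alpha> \<alpha>) E = emeasure (normalized_\<mu>\<^sub>\<alpha> \<alpha>) (fst -` E \<inter> \<Omega>\<^sub>\<alpha> \<alpha>)"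
    using assms(2) by (simp add: \<nu>\<^sub>\<alpha>_def emeasure_distr sp)
  also have "fst -` E \<inter> \<Omega>\<^sub>\<alpha> \<alpha> = {(x, y) \<in> \<Omega>\<^sub>\<alpha> \<alpha>. x \<in> E}"
    by auto
  finally show ?thesis .
qed

end

theory Submission
  imports Defs
begin

text \<open>
  Invariance. Up to null sets the natural extension domain is a union of three rectangles with
  corners given by formulas uniform in \<open>\<alpha>\<close>. Integrating out \<open>y\<close> gives an explicit density, and for it
  the Perron-Frobenius equation is a telescoping sum over the odd digits.

  Exactness. The product \<open>\<bar>x \<phi>(x)\<bar>\<close> is at most \<open>9/10\<close> on the interval, so inverse branches of order
  \<open>n\<close> contract like \<open>(9/10)\<^sup>n\<close> and have bounded distortion. Pulling back a short interval along an
  orbit can only fail when the orbit comes exponentially close to an end point; by invariance this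
  is rare, uniformly in \<open>n\<close>. Every interval contains a full cylinder, by a Euclidean descent on the
  rationals. Hence the full cylinders of order \<open>n\<close> have total measure bounded below for infinitely
  many \<open>n\<close>. A tail set \<open>A = \<phi>\<^sup>-\<^sup>n(B\<^sub>n)\<close> occupies, by bounded distortion, a definite proportion of each of
  them, and so does its complement unless one of the two is null. But compact subsets of \<open>A\<close> and of its
  complement have positive distance, and short cylinders cannot meet both, a contradiction.

  Mixing. For an exact transformation the conditional expectations of an indicator function given
  \<open>\<phi>\<^sup>-\<^sup>n\<B>\<close> converge in mean to a constant. This makes mixing uniform over the later event, and mixing
  of all orders follows by induction.
\<close>

section \<open>Exact transformations are mixing of all orders\<close>

text \<open>Unless \<alpha> = 1, the interval contains points of modulus above 1, where the map
  contracts locally and a single inverse branch expands. The derivative of a branch of order n is,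
  up to sign, x_0^2 ... x_(n-1)^2 along the orbit; regrouped as |x_0| |x_0 x_1| ... |x_(n-2)
  x_(n-1)| |x_(n-1)| it consists of products of neighbours, which do have a uniform bound below 1.
  The second obstacle is that for general \<alpha> the partition by digits is not Markov: images of
  cylinders end at points of the orbits of the two end points. Branches are therefore attached to an
  arbitrary set K on which all their intermediate values stay inside the interval. If K runs through
  the cells of a fine subdivision, the loss at step n is a geometric term times the length of a
  cell, so one subdivision keeps half of the mass for all n at once. One fixed full branch into each
  cell, appended to the branches over that cell, then replaces K by the whole interval at the cost
  of a constant factor. Proportions are measured by Lebesgue measure; the invariant measure enters
  through its invariance and its bounded density.\<close>

lemma measure_preserving_funpow:
  assumes "measure_preserving M T"
  shows "T ^^ n \<in> measurable M M \<and> distr M M (T ^^ n) = M"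
proof (induction n)
  case (Suc n)
  have T: "T \<in> measurable M M" "distr M M T = M"
    using assms by (auto simp: measure_preserving_def)
  have m: "T ^^ n \<in> measurable M M" and d: "distr M M (T ^^ n) = M" using Suc by auto
  have "distr M M (T ^^ Suc n) = distr (distr M M (T ^^ n)) M T"
    by (subst distr_distr[OF T(1) m]) simp
  then have "distr M M (T ^^ Suc n) = M" unfolding d T(2) .
  moreover have "T ^^ Suc n \<in> measurable M M"
    using measurable_comp[OF m T(1)] by simp
  ultimately show ?case by blast
qed (simp add: id_def)

section \<open>Conditional expectations along a trivial tail\<close>

context prob_space
begin

text \<open>The variance of |X| is nonnegative; this turns convergence in mean square into
  convergence in mean.\<close>

lemma expectation_abs_le_sqrt:
  fixes X :: "'a \<Rightarrow> real"
  assumes [measurable]: "X \<in> borel_measurable M" and "\<And>x. \<bar>X x\<bar> \<le> B"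
  shows "expectation (\<lambda>x. \<bar>X x\<bar>) \<le> sqrt (expectation (\<lambda>x. (X x)\<^sup>2))"
proof -
  have i1: "integrable M (\<lambda>x. \<bar>X x\<bar>)"
    using assms(2) by (intro integrable_const_bound[where B=B]) auto
  have "\<bar>X x\<bar>\<^sup>2 \<le> B\<^sup>2" for x
    by (rule power_mono) (use assms(2) in auto)
  then have i2: "integrable M (\<lambda>x. \<bar>X x\<bar>\<^sup>2)"
    by (intro integrable_const_bound[where B="B\<^sup>2"]) auto
  have "0 \<le> variance (\<lambda>x. \<bar>X x\<bar>)"
    by (rule variance_positive)
  also have "\<dots> = expectation (\<lambda>x. \<bar>X x\<bar>\<^sup>2) - (expectation (\<lambda>x. \<bar>X x\<bar>))\<^sup>2"
    by (rule variance_eq[OF i1 i2])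
  finally show ?thesis
    by (intro real_le_rsqrt) simp
qed

text \<open>
  The reverse martingale theorem, in the special case of a trivial tail: the conditional
  expectations are orthogonal projections, so their square norms decrease; a subsequence
  converges almost everywhere, and its limit is tail measurable.
\<close>

lemma trivial_tail_projections_tend_to_mean:
  fixes F :: "nat \<Rightarrow> 'a measure" and f :: "'a \<Rightarrow> real"
  assumes sub: "\<And>n. subalgebra M (F n)"
    and dec: "\<And>n m. n \<le> m \<Longrightarrow> sets (F m) \<subseteq> sets (F n)"
    and f[measurable]: "f \<in> borel_measurable M" and f01: "\<And>x. 0 \<le> f x \<and> f x \<le> 1"
    and triv: "\<And>A. (\<And>n. A \<in> sets (F n)) \<Longrightarrow> prob A = 0 \<or> prob A = 1"
  obtains p :: "nat \<Rightarrow> 'a \<Rightarrow> real" where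
    "\<And>n. p n \<in> borel_measurable M" "\<And>n x. 0 \<le> p n x \<and> p n x \<le> 1"
    "\<And>n A. A \<in> sets (F n) \<Longrightarrow> (\<integral>x. indicator A x * p n x \<partial>M) = (\<integral>x. indicator A x * f x \<partial>M)"
    "(\<lambda>n. \<integral>x. \<bar>p n x - expectation f\<bar> \<partial>M) \<longlonglongrightarrow> 0"
proof -
  \<comment> \<open>\<open>real_cond_exp\<close> obeys the bounds 0 and 1 only almost everywhere;
    clamping makes them hold at every point and keeps the function measurable for
    \<open>F n\<close>.\<close>
  define p where "p = (\<lambda>n x. min 1 (max 0 (real_cond_exp M (F n) f x)))"
  have fint: "integrable M f"
    using f01 by (intro integrable_const_bound[where B=1]) auto
  have sF: "space (F n) = space M" for n
    using sub[of n] by (simp add: subalgebra_def)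
  have pF: "p n \<in> borel_measurable (F n)" for n
    unfolding p_def by measurable
  have p01: "0 \<le> p n x \<and> p n x \<le> 1" for n x
    by (auto simp: p_def)
  have pM[measurable]: "p n \<in> borel_measurable M" for n
    by (rule measurable_from_subalg[OF sub pF])
  have sfs: "sigma_finite_subalgebra M (F n)" for n
    by (rule finite_measure_subalgebra_is_sigma_finite)
       (simp add: finite_measure_subalgebra_def finite_measure_subalgebra_axioms_def sub finite_measure_axioms)
  have pAE: "AE x in M. p n x = real_cond_exp M (F n) f x" for n
  proof -
    interpret S: sigma_finite_subalgebra M "F n" by (rule sfs)
    have "AE x in M. real_cond_exp M (F n) f x \<ge> 0"
      using f01 by (intro S.real_cond_exp_ge_c fint) auto
    moreover have "AE x in M. real_cond_exp M (F n) f x \<le> 1"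
      using f01 by (intro S.real_cond_exp_le_c fint) auto
    ultimately show ?thesis by eventually_elim (auto simp: p_def)
  qed
  have key: "(\<integral>x. h x * p n x \<partial>M) = (\<integral>x. h x * f x \<partial>M)"
    if hF: "h \<in> borel_measurable (F n)" and hb: "\<And>x. \<bar>h x\<bar> \<le> B" for h B n
  proof -
    interpret S: sigma_finite_subalgebra M "F n" by (rule sfs)
    have hM[measurable]: "h \<in> borel_measurable M"
      by (rule measurable_from_subalg[OF sub hF])
    have "\<bar>h x * f x\<bar> \<le> B" for x
      using f01[of x] hb[of x] mult_mono[of "\<bar>h x\<bar>" B "\<bar>f x\<bar>" 1] by (auto simp: abs_mult)
    then have "integrable M (\<lambda>x. h x * f x)"
      by (intro integrable_const_bound[where B=B]) auto
    then have "(\<integral>x. h x * real_cond_exp M (F n) f x \<partial>M) = (\<integral>x. h x * f x \<partial>M)"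
      by (rule S.real_cond_exp_intg(2)[OF _ hF f])
    moreover have "(\<integral>x. h x * real_cond_exp M (F n) f x \<partial>M) = (\<integral>x. h x * p n x \<partial>M)"
      using pAE[of n] by (intro integral_cong_AE) auto
    ultimately show ?thesis by simp
  qed
  define c where "c = expectation f"
  define a where "a n = expectation (\<lambda>x. (p n x)\<^sup>2)" for n
  have pint: "integrable M (p n)" for n
    using p01 by (intro integrable_const_bound[where B=1]) auto
  have ppint: "integrable M (\<lambda>x. p n x * p m x)" for n m
    using p01 by (intro integrable_const_bound[where B=1]) (auto simp: abs_mult mult_le_one)
  have pF': "p m \<in> borel_measurable (F n)" if "n \<le> m" for n m
    using pF[of m] dec[OF that] sF by (auto simp: measurable_def)
  have pc: "expectation (p n) = c" for n
    using key[of "\<lambda>_. 1" n 1] by (simp add: c_def)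
  \<comment> \<open>For n \<le> m the function \<open>p m\<close> is measurable for
    \<open>F n\<close> too, so \<open>key\<close> applies to it at both levels: the cross term
    equals the integral of \<open>p m * f\<close>, hence \<open>a m\<close>. This is Pythagoras for
    nested projections.\<close>
  have orth: "expectation (\<lambda>x. (p n x - p m x)\<^sup>2) = a n - a m" if "n \<le> m" for n m
  proof -
    have "(\<integral>x. p m x * p n x \<partial>M) = (\<integral>x. p m x * f x \<partial>M)"
      using p01 by (intro key[of _ _ 1] pF' that) auto
    also have "\<dots> = (\<integral>x. p m x * p m x \<partial>M)"
      using p01 by (intro key[of _ _ 1, symmetric] pF' order_refl) auto
    finally have "(\<integral>x. p m x * p n x \<partial>M) = a m"
      by (simp add: a_def power2_eq_square)
    moreover have "expectation (\<lambda>x. (p n x - p m x)\<^sup>2) =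
        expectation (\<lambda>x. p n x * p n x - 2 * (p m x * p n x) + p m x * p m x)"
      by (simp add: power2_eq_square algebra_simps)
    moreover have "\<dots> = expectation (\<lambda>x. p n x * p n x) - 2 * (\<integral>x. p m x * p n x \<partial>M)
        + expectation (\<lambda>x. p m x * p m x)"
      using ppint by simp
    ultimately show ?thesis
      by (simp add: a_def power2_eq_square)
  qed
  have adec: "a m \<le> a n" if "n \<le> m" for n m
  proof -
    have "0 \<le> expectation (\<lambda>x. (p n x - p m x)\<^sup>2)" by simp
    then show ?thesis using orth[OF that] by simp
  qed
  have "decseq a" using adec by (auto simp: decseq_def)
  moreover have "0 \<le> a n" for n by (simp add: a_def)
  ultimately obtain l where al: "a \<longlonglongrightarrow> l" and al': "\<And>i. l \<le> a i"
    using decseq_convergent[of a 0] by blast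
  have ex: "\<exists>n>N. a n < l + (1/4)^k" for N k
  proof -
    have "\<forall>\<^sub>F n in sequentially. a n < l + (1/4)^k"
      using al by (rule order_tendstoD) simp
    moreover have "\<forall>\<^sub>F n in sequentially. n > N" by (rule eventually_gt_at_top)
    ultimately have "\<forall>\<^sub>F n in sequentially. n > N \<and> a n < l + (1/4)^k" by eventually_elim auto
    then show ?thesis by (auto simp: eventually_sequentially)
  qed
  \<comment> \<open>Along r, consecutive differences have square norm at most (1/4)^k, hence mean
    modulus at most (1/2)^k. The means are summable, which gives convergence almost
    everywhere.\<close>
  have "\<exists>r. \<forall>k. a (r k) < l + (1/4)^k \<and> r k < r (Suc k)"
  proof (rule dependent_nat_choice)
    show "\<exists>x. a x < l + (1/4)^0" using ex[of 0 0] by auto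
    show "\<exists>y. a y < l + (1/4)^Suc n \<and> x < y" for x n using ex[of x "Suc n"] by auto
  qed
  then obtain r where ra: "\<And>k. a (r k) < l + (1/4)^k" and rm: "\<And>k. r k < r (Suc k)"
    by blast
  have rs: "strict_mono r" using rm by (simp add: strict_mono_Suc_iff)
  have rk: "k \<le> r k" for k by (rule strict_mono_imp_increasing[OF rs])
  have step: "expectation (\<lambda>x. \<bar>p (r k) x - p (r (Suc k)) x\<bar>) \<le> (1/2)^k" for k
  proof -
    have "expectation (\<lambda>x. \<bar>p (r k) x - p (r (Suc k)) x\<bar>)
        \<le> sqrt (expectation (\<lambda>x. (p (r k) x - p (r (Suc k)) x)\<^sup>2))"
    proof (rule expectation_abs_le_sqrt[where B=1])
      show "\<bar>p (r k) x - p (r (Suc k)) x\<bar> \<le> 1" for x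
        using p01[of "r k" x] p01[of "r (Suc k)" x] by auto
    qed simp
    also have "\<dots> = sqrt (a (r k) - a (r (Suc k)))"
      using orth[of "r k" "r (Suc k)"] rm[of k] by simp
    also have "\<dots> \<le> sqrt ((1/4)^k)"
      using ra[of k] al'[of "r (Suc k)"] by (intro real_sqrt_le_mono) simp
    also have "\<dots> = (1/2)^k"
      by (simp add: real_sqrt_power real_sqrt_divide)
    finally show ?thesis .
  qed
  have "(\<integral>\<^sup>+x. (\<Sum>k. ennreal \<bar>p (r k) x - p (r (Suc k)) x\<bar>) \<partial>M)
      = (\<Sum>k. \<integral>\<^sup>+x. ennreal \<bar>p (r k) x - p (r (Suc k)) x\<bar> \<partial>M)"
    by (rule nn_integral_suminf) simp
  also have "\<dots> = (\<Sum>k. ennreal (expectation (\<lambda>x. \<bar>p (r k) x - p (r (Suc k)) x\<bar>)))"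
    using pint by (intro suminf_cong nn_integral_eq_integral) auto
  also have "\<dots> \<le> (\<Sum>k. ennreal ((1/2)^k))"
    using step by (intro suminf_le ennreal_leI) auto
  also have "\<dots> = ennreal (\<Sum>k. (1/2)^k)"
    by (rule suminf_ennreal2) auto
  also have "\<dots> < \<infinity>" by simp
  finally have "AE x in M. (\<Sum>k. ennreal \<bar>p (r k) x - p (r (Suc k)) x\<bar>) \<noteq> \<infinity>"
    by (intro nn_integral_noteq_infinite) auto
  then have conv: "AE x in M. convergent (\<lambda>k. p (r k) x)"
  proof eventually_elim
    fix x assume "(\<Sum>k. ennreal \<bar>p (r k) x - p (r (Suc k)) x\<bar>) \<noteq> \<infinity>"
    then have "summable (\<lambda>k. \<bar>p (r k) x - p (r (Suc k)) x\<bar>)"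
      by (intro summable_suminf_not_top) auto
    then have "summable (\<lambda>k. p (r k) x - p (r (Suc k)) x)"
      by (rule summable_rabs_cancel)
    then have "convergent (\<lambda>n. \<Sum>k<n. p (r k) x - p (r (Suc k)) x)"
      by (simp add: summable_iff_convergent)
    then have "convergent (\<lambda>n. p (r 0) x - (\<Sum>k<n. p (r k) x - p (r (Suc k)) x))"
      by (intro convergent_diff convergent_const)
    moreover have "(\<Sum>k<n. p (r k) x - p (r (Suc k)) x) = p (r 0) x - p (r n) x" for n
      by (rule sum_lessThan_telescope')
    ultimately show "convergent (\<lambda>k. p (r k) x)" by simp
  qed
  define q where "q x = lim (\<lambda>k. p (r k) x)" for x
  \<comment> \<open>Dropping the first n terms leaves functions measurable for \<open>F n\<close>,
    since k \<le> r k. Divergence does no harm: a sequence and its shift have the same limits, so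
    \<open>lim\<close> returns the same value for both.\<close>
  have qF: "q \<in> borel_measurable (F n)" for n
  proof -
    have "lim (\<lambda>k. p (r k) x) = lim (\<lambda>k. p (r (k + n)) x)" for x
      unfolding lim_def
      using LIMSEQ_ignore_initial_segment[of "\<lambda>k. p (r k) x" _ n]
        LIMSEQ_offset[of "\<lambda>k. p (r k) x" n] by metis
    then have "q = (\<lambda>x. lim (\<lambda>k. p (r (k + n)) x))" by (auto simp: q_def)
    also have "\<dots> \<in> borel_measurable (F n)"
    proof (rule borel_measurable_lim_metric)
      show "p (r (k + n)) \<in> borel_measurable (F n)" for k
        using rk[of "k + n"] by (intro pF') simp
    qed
    finally show ?thesis .
  qed
  have qM[measurable]: "q \<in> borel_measurable M"
    by (rule measurable_from_subalg[OF sub qF])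
  have tq: "AE x in M. (\<lambda>k. p (r k) x) \<longlonglongrightarrow> q x"
    using conv by eventually_elim (simp add: q_def convergent_LIMSEQ_iff)
  have q01: "AE x in M. 0 \<le> q x \<and> q x \<le> 1"
    using tq
  proof eventually_elim
    case (elim x)
    show ?case using p01
      by (auto intro: LIMSEQ_le_const[OF elim] LIMSEQ_le_const2[OF elim])
  qed
  have qint: "integrable M q"
    using q01 by (intro integrable_const_bound[where B=1]) auto
  have "(\<lambda>k. expectation (p (r k))) \<longlonglongrightarrow> expectation q"
    using tq p01 by (intro integral_dominated_convergence[where w="\<lambda>_. 1"]) auto
  then have qc: "expectation q = c"
    by (simp add: pc LIMSEQ_const_iff)
  \<comment> \<open>The event is in the tail, and probability 1 would push the mean of q above c. As
    the mean is c, the one-sided bound q \<le> c forces q = c.\<close>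
  have "AE x in M. \<not> q x > c + 1 / real (Suc j)" for j
  proof -
    let ?A = "{x \<in> space M. q x > c + 1 / real (Suc j)}"
    have "?A \<in> sets (F n)" for n
      using qF[of n] sF[of n] by (metis (no_types) borel_measurable_iff_greater)
    then have "prob ?A = 0 \<or> prob ?A = 1" by (rule triv)
    moreover have False if "prob ?A = 1"
    proof -
      have "AE x in M. q x > c + 1 / real (Suc j)"
        using that by (subst (asm) prob_Collect_eq_1) auto
      then have "expectation (\<lambda>_. c + 1 / real (Suc j)) \<le> expectation q"
        by (intro integral_mono_AE qint) auto
      then show False using qc by (simp add: prob_space)
    qed
    ultimately show ?thesis
      by (subst (asm) prob_Collect_eq_0) auto
  qed
  then have "AE x in M. \<forall>j. \<not> q x > c + 1 / real (Suc j)"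
    by (simp add: AE_all_countable)
  then have qle: "AE x in M. 0 \<le> c - q x"
  proof eventually_elim
    case (elim x)
    show ?case
    proof (rule ccontr)
      assume "\<not> 0 \<le> c - q x"
      then obtain j where "1 / real (Suc j) < q x - c"
        using reals_Archimedean[of "q x - c"] by (auto simp: inverse_eq_divide)
      with elim show False by (metis add.commute less_diff_eq)
    qed
  qed
  have "expectation (\<lambda>x. c - q x) = 0"
    using qint qc by (simp add: prob_space)
  then have "AE x in M. c - q x = 0"
    using qle qint by (subst (asm) integral_nonneg_eq_0_iff_AE) auto
  with tq have tc: "AE x in M. (\<lambda>k. p (r k) x) \<longlonglongrightarrow> c"
    by eventually_elim auto
  define v where "v n = expectation (\<lambda>x. (p n x - c)\<^sup>2)" for n
  have c01: "0 \<le> c" "c \<le> 1"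
  proof -
    show "0 \<le> c" unfolding c_def using f01 by (intro Bochner_Integration.integral_nonneg) auto
    have "c \<le> expectation (\<lambda>_. 1)"
      unfolding c_def using f01 fint by (intro integral_mono) auto
    then show "c \<le> 1" by (simp add: prob_space)
  qed
  have pcb: "\<bar>p n x - c\<bar> \<le> 1" for n x
    using p01[of n x] c01 by auto
  \<comment> \<open>\<open>v\<close> and \<open>a\<close> differ by a constant, so \<open>v\<close>
    converges along the whole sequence because \<open>a\<close> does; the subsequence identifies the
    limit as 0.\<close>
  have veq: "v n = a n - c\<^sup>2" for n
  proof -
    have "v n = expectation (\<lambda>x. p n x * p n x - 2 * c * p n x + c * c)"
      by (simp add: v_def power2_eq_square algebra_simps)
    also have "\<dots> = expectation (\<lambda>x. p n x * p n x) - 2 * c * expectation (p n) + c * c"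
      using ppint pint by (simp add: prob_space)
    finally show ?thesis
      by (simp add: pc a_def power2_eq_square)
  qed
  have "(\<lambda>k. v (r k)) \<longlonglongrightarrow> expectation (\<lambda>_. 0)"
    unfolding v_def
  proof (rule integral_dominated_convergence[where w="\<lambda>_. 1"])
    show "AE x in M. (\<lambda>k. (p (r k) x - c)\<^sup>2) \<longlonglongrightarrow> 0"
      using tc
    proof eventually_elim
      case (elim x)
      then have "(\<lambda>k. (p (r k) x - c)\<^sup>2) \<longlonglongrightarrow> (c - c)\<^sup>2"
        by (intro tendsto_intros)
      then show ?case by simp
    qed
    show "AE x in M. norm ((p (r k) x - c)\<^sup>2) \<le> 1" for k
      using pcb by (simp add: abs_square_le_1)
  qed auto
  then have "(\<lambda>k. v (r k)) \<longlonglongrightarrow> 0" by simp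
  moreover have "(\<lambda>k. v (r k)) \<longlonglongrightarrow> l - c\<^sup>2"
    unfolding veq using LIMSEQ_subseq_LIMSEQ[OF al rs] by (intro tendsto_intros) (simp add: o_def)
  ultimately have "l - c\<^sup>2 = 0" by (rule LIMSEQ_unique[symmetric])
  moreover have "v \<longlonglongrightarrow> l - c\<^sup>2"
    unfolding veq[abs_def] using al by (intro tendsto_intros)
  ultimately have "v \<longlonglongrightarrow> 0" by simp
  then have sv: "(\<lambda>n. sqrt (v n)) \<longlonglongrightarrow> 0"
    using tendsto_real_sqrt by force
  have "(\<lambda>n. \<integral>x. \<bar>p n x - expectation f\<bar> \<partial>M) \<longlonglongrightarrow> 0"
  proof (rule tendsto_sandwich[OF _ _ tendsto_const sv])
    show "\<forall>\<^sub>F n in sequentially. (\<integral>x. \<bar>p n x - expectation f\<bar> \<partial>M) \<le> sqrt (v n)"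
      unfolding v_def c_def[symmetric]
      using pcb by (intro always_eventually allI expectation_abs_le_sqrt[where B=1]) auto
  qed simp
  moreover have "(\<integral>x. indicator A x * p n x \<partial>M) = (\<integral>x. indicator A x * f x \<partial>M)"
    if "A \<in> sets (F n)" for A n
    using that by (intro key[of _ _ 1]) (auto simp: indicator_def)
  ultimately show ?thesis
    using that[of p] pM p01 by blast
qed

end

section \<open>From exactness to mixing\<close>

text \<open>N is chosen before B. With \<open>p n\<close> the conditional expectation of the
  indicator of A, the defect is the integral of \<open>p n - measure M A\<close> over the n-th
  preimage of B, so it is at most an L1 norm that does not involve B.\<close>

lemma exact_imp_uniform_mixing:
  assumes mp: "measure_preserving M T" and ex: "exact_transformation M T" and A: "A \<in> sets M"
    and e: "0 < e"
  shows "\<exists>N. \<forall>n\<ge>N. \<forall>B\<in>sets M.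
    \<bar>measure M (A \<inter> ((T ^^ n) -` B \<inter> space M)) - measure M A * measure M B\<bar> < e"
proof -
  interpret prob_space M using mp by (simp add: measure_preserving_def)
  have Tn[measurable]: "T ^^ n \<in> measurable M M" and dTn: "distr M M (T ^^ n) = M" for n
    using measure_preserving_funpow[OF mp] by auto
  have T[measurable]: "T \<in> measurable M M"
    using mp by (simp add: measure_preserving_def)
  define F where "F n = vimage_algebra (space M) (T ^^ n) M" for n
  have TnS: "T ^^ n \<in> space M \<rightarrow> space M" for n
    using measurable_space[OF Tn] by auto
  have setsF: "sets (F n) = {(T ^^ n) -` B \<inter> space M |B. B \<in> sets M}" for n
    unfolding F_def by (rule sets_vimage_algebra2[OF TnS])
  have sub: "subalgebra M (F n)" for n
    unfolding subalgebra_def using setsF[of n] by (auto simp: F_def)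
  have dec1: "sets (F (Suc n)) \<subseteq> sets (F n)" for n
  proof
    fix X assume "X \<in> sets (F (Suc n))"
    then obtain B where B: "B \<in> sets M" "X = (T ^^ Suc n) -` B \<inter> space M"
      by (auto simp: setsF)
    then have "X = (T ^^ n) -` (T -` B \<inter> space M) \<inter> space M"
      using TnS[of n] by auto
    moreover have "T -` B \<inter> space M \<in> sets M" using B by simp
    ultimately show "X \<in> sets (F n)" unfolding setsF by blast
  qed
  have dec: "sets (F m) \<subseteq> sets (F n)" if "n \<le> m" for n m
    using that by (induction m rule: dec_induct) (use dec1 in auto)
  have triv: "prob X = 0 \<or> prob X = 1" if "\<And>n. X \<in> sets (F n)" for X
  proof -
    have "X \<in> tail_sigma_algebra M T"
      using that by (auto simp: tail_sigma_algebra_def setsF)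
    then have "emeasure M X = 0 \<or> emeasure M (space M - X) = 0"
      using ex by (auto simp: exact_transformation_def)
    moreover have "X \<in> sets M" using that[of 0] sub[of 0] by (auto simp: subalgebra_def)
    ultimately show ?thesis
      using prob_compl[of X] by (auto simp: measure_def)
  qed
  have iA: "(indicator A :: _ \<Rightarrow> real) \<in> borel_measurable M"
    using A by simp
  have iA01: "0 \<le> (indicator A x :: real) \<and> indicator A x \<le> (1 :: real)" for x
    by simp
  obtain p where pM[measurable]: "\<And>n. p n \<in> borel_measurable M"
    and p01: "\<And>n x. 0 \<le> p n x \<and> p n x \<le> (1 :: real)"
    and key: "\<And>n X. X \<in> sets (F n) \<Longrightarrow>
      (\<integral>x. indicator X x * p n x \<partial>M) = (\<integral>x. indicator X x * indicator A x \<partial>M)"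
    and lim: "(\<lambda>n. \<integral>x. \<bar>p n x - expectation (indicator A)\<bar> \<partial>M) \<longlonglongrightarrow> 0"
    using trivial_tail_projections_tend_to_mean[where F=F, OF sub dec iA iA01 triv] by blast
  have c: "expectation (indicator A) = measure M A"
    using A by (simp add: sets.Int_space_eq2)
  obtain N where N: "\<And>n. n \<ge> N \<Longrightarrow> (\<integral>x. \<bar>p n x - measure M A\<bar> \<partial>M) < e"
    using order_tendstoD(2)[OF lim[unfolded c] e] unfolding eventually_sequentially by blast
  show ?thesis
  proof (intro exI allI impI ballI)
    fix n B assume n: "N \<le> n" and B: "B \<in> sets M"
    define X where "X = (T ^^ n) -` B \<inter> space M"
    have XM[measurable]: "X \<in> sets M" using B by (simp add: X_def)
    have pX: "prob X = prob B"
      using B measure_distr[OF Tn B, of n] by (simp add: dTn X_def)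
    have "X \<in> sets (F n)" using B by (auto simp: setsF X_def)
    note key[OF this]
    also have "(\<integral>x. indicator X x * indicator A x \<partial>M) = prob (A \<inter> X)"
    proof -
      have "(\<lambda>x. indicator X x * indicator A x) = (indicator (A \<inter> X) :: _ \<Rightarrow> real)"
        by (auto simp: fun_eq_iff split: split_indicator)
      then show ?thesis using A XM by (simp add: sets.Int_space_eq2)
    qed
    finally have 1: "(\<integral>x. indicator X x * p n x \<partial>M) = prob (A \<inter> X)" .
    have pint: "integrable M (p n)"
      using p01 by (intro integrable_const_bound[where B=1]) auto
    have ipint: "integrable M (\<lambda>x. indicator X x * p n x)"
      using p01 by (intro integrable_const_bound[where B=1]) (auto split: split_indicator)
    have iint: "integrable M (indicator X :: _ \<Rightarrow> real)"
      by (intro integrable_const_bound[where B=1]) auto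
    have "(\<integral>x. indicator X x * (p n x - prob A) \<partial>M)
        = (\<integral>x. indicator X x * p n x - prob A * indicator X x \<partial>M)"
      by (simp add: algebra_simps)
    also have "\<dots> = prob (A \<inter> X) - prob A * prob X"
      using ipint iint by (simp add: 1 sets.Int_space_eq2)
    finally have 2: "(\<integral>x. indicator X x * (p n x - prob A) \<partial>M) = prob (A \<inter> X) - prob A * prob B"
      by (simp add: pX)
    have "\<bar>\<integral>x. indicator X x * (p n x - prob A) \<partial>M\<bar> \<le> (\<integral>x. \<bar>indicator X x * (p n x - prob A)\<bar> \<partial>M)"
      by (rule integral_abs_bound)
    also have "\<dots> \<le> (\<integral>x. \<bar>p n x - prob A\<bar> \<partial>M)"
    proof (rule integral_mono')
      show "integrable M (\<lambda>x. \<bar>p n x - prob A\<bar>)" using pint by auto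
    qed (auto split: split_indicator)
    also have "\<dots> < e" by (rule N[OF n])
    finally show "\<bar>prob (A \<inter> ((T ^^ n) -` B \<inter> space M)) - prob A * prob B\<bar> < e"
      using 2 by (simp add: X_def)
  qed
qed

text \<open>All sets but the first are pulled back along \<open>T ^^ n 1\<close> from one event B
  that changes with the gaps; this is why two-set mixing has to be uniform in the later event.
  Splitting off the first set costs e/2, the induction hypothesis for B another e/2.\<close>

theorem exact_imp_mixing_of_all_orders:
  assumes mp: "measure_preserving M T" and ex: "exact_transformation M T"
  shows "mixing_of_all_orders M T"
proof -
  interpret prob_space M using mp by (simp add: measure_preserving_def)
  have Tn[measurable]: "T ^^ n \<in> measurable M M" for n
    using measure_preserving_funpow[OF mp] by blast
  have "mixing_of_order r M T" for r
  proof (induction r)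
    case 0
    show ?case
      unfolding mixing_of_order_def by (auto simp: sets.Int_space_eq2)
  next
    case (Suc r)
    show ?case
      unfolding mixing_of_order_def
    proof (intro allI impI)
      fix A :: "nat \<Rightarrow> 'a set" and e :: real
      assume A: "\<forall>i\<le>Suc r. A i \<in> sets M" and e: "0 < e"
      have A0: "A 0 \<in> sets M" using A by simp
      obtain N1 where N1: "\<And>n B. n \<ge> N1 \<Longrightarrow> B \<in> sets M \<Longrightarrow>
          \<bar>measure M (A 0 \<inter> ((T ^^ n) -` B \<inter> space M)) - measure M (A 0) * measure M B\<bar> < e / 2"
        using exact_imp_uniform_mixing[OF mp ex A0, of "e / 2"] e by auto
      have "\<forall>i\<le>r. A (Suc i) \<in> sets M" using A by simp
      with Suc obtain N2 where N2: "\<And>n :: nat \<Rightarrow> nat. n 0 = 0 \<and> (\<forall>i<r. n i + N2 \<le> n (Suc i)) \<Longrightarrow>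
          \<bar>measure M (\<Inter>i\<le>r. (T ^^ n i) -` A (Suc i) \<inter> space M) - (\<Prod>i\<le>r. measure M (A (Suc i)))\<bar> < e / 2"
        unfolding mixing_of_order_def using half_gt_zero[OF e] by (elim allE[of _ "\<lambda>i. A (Suc i)"]) blast
      show "\<exists>N. \<forall>n :: nat \<Rightarrow> nat. n 0 = 0 \<and> (\<forall>i<Suc r. n i + N \<le> n (Suc i)) \<longrightarrow>
          \<bar>measure M (\<Inter>i\<le>Suc r. (T ^^ n i) -` A i \<inter> space M) - (\<Prod>i\<le>Suc r. measure M (A i))\<bar> < e"
      proof (intro exI[of _ "max N1 N2"] allI impI)
        fix n :: "nat \<Rightarrow> nat"
        assume n: "n 0 = 0 \<and> (\<forall>i<Suc r. n i + max N1 N2 \<le> n (Suc i))"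
        \<comment> \<open>A subtraction of natural numbers; by \<open>ge\<close> it never
          truncates.\<close>
        define n' where "n' i = n (Suc i) - n 1" for i
        have ge: "i \<le> r \<Longrightarrow> n 1 \<le> n (Suc i)" for i
        proof (induction i)
          case (Suc i)
          then have "n (Suc i) + max N1 N2 \<le> n (Suc (Suc i))" using n by auto
          with Suc show ?case by auto
        qed simp
        define B where "B = (\<Inter>i\<le>r. (T ^^ n' i) -` A (Suc i) \<inter> space M)"
        have BM: "B \<in> sets M"
          unfolding B_def using A by (intro sets.finite_INT) auto
        have n'i: "n' 0 = 0 \<and> (\<forall>i<r. n' i + N2 \<le> n' (Suc i))"
        proof (intro conjI allI impI)
          show "n' 0 = 0" by (simp add: n'_def)
          fix i assume i: "i < r"
          then have "n (Suc i) + max N1 N2 \<le> n (Suc (Suc i))" using n by auto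
          then have "n (Suc i) + N2 \<le> n (Suc (Suc i))" by linarith
          moreover have "n 1 \<le> n (Suc i)" using ge[of i] i by auto
          ultimately show "n' i + N2 \<le> n' (Suc i)" unfolding n'_def by linarith
        qed
        have b2: "\<bar>measure M B - (\<Prod>i\<le>r. measure M (A (Suc i)))\<bar> < e / 2"
          unfolding B_def by (rule N2[OF n'i])
        have "n 0 + max N1 N2 \<le> n (Suc 0)" using n by blast
        then have "N1 \<le> n 1" using n by simp
        from N1[OF this BM]
        have b1: "\<bar>measure M (A 0 \<inter> ((T ^^ n 1) -` B \<inter> space M)) - measure M (A 0) * measure M B\<bar> < e / 2" .
        have Tadd: "(T ^^ n' i) ((T ^^ n 1) x) = (T ^^ n (Suc i)) x" if "i \<le> r" for i x
          using ge[OF that] by (metis add.commute comp_apply funpow_add le_add_diff_inverse n'_def)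
        have eq: "(\<Inter>i\<le>Suc r. (T ^^ n i) -` A i \<inter> space M) = A 0 \<inter> ((T ^^ n 1) -` B \<inter> space M)"
        proof (rule set_eqI)
          fix x
          have "x \<in> (\<Inter>i\<le>Suc r. (T ^^ n i) -` A i \<inter> space M)
              \<longleftrightarrow> (x \<in> A 0 \<and> x \<in> space M) \<and> (\<forall>i\<le>r. (T ^^ n (Suc i)) x \<in> A (Suc i) \<and> x \<in> space M)"
            using n by (auto simp: atMost_Suc_eq_insert_0)
          also have "\<dots> \<longleftrightarrow> x \<in> A 0 \<inter> ((T ^^ n 1) -` B \<inter> space M)"
            using measurable_space[OF Tn, of x "n 1"] Tadd by (auto simp: B_def)
          finally show "x \<in> (\<Inter>i\<le>Suc r. (T ^^ n i) -` A i \<inter> space M)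
              \<longleftrightarrow> x \<in> A 0 \<inter> ((T ^^ n 1) -` B \<inter> space M)" .
        qed
        have "\<bar>measure M (A 0) * measure M B - measure M (A 0) * (\<Prod>i\<le>r. measure M (A (Suc i)))\<bar>
            = measure M (A 0) * \<bar>measure M B - (\<Prod>i\<le>r. measure M (A (Suc i)))\<bar>"
          by (simp add: abs_mult flip: right_diff_distrib)
        also have "\<dots> \<le> 1 * \<bar>measure M B - (\<Prod>i\<le>r. measure M (A (Suc i)))\<bar>"
          by (intro mult_right_mono) auto
        finally have "\<bar>measure M (A 0) * measure M B - measure M (A 0) * (\<Prod>i\<le>r. measure M (A (Suc i)))\<bar> < e / 2"
          using b2 by simp
        then show "\<bar>measure M (\<Inter>i\<le>Suc r. (T ^^ n i) -` A i \<inter> space M) - (\<Prod>i\<le>Suc r. measure M (A i))\<bar> < e"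
          unfolding eq prod.atMost_Suc_shift using b1 by linarith
      qed
    qed
  qed
  then show ?thesis by (simp add: mixing_of_all_orders_def)
qed

section \<open>Digits and inverse branches\<close>

lemma golden_g_sq: "golden_g * golden_g = 1 - golden_g"
  by (simp add: golden_g_def field_simps)

lemma golden_G_eq: "golden_G = 1 + golden_g"
  by (simp add: golden_g_def golden_G_def field_simps)

lemma golden_g_numeric: "309/500 < golden_g" "golden_g < 619/1000"
proof -
  have "2236/1000 < sqrt 5" "sqrt 5 < 2237/1000"
    by (rule real_less_rsqrt real_less_lsqrt; simp add: power2_eq_square)+
  then show "309/500 < golden_g" "golden_g < 619/1000"
    by (simp_all add: golden_g_def)
qed

text \<open>The finite continued fraction s_1/(k_1 + s_2/(k_2 + ... + z)). A letter holds the sign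
  and the digit of an orbit point, the head belonging to the point itself, so applying the map
  removes the head.\<close>

fun inverse_branch :: "(int \<times> int) list \<Rightarrow> real \<Rightarrow> real" where
  "inverse_branch [] z = z"
| "inverse_branch ((s, k) # w) z = of_int s / (of_int k + inverse_branch w z)"

text \<open>The square root of the modulus of the derivative of \<open>inverse_branch w\<close> at
  z. A branch is a Moebius map of determinant 1 or -1, and for such maps the difference quotient of
  two points is exactly the product of these roots (\<open>inverse_branch_diff\<close>).\<close>

fun branch_root_deriv :: "(int \<times> int) list \<Rightarrow> real \<Rightarrow> real" where
  "branch_root_deriv [] z = 1"
| "branch_root_deriv ((s, k) # w) z = branch_root_deriv w z / (of_int k + inverse_branch w z)"

locale odd_cf =
  fixes \<alpha> :: real
  assumes \<alpha>_mem: "\<alpha> \<in> {golden_g..golden_G}"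
begin

abbreviation "I\<^sub>o \<equiv> {\<alpha> - 2<..<\<alpha>}"

text \<open>The quadratic inequalities are g \<le> \<alpha> and \<alpha> \<le> G in polynomial form,
  as g^2 + g = 1 and G^2 = G + 1.\<close>

lemma \<alpha>_bounds: "3/5 < \<alpha>" "\<alpha> < 81/50" "1 \<le> \<alpha> * \<alpha> + \<alpha>" "\<alpha> * \<alpha> \<le> \<alpha> + 1"
proof -
  have g: "golden_g \<le> \<alpha>" "\<alpha> \<le> 1 + golden_g"
    using \<alpha>_mem by (auto simp: golden_G_eq)
  then show "3/5 < \<alpha>" "\<alpha> < 81/50" using golden_g_numeric by linarith+
  have "golden_g * golden_g \<le> \<alpha> * \<alpha>"
    using g golden_bounds by (intro mult_mono) auto
  then show "1 \<le> \<alpha> * \<alpha> + \<alpha>" using g golden_g_sq by linarith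
  have "(1 + golden_g - \<alpha>) * (\<alpha> + golden_g) \<ge> 0"
    using g golden_bounds by (intro mult_nonneg_nonneg) auto
  then show "\<alpha> * \<alpha> \<le> \<alpha> + 1" using golden_g_sq by (simp add: algebra_simps)
qed

lemma d_odd: "odd (d\<^sub>\<alpha> \<alpha> x)"
  by (simp add: d\<^sub>\<alpha>_def)

lemma \<phi>_eq: "x \<noteq> 0 \<Longrightarrow> \<phi>\<^sub>\<alpha> \<alpha> x = 1 / \<bar>x\<bar> - of_int (d\<^sub>\<alpha> \<alpha> x)"
  by (simp add: \<phi>\<^sub>\<alpha>_def)

lemma \<phi>_in_I: "x \<noteq> 0 \<Longrightarrow> \<alpha> - 2 \<le> \<phi>\<^sub>\<alpha> \<alpha> x \<and> \<phi>\<^sub>\<alpha> \<alpha> x < \<alpha>"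
  using \<phi>\<^sub>\<alpha>_in_I\<^sub>\<alpha>[of x \<alpha>] by (simp add: I\<^sub>\<alpha>_def)

lemma odd_ints_close_eq:
  fixes j k :: int
  assumes "odd j" "odd k" "\<bar>real_of_int j - real_of_int k\<bar> < 2"
  shows "j = k"
proof -
  have "\<bar>j - k\<bar> < 2" using assms(3) by linarith
  moreover have "even (j - k)" using assms(1,2) by simp
  ultimately show ?thesis by presburger
qed

text \<open>The target interval has length 2, the gap between consecutive odd numbers.\<close>

lemma d_unique:
  assumes "x \<noteq> 0" "odd k" "\<alpha> - 2 \<le> 1 / \<bar>x\<bar> - of_int k" "1 / \<bar>x\<bar> - of_int k < \<alpha>"
  shows "d\<^sub>\<alpha> \<alpha> x = k"
  using \<phi>_in_I[OF assms(1)] \<phi>_eq[OF assms(1)] assms(3,4)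
  by (intro odd_ints_close_eq d_odd assms) linarith

text \<open>The disjunction excludes only \<open>x = z = \<alpha> = golden_G\<close>, where \<open>k = -1\<close>.\<close>

lemma digit_pos:
  assumes x: "x \<noteq> 0" "\<alpha> - 2 \<le> x" "x \<le> \<alpha>" and z: "z = 1 / \<bar>x\<bar> - of_int k" "z \<le> \<alpha>"
    and "x < \<alpha> \<or> z < \<alpha>" and k: "odd k"
  shows "1 \<le> k"
proof (rule ccontr)
  assume "\<not> 1 \<le> k"
  then have "k \<le> -1" using k by (cases "k = 0") auto
  then have "real_of_int k \<le> -1" by linarith
  then have z1: "1 / \<bar>x\<bar> + 1 \<le> z" using z by linarith
  \<comment> \<open>The inequality \<open>z1\<close> contradicts z \<le> \<alpha>. For x > 0 this
    rests on 1 + 1/\<alpha> \<ge> \<alpha>, with equality only at G, where the strict inequality in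
    the hypothesis decides; for x < 0 on 1 + 1/(2 - \<alpha>) > \<alpha>.\<close>
  show False
  proof (cases "x > 0")
    case True
    have "1 / \<alpha> \<le> 1 / x" using True x by (intro divide_left_mono) auto
    moreover have "\<alpha> \<le> 1 / \<alpha> + 1" using \<alpha>_bounds by (simp add: field_simps)
    moreover have "1 / \<alpha> < 1 / x" if "x < \<alpha>" using True that by (intro divide_strict_left_mono) auto
    ultimately show False using assms z1 True by auto
  next
    case False
    then have "1 / (2 - \<alpha>) \<le> 1 / \<bar>x\<bar>"
      using x \<alpha>_bounds by (intro divide_left_mono mult_pos_pos) auto
    moreover have "\<alpha> - 1 < 1 / (2 - \<alpha>)"
    proof -
      have "(\<alpha> - 1) * (2 - \<alpha>) = 1/4 - (\<alpha> - 3/2)\<^sup>2" by (simp add: power2_eq_square algebra_simps)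
      also have "\<dots> < 1" using zero_le_power2[of "\<alpha> - 3/2"] by linarith
      finally show ?thesis using \<alpha>_bounds by (simp add: field_simps)
    qed
    ultimately show False using z z1 by linarith
  qed
qed

lemma d_pos:
  assumes "x \<in> I\<^sub>\<alpha> \<alpha>" "x \<noteq> 0"
  shows "1 \<le> d\<^sub>\<alpha> \<alpha> x"
  using assms \<phi>_in_I[of x] \<phi>_eq[of x] by (intro digit_pos[of x "\<phi>\<^sub>\<alpha> \<alpha> x"] d_odd) (auto simp: I\<^sub>\<alpha>_def)

text \<open>|x z| is |z|/(k + z). For k = 1 the bound |x| \<le> 81/50 keeps 1 + z away from 0; for k
  \<ge> 3 the worst case is k = 3 with z near -7/5, where the quotient is close to 7/8.\<close>

lemma abs_mult_next_le:
  fixes k :: int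
  assumes x: "\<alpha> - 2 \<le> x" "x \<le> \<alpha>" and z: "\<alpha> - 2 \<le> z" "z \<le> \<alpha>"
    and k: "1 \<le> k" "odd k" and kz: "0 < of_int k + z" and s: "\<bar>s\<bar> = 1" and xz: "x = s / (of_int k + z)"
  shows "\<bar>x * z\<bar> \<le> 9/10"
proof -
  have ax: "\<bar>x\<bar> = 1 / (of_int k + z)" using s kz xz by (simp add: abs_divide)
  have "\<bar>x\<bar> \<le> 81/50" using x \<alpha>_bounds by (auto simp: abs_if)
  then have lb: "1 \<le> 81/50 * (of_int k + z)" using kz unfolding ax by (simp add: field_simps)
  have "\<bar>z\<bar> \<le> 9/10 * (of_int k + z)"
  proof (cases "k = 1")
    case True
    then show ?thesis using lb z \<alpha>_bounds by (auto simp: abs_if)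
  next
    case False
    with k have "3 \<le> k" by (cases "k = 2") auto
    then have "3 \<le> real_of_int k" by linarith
    then show ?thesis using z \<alpha>_bounds by (auto simp: abs_if)
  qed
  then show ?thesis unfolding abs_mult ax using kz by (simp add: field_simps)
qed

text \<open>K is the set of points from which the branch is followed backwards. It is a parameter
  because a branch need not be defined on the whole interval. Positive denominators and intermediate
  values in \<open>I\<^sub>o\<close> make s and k the true signs and digits.\<close>

fun admissible :: "(int \<times> int) list \<Rightarrow> real set \<Rightarrow> bool" where
  "admissible [] K \<longleftrightarrow> K \<subseteq> I\<^sub>o"
| "admissible ((s, k) # w) K \<longleftrightarrow> admissible w K \<and> \<bar>s\<bar> = 1 \<and> odd k \<and> 1 \<le> k \<and>
     (\<forall>z\<in>K. 0 < of_int k + inverse_branch w z \<and> inverse_branch ((s, k) # w) z \<in> I\<^sub>o)"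

lemma inverse_branch_in_Io:
  assumes "admissible w K" "z \<in> K"
  shows "inverse_branch w z \<in> I\<^sub>o"
proof (cases w)
  case (Cons c v)
  then show ?thesis using assms by (cases c) auto
qed (use assms in auto)

lemma inverse_branch_append: "inverse_branch (w @ v) z = inverse_branch w (inverse_branch v z)"
  by (induction w z rule: inverse_branch.induct) auto

lemma admissible_append:
  assumes "admissible w K" "admissible v L" "inverse_branch v ` L \<subseteq> K"
  shows "admissible (w @ v) L"
  using assms
proof (induction w)
  case (Cons c w)
  obtain s k where c: "c = (s, k)" by (cases c)
  have "inverse_branch v z \<in> K" if "z \<in> L" for z using Cons.prems that by auto
  with Cons show ?case by (simp add: c inverse_branch_append)
qed simp

section \<open>Contraction and bounded distortion\<close>

lemma branch_root_deriv_pos: "admissible w K \<Longrightarrow> z \<in> K \<Longrightarrow> 0 < branch_root_deriv w z"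
  by (induction w K rule: admissible.induct) auto

lemma inverse_branch_diff:
  assumes "admissible w K" "z \<in> K" "z' \<in> K"
  shows "\<bar>inverse_branch w z - inverse_branch w z'\<bar>
    = \<bar>z - z'\<bar> * branch_root_deriv w z * branch_root_deriv w z'"
  using assms
proof (induction w K rule: admissible.induct)
  case (2 s k w K)
  let ?y = "inverse_branch w z" and ?y' = "inverse_branch w z'"
  have p: "0 < of_int k + ?y" "0 < of_int k + ?y'" and s: "\<bar>real_of_int s\<bar> = 1"
    using 2 by auto
  have "of_int s / (of_int k + ?y) - of_int s / (of_int k + ?y')
      = of_int s * (?y' - ?y) / ((of_int k + ?y) * (of_int k + ?y'))"
    using p by (simp add: field_simps)
  then have "\<bar>inverse_branch ((s, k) # w) z - inverse_branch ((s, k) # w) z'\<bar>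
      = \<bar>?y - ?y'\<bar> / ((of_int k + ?y) * (of_int k + ?y'))"
    using p s by (simp add: abs_mult abs_minus_commute)
  then show ?case using 2 by simp
qed simp

text \<open>The modulus of \<open>inverse_branch w z\<close> is kept as a separate factor so that
  the next letter can pair it with its own modulus by \<open>abs_mult_next_le\<close>. The exponent
  counts these pairs, and 2 bounds the last modulus, which stays unpaired.\<close>

lemma branch_root_deriv_sq_le_aux:
  assumes "admissible w K" "z \<in> K" "w \<noteq> []"
  shows "(branch_root_deriv w z)\<^sup>2 \<le> \<bar>inverse_branch w z\<bar> * (2 * (9/10) ^ (length w - 1))"
  using assms
proof (induction w K rule: admissible.induct)
  case (2 s k w K)
  let ?y = "inverse_branch w z" and ?x = "inverse_branch ((s, k) # w) z"
  have p: "0 < of_int k + ?y" and s: "\<bar>real_of_int s\<bar> = 1" and x: "?x \<in> I\<^sub>o"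
    and k: "1 \<le> k" "odd k" and w: "admissible w K"
    using 2 by auto
  have y: "?y \<in> I\<^sub>o" using inverse_branch_in_Io 2 w by auto
  have ax: "\<bar>?x\<bar> = 1 / (of_int k + ?y)" using s p by (simp add: abs_divide)
  have r: "(branch_root_deriv ((s, k) # w) z)\<^sup>2 = \<bar>?x\<bar> * (\<bar>?x\<bar> * (branch_root_deriv w z)\<^sup>2)"
    unfolding ax using p by (simp add: power2_eq_square field_simps)
  have "\<bar>?x\<bar> * (branch_root_deriv w z)\<^sup>2 \<le> 2 * (9/10) ^ length w"
  proof (cases "w = []")
    case True
    then show ?thesis using x \<alpha>_bounds by (auto simp: abs_if)
  next
    case False
    have xy: "\<bar>?x * ?y\<bar> \<le> 9/10"
      using x y k p s by (intro abs_mult_next_le[where s="of_int s" and k=k]) auto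
    have "\<bar>?x\<bar> * (branch_root_deriv w z)\<^sup>2 \<le> \<bar>?x\<bar> * (\<bar>?y\<bar> * (2 * (9/10) ^ (length w - 1)))"
      using 2 False by (intro mult_left_mono) auto
    also have "\<dots> = \<bar>?x * ?y\<bar> * (2 * (9/10) ^ (length w - 1))" by (simp add: abs_mult)
    also have "\<dots> \<le> 9/10 * (2 * (9/10) ^ (length w - 1))"
      using xy by (intro mult_right_mono) auto
    also have "\<dots> = 2 * (9/10) ^ length w"
      using False by (cases w) auto
    finally show ?thesis .
  qed
  then show ?case unfolding r by (intro mult_left_mono) auto
qed simp

lemma branch_root_deriv_sq_le:
  assumes "admissible w K" "z \<in> K"
  shows "(branch_root_deriv w z)\<^sup>2 \<le> 4 * (9/10) ^ length w"
proof (cases "w = []")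
  case False
  have x: "\<bar>inverse_branch w z\<bar> \<le> 81/50"
    using inverse_branch_in_Io[OF assms] \<alpha>_bounds by auto
  have "(branch_root_deriv w z)\<^sup>2 \<le> \<bar>inverse_branch w z\<bar> * (2 * (9/10) ^ (length w - 1))"
    by (rule branch_root_deriv_sq_le_aux[OF assms False])
  also have "\<dots> \<le> 81/50 * (2 * (9/10) ^ (length w - 1))"
    using x by (intro mult_right_mono) auto
  \<comment> \<open>81/50 * 2 * 10/9 = 18/5.\<close>
  also have "\<dots> \<le> 4 * (9/10) ^ length w"
    using False by (cases w) auto
  finally show ?thesis .
qed simp

lemma inverse_branch_diff_le:
  assumes "admissible w K" "z \<in> K" "z' \<in> K"
  shows "\<bar>inverse_branch w z - inverse_branch w z'\<bar> \<le> \<bar>z - z'\<bar> * (4 * (9/10) ^ length w)"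
proof -
  let ?r = "branch_root_deriv w z" and ?r' = "branch_root_deriv w z'"
  have "?r\<^sup>2 \<le> (sqrt (4 * (9/10) ^ length w))\<^sup>2" "?r'\<^sup>2 \<le> (sqrt (4 * (9/10) ^ length w))\<^sup>2"
    using branch_root_deriv_sq_le assms by auto
  then have "?r \<le> sqrt (4 * (9/10) ^ length w)" "?r' \<le> sqrt (4 * (9/10) ^ length w)"
    by (auto intro: power2_le_imp_le)
  then have "?r * ?r' \<le> sqrt (4 * (9/10) ^ length w) * sqrt (4 * (9/10) ^ length w)"
    using branch_root_deriv_pos[OF assms(1,3)] by (intro mult_mono) auto
  also have "\<dots> = 4 * (9/10) ^ length w" by simp
  finally have "\<bar>z - z'\<bar> * (?r * ?r') \<le> \<bar>z - z'\<bar> * (4 * (9/10) ^ length w)"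
    by (rule mult_left_mono) simp
  then show ?thesis using inverse_branch_diff[OF assms] by (simp add: mult.assoc)
qed

lemma sum_geometric_le: "(\<Sum>m<n. (9/10::real) ^ m) \<le> 10"
  by (simp add: sum_gp_strict)

text \<open>A new letter multiplies the ratio of the root derivatives by (k + y')/(k + y). With n
  the length of the tail, y and y' differ by at most 8 (9/10)^n and 1/(k + y) = |x| \<le> 2, so the
  factor is at most exp (16 (9/10)^n). The exponents sum to at most 16 * 10 in
  \<open>bounded_distortion\<close>.\<close>

lemma bounded_distortion_aux:
  assumes "admissible w K" "z \<in> K" "z' \<in> K" "\<bar>z - z'\<bar> \<le> 2"
  shows "branch_root_deriv w z \<le> exp (16 * (\<Sum>m<length w. (9/10) ^ m)) * branch_root_deriv w z'"
  using assms
proof (induction w K rule: admissible.induct)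
  case (2 s k w K)
  let ?y = "inverse_branch w z" and ?y' = "inverse_branch w z'"
  let ?x = "inverse_branch ((s, k) # w) z"
  let ?e = "16 * (9/10) ^ length w :: real"
  have w: "admissible w K" and p: "0 < of_int k + ?y" "0 < of_int k + ?y'"
    and s: "\<bar>real_of_int s\<bar> = 1" and x: "?x \<in> I\<^sub>o"
    using 2 by auto
  have ax: "\<bar>?x\<bar> = 1 / (of_int k + ?y)" using s p by (simp add: abs_divide)
  have x2: "1 / (of_int k + ?y) \<le> 2" unfolding ax[symmetric] using x \<alpha>_bounds by (auto simp: abs_if)
  have "\<bar>?y' - ?y\<bar> \<le> \<bar>z' - z\<bar> * (4 * (9/10) ^ length w)"
    by (rule inverse_branch_diff_le[OF w "2.prems"(3,2)])
  also have "\<dots> \<le> 2 * (4 * (9/10) ^ length w)"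
    using 2 by (intro mult_right_mono) auto
  finally have d: "?y' - ?y \<le> 8 * (9/10) ^ length w" by simp
  have "(of_int k + ?y') / (of_int k + ?y) = 1 + (?y' - ?y) * (1 / (of_int k + ?y))"
    using p by (simp add: field_simps)
  also have "\<dots> \<le> 1 + (8 * (9/10) ^ length w) * (1 / (of_int k + ?y))"
    using d p by (intro add_mono mult_right_mono) auto
  also have "\<dots> \<le> 1 + (8 * (9/10) ^ length w) * 2"
    using x2 by (intro add_mono mult_left_mono) auto
  also have "\<dots> \<le> exp ?e" using exp_ge_add_one_self[of ?e] by simp
  finally have "1 / (of_int k + ?y) \<le> exp ?e * (1 / (of_int k + ?y'))"
    using p by (simp add: field_simps)
  moreover have "branch_root_deriv w z \<le> exp (16 * (\<Sum>m<length w. (9/10) ^ m)) * branch_root_deriv w z'"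
    by (rule "2.IH"[OF w "2.prems"(2,3,4)])
  ultimately have "branch_root_deriv w z * (1 / (of_int k + ?y))
     \<le> (exp (16 * (\<Sum>m<length w. (9/10) ^ m)) * branch_root_deriv w z') * (exp ?e * (1 / (of_int k + ?y')))"
    using p branch_root_deriv_pos[OF w "2.prems"(3)] by (intro mult_mono) auto
  then show ?case by (simp add: exp_add algebra_simps)
qed simp

lemma bounded_distortion:
  assumes "admissible w K" "z \<in> K" "z' \<in> K"
  shows "branch_root_deriv w z \<le> exp 160 * branch_root_deriv w z'"
proof -
  have "K \<subseteq> I\<^sub>o" using assms(1) by (induction w K rule: admissible.induct) auto
  then have "z \<in> I\<^sub>o" "z' \<in> I\<^sub>o" using assms by auto
  then have "\<bar>z - z'\<bar> \<le> 2" by auto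
  from bounded_distortion_aux[OF assms this]
  have "branch_root_deriv w z \<le> exp (16 * (\<Sum>m<length w. (9/10) ^ m)) * branch_root_deriv w z'" .
  also have "\<dots> \<le> exp 160 * branch_root_deriv w z'"
    using sum_geometric_le[of "length w"] branch_root_deriv_pos[OF assms(1,3)]
    by (intro mult_right_mono) auto
  finally show ?thesis .
qed

lemma \<phi>_branch:
  assumes y: "y \<in> I\<^sub>\<alpha> \<alpha>" and k: "odd k" "0 < of_int k + y" and s: "\<bar>s\<bar> = (1::real)"
  shows "\<phi>\<^sub>\<alpha> \<alpha> (s / (of_int k + y)) = y" "d\<^sub>\<alpha> \<alpha> (s / (of_int k + y)) = k"
proof -
  let ?x = "s / (of_int k + y)"
  have nz: "?x \<noteq> 0" and inv: "1 / \<bar>?x\<bar> = of_int k + y"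
    using k s by (auto simp: abs_divide)
  show "d\<^sub>\<alpha> \<alpha> ?x = k"
    using d_unique[OF nz k(1)] y unfolding I\<^sub>\<alpha>_def inv by simp
  then show "\<phi>\<^sub>\<alpha> \<alpha> ?x = y"
    using \<phi>_eq[OF nz] inv by simp
qed

lemma \<phi>_inverse_branch_Cons:
  assumes "admissible ((s, k) # w) K" "z \<in> K"
  shows "\<phi>\<^sub>\<alpha> \<alpha> (inverse_branch ((s, k) # w) z) = inverse_branch w z"
    "d\<^sub>\<alpha> \<alpha> (inverse_branch ((s, k) # w) z) = k"
    "sgn (inverse_branch ((s, k) # w) z) = of_int s"
proof -
  have "inverse_branch w z \<in> I\<^sub>\<alpha> \<alpha>"
    using inverse_branch_in_Io[of w K z] assms by (auto simp: I\<^sub>\<alpha>_def)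
  from \<phi>_branch[OF this, of k "of_int s"] assms
  show "\<phi>\<^sub>\<alpha> \<alpha> (inverse_branch ((s, k) # w) z) = inverse_branch w z"
    "d\<^sub>\<alpha> \<alpha> (inverse_branch ((s, k) # w) z) = k" by auto
  have "s = 1 \<or> s = -1" using assms by auto
  then show "sgn (inverse_branch ((s, k) # w) z) = of_int s"
    using assms by (auto simp: sgn_if)
qed

lemma \<phi>_funpow_inverse_branch:
  assumes "admissible w K" "z \<in> K"
  shows "(\<phi>\<^sub>\<alpha> \<alpha> ^^ length w) (inverse_branch w z) = z"
  using assms
proof (induction w)
  case (Cons c w)
  obtain s k where c: "c = (s, k)" by (cases c)
  have "(\<phi>\<^sub>\<alpha> \<alpha> ^^ length (c # w)) (inverse_branch (c # w) z)
      = (\<phi>\<^sub>\<alpha> \<alpha> ^^ length w) (\<phi>\<^sub>\<alpha> \<alpha> (inverse_branch (c # w) z))"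
    by (simp only: length_Cons funpow_Suc_right o_apply)
  also have "\<dots> = z"
    using Cons \<phi>_inverse_branch_Cons(1)[of s k w K z] by (simp add: c)
  finally show ?case .
qed simp

text \<open>A common point fixes the first sign and digit, and its image is a common point of the
  two shorter cylinders.\<close>

lemma cylinders_disjoint:
  assumes "admissible w K" "admissible w' K" "length w = length w'"
    "inverse_branch w ` K \<inter> inverse_branch w' ` K \<noteq> {}"
  shows "w = w'"
  using assms
proof (induction w arbitrary: w')
  case (Cons c w)
  then obtain c' v where w': "w' = c' # v" by (cases w') auto
  obtain s k s' k' where c: "c = (s, k)" "c' = (s', k')" by (cases c, cases c')
  obtain z z' where z: "z \<in> K" "z' \<in> K"
    and eq: "inverse_branch ((s, k) # w) z = inverse_branch ((s', k') # v) z'"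
    using Cons.prems(4) unfolding c w' by blast
  note a = Cons.prems(1)[unfolded c] and a' = Cons.prems(2)[unfolded c w']
  have "k = k'" using \<phi>_inverse_branch_Cons(2)[OF a z(1)] \<phi>_inverse_branch_Cons(2)[OF a' z(2)] eq by metis
  moreover have "real_of_int s = of_int s'"
    using \<phi>_inverse_branch_Cons(3)[OF a z(1)] \<phi>_inverse_branch_Cons(3)[OF a' z(2)] eq by metis
  moreover have "inverse_branch w z = inverse_branch v z'"
    using \<phi>_inverse_branch_Cons(1)[OF a z(1)] \<phi>_inverse_branch_Cons(1)[OF a' z(2)] eq by metis
  then have "inverse_branch w ` K \<inter> inverse_branch v ` K \<noteq> {}" using z by blast
  with Cons.IH[of v] Cons.prems a a' have "w = v" by (auto simp: w')
  ultimately show ?case by (simp add: c w')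
qed simp

end

section \<open>Change of variables along branches\<close>

text \<open>Inversion reverses the order, so x is reflected first and the increasing map t -> -1/t
  is substituted. The exhausting intervals [1/(n+2), n+2] are invariant under inversion, and the 2
  makes them nondegenerate from n = 0 on.\<close>

lemma nn_integral_inverse:
  fixes f :: "real \<Rightarrow> ennreal"
  assumes [measurable]: "f \<in> borel_measurable borel"
  shows "(\<integral>\<^sup>+x. f x * indicator {0<..} x \<partial>lborel)
    = (\<integral>\<^sup>+t. f (1 / t) * ennreal (1 / t\<^sup>2) * indicator {0<..} t \<partial>lborel)"
proof -
  define S where "S n = {1 / real (n + 2) .. real (n + 2)}" for n
  have S_mono: "incseq S"
    unfolding S_def incseq_def by (auto simp: field_simps intro: order_trans)
  have S_ev: "\<forall>\<^sub>F n in sequentially. indicator (S n) x = (indicator {0<..} x :: ennreal)" for x :: real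
  proof (cases "x > 0")
    case True
    obtain N1 where N1: "1 / real (Suc N1) < x"
      using reals_Archimedean[OF True] by (auto simp: inverse_eq_divide)
    obtain N2 where N2: "x < real N2" using reals_Archimedean2 by blast
    have "x \<in> S n" if "n \<ge> max N1 N2" for n
    proof -
      have "1 / real (n + 2) \<le> 1 / real (Suc N1)" using that by (intro divide_left_mono) auto
      then show ?thesis using N1 N2 that by (auto simp: S_def)
    qed
    then show ?thesis
      using True by (intro eventually_mono[OF eventually_ge_at_top[of "max N1 N2"]]) auto
  next
    case False
    have "x \<notin> S n" for n
    proof
      assume "x \<in> S n"
      then have "1 / real (n + 2) \<le> x" by (simp add: S_def)
      moreover have "0 < 1 / real (n + 2)" by simp
      ultimately show False using False by linarith
    qed
    then show ?thesis using False by simp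
  qed
  have eq: "(\<integral>\<^sup>+x. f x * indicator (S n) x \<partial>lborel)
      = (\<integral>\<^sup>+t. f (1 / t) * ennreal (1 / t\<^sup>2) * indicator (S n) t \<partial>lborel)" for n
  proof -
    let ?a = "1 / real (n + 2)" and ?b = "real (n + 2)"
    have "0 < ?a" "?a < 1" "1 < ?b" by (simp_all add: divide_less_eq)
    then have ab: "0 < ?a" "?a < ?b" by linarith+
    have "(\<integral>\<^sup>+x. f x * indicator (S n) x \<partial>lborel)
        = (\<integral>\<^sup>+x. f (0 + (-1) * x) * indicator (S n) (0 + (-1) * x) \<partial>lborel)"
      by (subst nn_integral_real_affine[where c="-1" and t=0]) (auto simp: S_def)
    also have "\<dots> = (\<integral>\<^sup>+x. f (- x) * indicator {- 1 / ?a .. - 1 / ?b} x \<partial>lborel)"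
      by (intro nn_integral_cong) (auto simp: S_def split: split_indicator)
    also have "\<dots> = (\<integral>\<^sup>+x. f (- (- 1 / x)) * ennreal (1 / x\<^sup>2) * indicator {?a .. ?b} x \<partial>lborel)"
    proof (rule nn_integral_substitution_aux[OF _ _ _ _ _ ab(2)])
      fix x assume "x \<in> {?a..?b}"
      then have "x \<noteq> 0" using ab by auto
      then show "((\<lambda>x. - 1 / x) has_real_derivative 1 / x\<^sup>2) (at x)"
        by (auto intro!: derivative_eq_intros simp: power2_eq_square)
    next
      show "continuous_on {?a..?b} (\<lambda>x. 1 / x\<^sup>2)"
        using ab by (intro continuous_intros) auto
    qed auto
    also have "\<dots> = (\<integral>\<^sup>+t. f (1 / t) * ennreal (1 / t\<^sup>2) * indicator (S n) t \<partial>lborel)"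
      by (simp add: S_def)
    finally show ?thesis .
  qed
  have lim: "(\<lambda>n. \<integral>\<^sup>+x. g x * indicator (S n) x \<partial>lborel) \<longlonglongrightarrow> (\<integral>\<^sup>+x. g x * indicator {0<..} x \<partial>lborel)"
    if [measurable]: "g \<in> borel_measurable borel" for g :: "real \<Rightarrow> ennreal"
  proof (rule nn_integral_LIMSEQ)
    show "incseq (\<lambda>n x. g x * indicator (S n) x)"
      using S_mono by (auto simp: incseq_def le_fun_def intro!: mult_left_mono split: split_indicator)
    show "(\<lambda>n. g x * indicator (S n) x) \<longlonglongrightarrow> g x * indicator {0<..} x" for x
      using S_ev[of x] by (intro tendsto_eventually) (auto elim: eventually_mono)
    show "(\<lambda>x. g x * indicator (S n) x) \<in> borel_measurable lborel" for n
      unfolding S_def by measurable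
  qed
  have "(\<lambda>n. \<integral>\<^sup>+x. f x * indicator (S n) x \<partial>lborel)
      \<longlonglongrightarrow> (\<integral>\<^sup>+t. f (1 / t) * ennreal (1 / t\<^sup>2) * indicator {0<..} t \<partial>lborel)"
    unfolding eq by (rule lim) measurable
  with lim[OF assms] show ?thesis by (rule LIMSEQ_unique)
qed

text \<open>The branch is a translation by k, then an inversion, then a reflection by s. Its image
  of Y is written as a condition on the sign of x and on 1/|x| - k, which makes it a measurable
  preimage.\<close>

lemma nn_integral_branch:
  fixes F :: "real \<Rightarrow> ennreal" and s k :: int
  assumes [measurable]: "F \<in> borel_measurable borel" "Y \<in> sets borel"
    and s: "\<bar>s\<bar> = 1" and Y: "\<And>z. z \<in> Y \<Longrightarrow> 0 < of_int k + z"
  shows "(\<integral>\<^sup>+x. F x * indicator {x. 0 < of_int s * x \<and> 1 / \<bar>x\<bar> - of_int k \<in> Y} x \<partial>lborel)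
    = (\<integral>\<^sup>+z. F (of_int s / (of_int k + z)) * ennreal (1 / (of_int k + z)\<^sup>2) * indicator Y z \<partial>lborel)"
proof -
  have s2: "of_int s * (of_int s :: real) = 1" "\<bar>of_int s\<bar> = (1 :: real)"
    using s by (auto simp: abs_if split: if_splits)
  let ?A = "{x. 0 < of_int s * x \<and> 1 / \<bar>x\<bar> - of_int k \<in> Y}"
  have [measurable]: "?A \<in> sets borel" by measurable
  have "(\<integral>\<^sup>+x. F x * indicator ?A x \<partial>lborel)
      = (\<integral>\<^sup>+x. F (0 + of_int s * x) * indicator ?A (0 + of_int s * x) \<partial>lborel)"
    using s2 by (subst nn_integral_real_affine[where c="of_int s" and t=0]) auto
  also have "\<dots> = (\<integral>\<^sup>+x. (F (of_int s * x) * indicator Y (1 / x - of_int k)) * indicator {0<..} x \<partial>lborel)"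
    using s2 by (intro nn_integral_cong) (auto simp: abs_mult mult.assoc[symmetric] split: split_indicator)
  also have "\<dots> = (\<integral>\<^sup>+t. (F (of_int s * (1 / t)) * indicator Y (1 / (1 / t) - of_int k))
      * ennreal (1 / t\<^sup>2) * indicator {0<..} t \<partial>lborel)"
    by (rule nn_integral_inverse) measurable
  also have "\<dots> = (\<integral>\<^sup>+z. (F (of_int s * (1 / (of_int k + 1 * z))) * indicator Y (1 / (1 / (of_int k + 1 * z)) - of_int k))
      * ennreal (1 / (of_int k + 1 * z)\<^sup>2) * indicator {0<..} (of_int k + 1 * z) \<partial>lborel)"
    by (subst nn_integral_real_affine[where c=1 and t="of_int k"]) auto
  also have "\<dots> = (\<integral>\<^sup>+z. F (of_int s / (of_int k + z)) * ennreal (1 / (of_int k + z)\<^sup>2) * indicator Y z \<partial>lborel)"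
    using Y by (intro nn_integral_cong) (auto split: split_indicator)
  finally show ?thesis .
qed

context odd_cf
begin

text \<open>Images under a branch become preimages; this gives their measurability and the form
  required by \<open>nn_integral_branch\<close>.\<close>

lemma inverse_branch_Cons_image:
  assumes "admissible ((s, k) # w) K" "X \<subseteq> K"
  shows "inverse_branch ((s, k) # w) ` X
    = {x. 0 < of_int s * x \<and> 1 / \<bar>x\<bar> - of_int k \<in> inverse_branch w ` X}"
proof (intro set_eqI iffI)
  fix x assume "x \<in> inverse_branch ((s, k) # w) ` X"
  then obtain z where z: "z \<in> X" "x = of_int s / (of_int k + inverse_branch w z)" by auto
  then have p: "0 < of_int k + inverse_branch w z" and s: "s = 1 \<or> s = -1"
    using assms by auto
  have "0 < of_int s * x" "1 / \<bar>x\<bar> - of_int k = inverse_branch w z"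
    using p s z(2) by auto
  then show "x \<in> {x. 0 < of_int s * x \<and> 1 / \<bar>x\<bar> - of_int k \<in> inverse_branch w ` X}"
    using z by auto
next
  fix x assume "x \<in> {x. 0 < of_int s * x \<and> 1 / \<bar>x\<bar> - of_int k \<in> inverse_branch w ` X}"
  then obtain z where x: "0 < of_int s * x" and z: "z \<in> X" "1 / \<bar>x\<bar> - of_int k = inverse_branch w z"
    by auto
  have s: "s = 1 \<or> s = -1" using assms by auto
  have "of_int k + inverse_branch w z = 1 / \<bar>x\<bar>" using z by linarith
  then have "inverse_branch ((s, k) # w) z = of_int s * \<bar>x\<bar>" by simp
  also have "\<dots> = x" using s x by auto
  finally show "x \<in> inverse_branch ((s, k) # w) ` X" using z(1) by (metis imageI)
qed

lemma sets_inverse_branch_image: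
  assumes "admissible w K" "X \<subseteq> K" "X \<in> sets borel"
  shows "inverse_branch w ` X \<in> sets borel"
  using assms
proof (induction w K rule: admissible.induct)
  case (2 s k w K)
  then have [measurable]: "inverse_branch w ` X \<in> sets borel" by simp
  show ?case unfolding inverse_branch_Cons_image[OF "2.prems"(1,2)] by measurable
qed simp

lemma measurable_inverse_branch[measurable]: "inverse_branch w \<in> borel_measurable borel"
proof (induction w)
  case (Cons c w)
  note [measurable] = Cons
  have "inverse_branch (c # w) = (\<lambda>z. of_int (fst c) / (of_int (snd c) + inverse_branch w z))"
    by (cases c) (simp add: fun_eq_iff)
  then show ?case by simp
qed (simp add: fun_eq_iff inverse_branch.simps(1)[abs_def])

lemma measurable_branch_root_deriv[measurable]: "branch_root_deriv w \<in> borel_measurable borel"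
proof (induction w)
  case (Cons c w)
  note [measurable] = Cons
  have "branch_root_deriv (c # w) = (\<lambda>z. branch_root_deriv w z / (of_int (snd c) + inverse_branch w z))"
    by (cases c) (simp add: fun_eq_iff)
  then show ?case by simp
qed (simp add: branch_root_deriv.simps(1)[abs_def])

lemma nn_integral_inverse_branch_image:
  assumes "admissible w K" "X \<subseteq> K" "X \<in> sets borel" "F \<in> borel_measurable borel"
  shows "(\<integral>\<^sup>+x. F x * indicator (inverse_branch w ` X) x \<partial>lborel)
    = (\<integral>\<^sup>+z. F (inverse_branch w z) * ennreal ((branch_root_deriv w z)\<^sup>2) * indicator X z \<partial>lborel)"
  using assms
proof (induction w K arbitrary: F rule: admissible.induct)
  case (2 s k w K)
  note [measurable] = "2.prems"(3,4)
  let ?Y = "inverse_branch w ` X"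
  have w: "admissible w K" using 2 by simp
  have [measurable]: "?Y \<in> sets borel" by (rule sets_inverse_branch_image[OF w "2.prems"(2,3)])
  have p: "0 < of_int k + z" if "z \<in> ?Y" for z using that 2 by auto
  have "(\<integral>\<^sup>+x. F x * indicator (inverse_branch ((s, k) # w) ` X) x \<partial>lborel)
      = (\<integral>\<^sup>+z. F (of_int s / (of_int k + z)) * ennreal (1 / (of_int k + z)\<^sup>2) * indicator ?Y z \<partial>lborel)"
    unfolding inverse_branch_Cons_image[OF "2.prems"(1,2)]
    using 2 p by (intro nn_integral_branch) auto
  also have "\<dots> = (\<integral>\<^sup>+z. F (of_int s / (of_int k + inverse_branch w z)) * ennreal (1 / (of_int k + inverse_branch w z)\<^sup>2)
      * ennreal ((branch_root_deriv w z)\<^sup>2) * indicator X z \<partial>lborel)"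
    by (rule "2.IH"[OF w "2.prems"(2,3)]) measurable
  also have "\<dots> = (\<integral>\<^sup>+z. F (inverse_branch ((s, k) # w) z) * ennreal ((branch_root_deriv ((s, k) # w) z)\<^sup>2)
      * indicator X z \<partial>lborel)"
    by (intro nn_integral_cong) (simp add: power_divide mult.assoc ennreal_mult[symmetric])
  finally show ?case .
qed simp

lemma Io_finite_measure: "X \<subseteq> I\<^sub>o \<Longrightarrow> emeasure lborel X < \<infinity>"
  using emeasure_mono[of X I\<^sub>o lborel] by (auto simp: order_le_less_trans)

lemma admissible_subset_Io: "admissible w K \<Longrightarrow> K \<subseteq> I\<^sub>o"
  by (induction w K rule: admissible.induct) auto

text \<open>By bounded distortion the derivative on K is within the factor exp 320 = (exp 160)^2 of
  its value at one point \<open>z0\<close>. The factor is paid once in the lower bound for X and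
  once in the upper bound for Y.\<close>

lemma inverse_branch_image_comparison:
  assumes w: "admissible w K" and X: "X \<subseteq> K" "X \<in> sets borel" and Y: "Y \<subseteq> K" "Y \<in> sets borel"
  shows "measure lborel X * measure lborel (inverse_branch w ` Y)
    \<le> exp 640 * (measure lborel (inverse_branch w ` X) * measure lborel Y)"
proof (cases "K = {}")
  case False
  then obtain z0 where z0: "z0 \<in> K" by blast
  let ?r = "branch_root_deriv w z0"
  have r: "0 < ?r" by (rule branch_root_deriv_pos[OF w z0])
  have e320: "exp 160 ^ 2 = exp (320::real)" by (simp add: exp_double[symmetric] flip: exp_of_nat_mult)
  have im: "inverse_branch w ` Z \<subseteq> I\<^sub>o" if "Z \<subseteq> K" for Z
    using inverse_branch_in_Io[OF w] that by blast
  have fin: "emeasure lborel Z < \<infinity>" "emeasure lborel (inverse_branch w ` Z) < \<infinity>" if "Z \<subseteq> K" for Z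
    using that admissible_subset_Io[OF w] im[OF that] by (blast intro: Io_finite_measure)+
  have em: "emeasure lborel Z = ennreal (measure lborel Z)"
    "emeasure lborel (inverse_branch w ` Z) = ennreal (measure lborel (inverse_branch w ` Z))" if "Z \<subseteq> K" for Z
    using fin[OF that] by (auto intro!: emeasure_eq_ennreal_measure)
  have form: "emeasure lborel (inverse_branch w ` Z)
      = (\<integral>\<^sup>+z. ennreal ((branch_root_deriv w z)\<^sup>2) * indicator Z z \<partial>lborel)"
    if "Z \<subseteq> K" and Z: "Z \<in> sets borel" for Z
    using nn_integral_inverse_branch_image[OF w that, of "\<lambda>_. 1"] sets_inverse_branch_image[OF w that]
    by simp
  have "ennreal (?r\<^sup>2 / exp 320) * emeasure lborel X \<le> emeasure lborel (inverse_branch w ` X)"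
  proof -
    have "?r\<^sup>2 / exp 320 \<le> (branch_root_deriv w z)\<^sup>2" if "z \<in> X" for z
    proof -
      have "?r \<le> exp 160 * branch_root_deriv w z"
        using X z0 that by (intro bounded_distortion[OF w]) auto
      then have "?r\<^sup>2 \<le> (exp 160 * branch_root_deriv w z)\<^sup>2"
        using r by (intro power_mono) auto
      then show ?thesis by (simp add: power_mult_distrib e320 field_simps)
    qed
    then have "(\<integral>\<^sup>+z. ennreal (?r\<^sup>2 / exp 320) * indicator X z \<partial>lborel)
        \<le> (\<integral>\<^sup>+z. ennreal ((branch_root_deriv w z)\<^sup>2) * indicator X z \<partial>lborel)"
      by (intro nn_integral_mono) (auto intro!: ennreal_leI split: split_indicator)
    then show ?thesis using X form[OF X] by (simp add: nn_integral_cmult)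
  qed
  then have lo: "?r\<^sup>2 / exp 320 * measure lborel X \<le> measure lborel (inverse_branch w ` X)"
    unfolding em(1)[OF X(1)] em(2)[OF X(1)] by (simp flip: ennreal_mult)
  have "emeasure lborel (inverse_branch w ` Y) \<le> ennreal (?r\<^sup>2 * exp 320) * emeasure lborel Y"
  proof -
    have "(branch_root_deriv w z)\<^sup>2 \<le> ?r\<^sup>2 * exp 320" if "z \<in> Y" for z
    proof -
      have "branch_root_deriv w z \<le> exp 160 * ?r"
        using Y z0 that by (intro bounded_distortion[OF w]) auto
      moreover have "0 < branch_root_deriv w z" using that Y by (intro branch_root_deriv_pos[OF w]) auto
      ultimately have "(branch_root_deriv w z)\<^sup>2 \<le> (exp 160 * ?r)\<^sup>2"
        by (intro power_mono) auto
      then show ?thesis by (simp add: power_mult_distrib e320 mult.commute)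
    qed
    then have "(\<integral>\<^sup>+z. ennreal ((branch_root_deriv w z)\<^sup>2) * indicator Y z \<partial>lborel)
      \<le> (\<integral>\<^sup>+z. ennreal (?r\<^sup>2 * exp 320) * indicator Y z \<partial>lborel)"
      by (intro nn_integral_mono) (auto intro!: ennreal_leI split: split_indicator)
    then show ?thesis using Y form[OF Y] by (simp add: nn_integral_cmult)
  qed
  then have hi: "measure lborel (inverse_branch w ` Y) \<le> ?r\<^sup>2 * exp 320 * measure lborel Y"
    unfolding em(1)[OF Y(1)] em(2)[OF Y(1)] by (simp flip: ennreal_mult)
  have "measure lborel X * measure lborel (inverse_branch w ` Y)
      \<le> measure lborel X * (?r\<^sup>2 * exp 320 * measure lborel Y)"
    using hi by (intro mult_left_mono) auto
  also have "\<dots> = (exp 320 * exp 320) * ((?r\<^sup>2 / exp 320 * measure lborel X) * measure lborel Y)"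
    by (simp add: field_simps)
  also have "\<dots> \<le> (exp 320 * exp 320) * (measure lborel (inverse_branch w ` X) * measure lborel Y)"
    using lo by (intro mult_left_mono mult_right_mono) auto
  also have "exp 320 * exp 320 = exp (640::real)" by (simp flip: exp_add)
  finally show ?thesis .
qed (use X Y in simp)

section \<open>Full branches inside every interval\<close>

text \<open>Here k + z > 1 + \<alpha>, and 1/(1 + \<alpha>) is at most \<alpha> and at most 2 -
  \<alpha> precisely because g \<le> \<alpha> \<le> G. So among the odd digits only 1 can fail to be
  full.\<close>

lemma full_digit:
  assumes k: "3 \<le> k" and s: "\<bar>s\<bar> = 1" and z: "z \<in> I\<^sub>o"
  shows "0 < of_int k + z" "of_int s / (of_int k + z) \<in> I\<^sub>o"
proof -
  have k3: "3 \<le> real_of_int k" using k by simp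
  then have p: "1 + \<alpha> < of_int k + z" using z by auto
  then show kz: "0 < of_int k + z" using \<alpha>_bounds by linarith
  have "1 / (of_int k + z) < 1 / (1 + \<alpha>)"
    using p kz \<alpha>_bounds by (intro divide_strict_left_mono) auto
  moreover have "1 / (1 + \<alpha>) \<le> \<alpha>" "1 / (1 + \<alpha>) \<le> 2 - \<alpha>"
    using \<alpha>_bounds by (simp_all add: field_simps)
  moreover have "0 < 1 / (of_int k + z)" using kz by simp
  ultimately have "- \<alpha> < 1 / (of_int k + z)" "\<alpha> - 2 < 1 / (of_int k + z)"
    "1 / (of_int k + z) < \<alpha>" "1 / (of_int k + z) < 2 - \<alpha>"
    using \<alpha>_bounds by linarith+
  moreover have "s = 1 \<or> s = -1" using s by auto
  ultimately show "of_int s / (of_int k + z) \<in> I\<^sub>o"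
    by (auto simp: greaterThanLessThan_iff)
qed

text \<open>
  Near a rational \<open>p / q\<close>, on either side, the map is \<open>x \<mapsto> 1 / \<bar>x\<bar> - k\<close> for a fixed odd \<open>k\<close>;
  this continues the Euclidean-like descent of \<open>\<bar>p\<bar> + q\<close> to one-sided neighbourhoods even when
  \<open>p / q\<close> is a discontinuity. The descent ends at \<open>0\<close>, where full branches accumulate.
\<close>

lemma full_branch_near_rational:
  fixes p q s :: int
  assumes "0 < q" "\<bar>s\<bar> = 1" "r = of_int p / of_int q" "\<alpha> - 2 \<le> r" "r \<le> \<alpha>"
    "s = 1 \<Longrightarrow> r < \<alpha>" "s = -1 \<Longrightarrow> \<alpha> - 2 < r" "0 < e"
  shows "\<exists>v. admissible v I\<^sub>o \<and>
    (\<forall>z\<in>I\<^sub>o. 0 < of_int s * (inverse_branch v z - r) \<and> of_int s * (inverse_branch v z - r) < e)"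
  using assms
proof (induction "nat (\<bar>p\<bar> + q)" arbitrary: p q s r e rule: less_induct)
  case less
  have s: "s = 1 \<or> s = -1" using less.prems(2) by auto
  show ?case
  proof (cases "p = 0")
    case True
    \<comment> \<open>Odd, at least 3 so that the branch is full, and so large that k + z > 1/e for
      all z > -2.\<close>
    define k :: int where "k = 2 * (\<lceil>1 / e\<rceil> + 1) + 1"
    have c: "1 / e \<le> of_int \<lceil>1 / e\<rceil>" by simp
    moreover have "0 < 1 / e" using less.prems by simp
    ultimately have "0 < \<lceil>1 / e\<rceil>" by linarith
    then have k: "odd k" "3 \<le> k" unfolding k_def by presburger+
    have kr: "real_of_int k = 2 * of_int \<lceil>1 / e\<rceil> + 3" by (simp add: k_def)
    have adm: "admissible [(s, k)] I\<^sub>o"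
      using k s full_digit[OF k(2) less.prems(2)] by auto
    moreover have "0 < of_int s * (inverse_branch [(s, k)] z - r) \<and> of_int s * (inverse_branch [(s, k)] z - r) < e"
      if z: "z \<in> I\<^sub>o" for z
    proof -
      have "\<alpha> - 2 < z" using z by simp
      then have "1 / e < of_int k + z" using \<alpha>_bounds c kr \<open>0 < 1 / e\<close> by linarith
      moreover from this have "0 < of_int k + z" using \<open>0 < 1 / e\<close> by linarith
      ultimately have "1 < (of_int k + z) * e" "0 < of_int k + z"
        using less.prems(8) by (simp_all add: divide_less_eq mult.commute)
      then have "1 / (of_int k + z) < e" "0 < 1 / (of_int k + z)"
        by (simp_all add: divide_less_eq mult.commute)
      moreover have "r = 0" using True less.prems by simp
      ultimately show ?thesis using s by auto
    qed
    ultimately show ?thesis by blast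
  next
    case False
    then have r0: "r \<noteq> 0" using less.prems by simp
    define t where "t = 1 / \<bar>r\<bar>"
    have ar: "\<bar>r\<bar> \<le> 81/50" "0 < \<bar>r\<bar>" using less.prems(4,5) \<alpha>_bounds r0 by (auto simp: abs_if)
    have t: "50/81 \<le> t" "0 < t" using ar by (auto simp: t_def field_simps)
    have t_eq: "t = of_int q / of_int \<bar>p\<bar>" using less.prems by (simp add: t_def abs_divide)
    define \<epsilon> :: int where "\<epsilon> = (if r > 0 then 1 else -1)"
    \<comment> \<open>x -> 1/|x| reverses the order for x > 0 and keeps it for x < 0, so the
      neighbourhood changes sides exactly when r > 0.\<close>
    define s' where "s' = - \<epsilon> * s"
    have \<epsilon>: "\<epsilon> = 1 \<or> \<epsilon> = -1" by (simp add: \<epsilon>_def)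
    have s': "s' = 1 \<or> s' = -1" "\<bar>s'\<bar> = 1" using \<epsilon> s by (auto simp: s'_def)
    have r_eq: "r = of_int \<epsilon> / t" by (simp add: \<epsilon>_def t_def)
    \<comment> \<open>For a neighbourhood on the right the image point must lie in [\<alpha> - 2,
      \<alpha>), which gives the digit of r; for one on the left it must lie in (\<alpha> - 2,
      \<alpha>], which asks for the opposite rounding.\<close>
    have "\<exists>k::int. odd k \<and> \<alpha> - 2 \<le> t - of_int k \<and> t - of_int k \<le> \<alpha> \<and>
        (s' = 1 \<longrightarrow> t - of_int k < \<alpha>) \<and> (s' = -1 \<longrightarrow> \<alpha> - 2 < t - of_int k)"
    proof (cases "s' = 1")
      case True
      have "\<alpha> - 2 \<le> t - of_int (d\<^sub>\<alpha> \<alpha> r) \<and> t - of_int (d\<^sub>\<alpha> \<alpha> r) < \<alpha>"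
        using \<phi>_in_I[OF r0] \<phi>_eq[OF r0] by (simp add: t_def)
      then show ?thesis using d_odd True by (intro exI[of _ "d\<^sub>\<alpha> \<alpha> r"]) auto
    next
      case False
      let ?u = "(t - \<alpha> - 1) / 2"
      define c where "c = \<lceil>?u\<rceil>"
      have "?u \<le> of_int c" "of_int c < ?u + 1" unfolding c_def by linarith+
      then have "t - \<alpha> - 1 \<le> 2 * of_int c" "2 * of_int c < t - \<alpha> + 1" by (simp_all add: field_simps)
      then show ?thesis using False by (intro exI[of _ "2 * c + 1"]) auto
    qed
    then obtain k :: int where k: "odd k" and r'b: "\<alpha> - 2 \<le> t - of_int k" "t - of_int k \<le> \<alpha>"
      and r'1: "s' = 1 \<Longrightarrow> t - of_int k < \<alpha>" and r'2: "s' = -1 \<Longrightarrow> \<alpha> - 2 < t - of_int k"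
      by blast
    define r' where "r' = t - of_int k"
    have k1: "1 \<le> k"
    proof (rule digit_pos[OF r0 less.prems(4,5), of r'])
      show "r < \<alpha> \<or> r' < \<alpha>"
        using s less.prems(6) r'1 \<alpha>_bounds by (cases "0 < r") (auto simp: r'_def s'_def \<epsilon>_def)
    qed (use r'b k in \<open>auto simp: r'_def t_def\<close>)
    \<comment> \<open>This makes the modulus of q - k |p| smaller than q, so the fraction (q - k
      |p|)/|p| is a smaller instance of the descent.\<close>
    have "of_int k < 2 * t"
    proof (cases "k = 1")
      case False
      with k1 k have "3 \<le> k" by (cases "k = 2") auto
      then have "3 \<le> real_of_int k" by simp
      then show ?thesis using r'b \<alpha>_bounds by linarith
    qed (use t in simp)
    then have "of_int k * of_int \<bar>p\<bar> < 2 * (of_int q :: real)"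
      using False by (simp add: t_eq field_simps)
    then have kq: "k * \<bar>p\<bar> < 2 * q" by (metis of_int_less_iff of_int_mult of_int_numeral)
    have kp: "0 < k * \<bar>p\<bar>" using k1 False by simp
    have r'_eq: "r' = of_int (q - k * \<bar>p\<bar>) / of_int \<bar>p\<bar>"
      using False by (simp add: r'_def t_eq field_simps)
    \<comment> \<open>A point on the chosen side of r and closer than \<delta> is still in
      \<open>I\<^sub>o\<close>.\<close>
    define \<delta> where "\<delta> = min e (if s = 1 then \<alpha> - r else r - (\<alpha> - 2))"
    have \<delta>: "0 < \<delta>" "\<delta> \<le> e" using s less.prems by (auto simp: \<delta>_def)
    have "nat (\<bar>q - k * \<bar>p\<bar>\<bar> + \<bar>p\<bar>) < nat (\<bar>p\<bar> + q)"
      using kq kp less.prems(1) by (subst nat_less_eq_zless) auto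
    \<comment> \<open>Distance 1/4 keeps k + y above 1/3; then the branch magnifies distances from
      r' by at most 3 * 2 = 6, which \<delta>/8 absorbs.\<close>
    from less.hyps[OF this _ s'(2) r'_eq, of "min (1/4) (\<delta> / 8)"]
    obtain v where v: "admissible v I\<^sub>o"
      and vz: "\<And>z. z \<in> I\<^sub>o \<Longrightarrow> 0 < of_int s' * (inverse_branch v z - r')"
        "\<And>z. z \<in> I\<^sub>o \<Longrightarrow> of_int s' * (inverse_branch v z - r') < min (1/4) (\<delta> / 8)"
      using False r'b r'1 r'2 \<delta> by (auto simp: r'_def)
    have main: "0 < of_int k + inverse_branch v z \<and> 0 < of_int s * (inverse_branch ((\<epsilon>, k) # v) z - r)
        \<and> of_int s * (inverse_branch ((\<epsilon>, k) # v) z - r) < \<delta>" if z: "z \<in> I\<^sub>o" for z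
    proof -
      let ?y = "inverse_branch v z"
      define D where "D = of_int s' * (?y - r')"
      have D: "0 < D" "D < 1/4" "D < \<delta> / 8" using vz[OF z] by (auto simp: D_def)
      have "\<bar>?y - r'\<bar> < 1/4" using vz[OF z] s' by auto
      then have "- (1/4) < ?y - r'" by linarith
      then have y: "1/3 < of_int k + ?y" using t(1) unfolding r'_def by linarith
      have "of_int s * (inverse_branch ((\<epsilon>, k) # v) z - r) = D * (1 / (of_int k + ?y)) * (1 / t)"
        using y t by (simp add: D_def r_eq r'_def s'_def field_simps)
      moreover have "D * (1 / (of_int k + ?y)) * (1 / t) < \<delta>"
      proof -
        have "1 / (of_int k + ?y) \<le> 3" "1 / t \<le> 2" using y t by (auto simp: field_simps)
        then have "D * (1 / (of_int k + ?y)) * (1 / t) \<le> D * 3 * 2"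
          using D y t by (intro mult_mono) auto
        then show ?thesis using D by auto
      qed
      moreover have "0 < D * (1 / (of_int k + ?y)) * (1 / t)"
        using D y t by (intro mult_pos_pos) auto
      ultimately show ?thesis using y by simp
    qed
    have "inverse_branch ((\<epsilon>, k) # v) z \<in> I\<^sub>o" if "z \<in> I\<^sub>o" for z
      using main[OF that] s less.prems(4,5) by (auto simp: \<delta>_def)
    then have "admissible ((\<epsilon>, k) # v) I\<^sub>o"
      using v k k1 \<epsilon> main by auto
    then show ?thesis using main \<delta> by (intro exI[of _ "(\<epsilon>, k) # v"]) force
  qed
qed

lemma full_branch_in_interval:
  assumes "a < b" "{a<..<b} \<subseteq> I\<^sub>o"
  obtains v where "admissible v I\<^sub>o" "inverse_branch v ` I\<^sub>o \<subseteq> {a<..<b}"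
proof -
  obtain r where r: "r \<in> \<rat>" "a < r" "r < b" using Rats_dense_in_real[OF assms(1)] by blast
  obtain p q :: int where pq: "0 < q" "r = of_int p / of_int q"
    using r(1) by (elim Rats_cases')
  have "r \<in> I\<^sub>o" using assms r by auto
  then obtain v where "admissible v I\<^sub>o"
    "\<forall>z\<in>I\<^sub>o. 0 < of_int 1 * (inverse_branch v z - r) \<and> of_int 1 * (inverse_branch v z - r) < b - r"
    using full_branch_near_rational[of q 1 r p "b - r"] pq r by auto
  then show ?thesis using r by (intro that[of v]) force+
qed

end

section \<open>The invariant density\<close>

text \<open>The integral of (1 + x y)^(-2) over 0 \<le> y \<le> b.\<close>

definition kern :: "real \<Rightarrow> real \<Rightarrow> real" where
  "kern b x = b / (1 + b * x)"

lemma kern_has_real_derivative: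
  assumes "1 + x * y \<noteq> 0"
  shows "((\<lambda>y. kern y x) has_real_derivative 1 / (1 + x * y)\<^sup>2) (at y)"
  unfolding kern_def using assms
  by (auto intro!: derivative_eq_intros simp: power2_eq_square mult.commute)

lemma nn_integral_FTC_increasing:
  fixes f F :: "real \<Rightarrow> real"
  assumes "f \<in> borel_measurable borel" "u \<le> v"
    and D: "\<And>x. u \<le> x \<Longrightarrow> x \<le> v \<Longrightarrow> (F has_real_derivative f x) (at x)"
    and nn: "\<And>x. u \<le> x \<Longrightarrow> x \<le> v \<Longrightarrow> 0 \<le> f x"
  shows "(\<integral>\<^sup>+x. ennreal (f x) * indicator {u..v} x \<partial>lborel) = ennreal (F v - F u)" "0 \<le> F v - F u"
proof -
  show "(\<integral>\<^sup>+x. ennreal (f x) * indicator {u..v} x \<partial>lborel) = ennreal (F v - F u)"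
    using assms by (intro nn_integral_FTC_Icc) (auto intro: has_field_derivative_at_within)
  have "F u \<le> F v" by (rule DERIV_nonneg_imp_nondecreasing[OF \<open>u \<le> v\<close>]) (use D nn in blast)
  then show "0 \<le> F v - F u" by simp
qed

lemma kern_antiderivative:
  assumes "0 < 1 + b * x"
  shows "((\<lambda>x. ln (1 + b * x)) has_real_derivative kern b x) (at x within S)"
  unfolding kern_def using assms by (auto intro!: derivative_eq_intros)

lemma kern_integral_fiber:
  assumes "a \<le> b" "\<And>y. a \<le> y \<Longrightarrow> y \<le> b \<Longrightarrow> 0 < 1 + x * y"
  shows "(\<integral>\<^sup>+y. ennreal (1 / (1 + x * y)\<^sup>2) * indicator {a..b} y \<partial>lborel) = ennreal (kern b x - kern a x)"
    "kern a x \<le> kern b x"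
proof -
  have D: "((\<lambda>y. kern y x) has_real_derivative 1 / (1 + x * y)\<^sup>2) (at y)" if "a \<le> y" "y \<le> b" for y
    using assms(2)[OF that] by (intro kern_has_real_derivative) auto
  have "(\<lambda>y. 1 / (1 + x * y)\<^sup>2) \<in> borel_measurable borel" by measurable
  from nn_integral_FTC_increasing[OF this assms(1) D]
  show "(\<integral>\<^sup>+y. ennreal (1 / (1 + x * y)\<^sup>2) * indicator {a..b} y \<partial>lborel) = ennreal (kern b x - kern a x)"
    "kern a x \<le> kern b x" by auto
qed

text \<open>Divided by t^2, the kernel at 1/t or -1/t splits into simple fractions in t. Summing
  over odd digits means t = z + 1, z + 3, ..., and such fractions can cancel.\<close>

lemma kern_branch_pos: "0 < t \<Longrightarrow> 0 \<le> b \<Longrightarrow> kern b (1 / t) / t\<^sup>2 = 1 / t - 1 / (t + b)"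
  by (simp add: kern_def power2_eq_square divide_simps)

lemma kern_branch_neg: "0 < t \<Longrightarrow> t \<noteq> b \<Longrightarrow> kern b (- 1 / t) / t\<^sup>2 = 1 / (t - b) - 1 / t"
  by (simp add: kern_def power2_eq_square divide_simps)

context odd_cf
begin

text \<open>The height 2 - G of the lowest rectangle, also equal to g^2.\<close>

abbreviation "\<theta> \<equiv> 1 - golden_g"

text \<open>
  For \<open>golden_g < \<alpha> < golden_G\<close> these are the images \<open>\<phi> \<alpha>\<close> and \<open>\<phi> (\<alpha> - 2)\<close>; with these formulas the
  description of the natural extension domain is, up to null sets, uniform in \<open>\<alpha>\<close>.
\<close>

definition e1 :: real where "e1 = 1 / \<alpha> - 1"
definition e2 :: real where "e2 = 1 / (2 - \<alpha>) - 1"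

text \<open>One summand for each rectangle, with tops at \<theta>, 1 and G. It is not normalised:
  its integral is 3 ln G.\<close>

definition invariant_density :: "real \<Rightarrow> real" where
  "invariant_density x = (if \<alpha> - 2 \<le> x \<and> x < \<alpha> then kern \<theta> x else 0)
       + (if e1 < x \<and> x < \<alpha> then kern 1 x - kern \<theta> x else 0)
       + (if e2 \<le> x \<and> x < \<alpha> then kern golden_G x - kern 1 x else 0)"

lemma \<theta>_bounds: "38/100 < \<theta>" "\<theta> < 39/100"
  using golden_g_numeric by simp_all

text \<open>Since kern b z = 1/(1/b + z), the kernels for \<theta>, 1 and G become 1/(z + 3 -
  \<theta>), 1/(z + 1) and 1/(z + 1 - \<theta>), the same fractions that arise from the preimages of
  z.\<close>

lemma \<theta>_inverse: "1 / \<theta> = 3 - \<theta>" "1 / golden_G = 1 - \<theta>"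
proof -
  have "(3 - \<theta>) * \<theta> = 1" using golden_g_sq by (simp add: algebra_simps)
  then show "1 / \<theta> = 3 - \<theta>" using \<theta>_bounds by (simp add: field_simps)
  have "golden_G * (1 - \<theta>) = 1" using golden_g_sq by (simp add: golden_G_eq algebra_simps)
  then show "1 / golden_G = 1 - \<theta>" using golden_bounds by (simp add: field_simps)
qed

lemma e_bounds: "\<alpha> - 2 \<le> e1" "e1 \<le> \<alpha>" "\<alpha> - 2 \<le> e2" "e2 \<le> \<alpha>"
proof -
  show "\<alpha> - 2 \<le> e1" "e1 \<le> \<alpha>" "e2 \<le> \<alpha>"
    using \<alpha>_bounds by (simp_all add: e1_def e2_def field_simps)
  have "0 \<le> 1 / (2 - \<alpha>) - (\<alpha> - 1)"
  proof -
    have "(\<alpha> - 1) * (2 - \<alpha>) = 1/4 - (\<alpha> - 3/2)\<^sup>2" by (simp add: power2_eq_square algebra_simps)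
    also have "\<dots> \<le> 1" using zero_le_power2[of "\<alpha> - 3/2"] by linarith
    finally show ?thesis using \<alpha>_bounds by (simp add: field_simps)
  qed
  then show "\<alpha> - 2 \<le> e2" by (simp add: e2_def)
qed

text \<open>The left sides are values of 1 + x y at corners of the rectangles. They all factor into
  g, g + \<alpha>, \<alpha> and 2 - \<alpha>, so that the logarithms in the total mass
  cancel.\<close>

lemma e_golden_identities:
  "1 + e1 = 1 / \<alpha>" "1 + e2 = 1 / (2 - \<alpha>)"
  "1 + \<theta> * (\<alpha> - 2) = golden_g\<^sup>2 * (golden_g + \<alpha>)"
  "1 + \<theta> * e1 = golden_g * (golden_g + \<alpha>) / \<alpha>"
  "1 + golden_G * \<alpha> = (golden_g + \<alpha>) / golden_g"
  "1 + golden_G * e2 = golden_g * (golden_g + \<alpha>) / (2 - \<alpha>)"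
proof -
  note g2 = golden_g_sq
  have nz: "\<alpha> \<noteq> 0" "2 - \<alpha> \<noteq> 0" "golden_g \<noteq> 0" using \<alpha>_bounds golden_bounds by auto
  show "1 + e1 = 1 / \<alpha>" "1 + e2 = 1 / (2 - \<alpha>)" by (simp_all add: e1_def e2_def)
  have th: "\<theta> = golden_g * golden_g" using g2 by simp
  have g4: "golden_g * golden_g * golden_g = 2 * golden_g - 1" using g2 by algebra
  show "1 + \<theta> * (\<alpha> - 2) = golden_g\<^sup>2 * (golden_g + \<alpha>)"
    unfolding th power2_eq_square using g4 g2 by algebra
  have "\<alpha> * (1 + \<theta> * e1) = \<alpha> + \<theta> * (\<alpha> * e1)" by (simp add: algebra_simps)
  also have "\<alpha> * e1 = 1 - \<alpha>" using nz by (simp add: e1_def algebra_simps)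
  also have "\<alpha> + \<theta> * (1 - \<alpha>) = golden_g * (golden_g + \<alpha>)" using g2 by algebra
  finally show "1 + \<theta> * e1 = golden_g * (golden_g + \<alpha>) / \<alpha>"
    using nz by (simp add: field_simps)
  have "golden_g * (1 + golden_G * \<alpha>) = golden_g + \<alpha>"
    unfolding golden_G_eq using g2 by algebra
  then show "1 + golden_G * \<alpha> = (golden_g + \<alpha>) / golden_g"
    using nz by (simp add: field_simps)
  have "(2 - \<alpha>) * (1 + golden_G * e2) = (2 - \<alpha>) + golden_G * ((2 - \<alpha>) * e2)"
    by (simp add: algebra_simps)
  also have "(2 - \<alpha>) * e2 = \<alpha> - 1"
    using nz by (simp add: e2_def algebra_simps)
  also have "(2 - \<alpha>) + golden_G * (\<alpha> - 1) = golden_g * (golden_g + \<alpha>)"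
    unfolding golden_G_eq using g2 by algebra
  finally show "1 + golden_G * e2 = golden_g * (golden_g + \<alpha>) / (2 - \<alpha>)"
    using nz by (simp add: field_simps)
qed

text \<open>For x < 0 the smallest value of 1 + x y is attained at the corner furthest left and
  highest; 4/10 lies below the values at all three such corners.\<close>

lemma fiber_pos:
  shows "\<alpha> - 2 \<le> x \<Longrightarrow> 0 \<le> y \<Longrightarrow> y \<le> \<theta> \<Longrightarrow> 4/10 < 1 + x * y"
    and "e1 \<le> x \<Longrightarrow> 0 \<le> y \<Longrightarrow> y \<le> 1 \<Longrightarrow> 4/10 < 1 + x * y"
    and "e2 \<le> x \<Longrightarrow> 0 \<le> y \<Longrightarrow> y \<le> golden_G \<Longrightarrow> 4/10 < 1 + x * y"
proof -
  have gen: "4/10 < 1 + x * y" if xl: "l \<le> x" and y: "0 \<le> y" "y \<le> b" and l: "4/10 < 1 + b * l" for l b x y :: real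
  proof (cases "x \<ge> 0")
    case True
    then show ?thesis using y mult_nonneg_nonneg[of x y] by linarith
  next
    case False
    have "l * b \<le> l * y" using False xl y by (intro mult_left_mono_neg) auto
    also have "l * y \<le> x * y" using xl y by (intro mult_right_mono) auto
    finally show ?thesis using l by (simp add: mult.commute)
  qed
  have "\<theta> * (2 - \<alpha>) \<le> 39/100 * (14/10)" using \<alpha>_bounds \<theta>_bounds by (intro mult_mono) auto
  moreover have "1 + \<theta> * (\<alpha> - 2) = 1 - \<theta> * (2 - \<alpha>)" by (simp add: algebra_simps)
  ultimately have 1: "4/10 < 1 + \<theta> * (\<alpha> - 2)" by simp
  have "4/10 < 1 / \<alpha>" using \<alpha>_bounds by (simp add: field_simps)
  then have 2: "4/10 < 1 + 1 * e1" using e_golden_identities(1) by simp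
  have "6/10 * (12/10) \<le> golden_g * (golden_g + \<alpha>)"
    using \<alpha>_bounds golden_g_numeric by (intro mult_mono) auto
  then have 3: "4/10 < 1 + golden_G * e2"
    unfolding e_golden_identities(6) using \<alpha>_bounds by (simp add: field_simps)
  show "\<alpha> - 2 \<le> x \<Longrightarrow> 0 \<le> y \<Longrightarrow> y \<le> \<theta> \<Longrightarrow> 4/10 < 1 + x * y"
    "e1 \<le> x \<Longrightarrow> 0 \<le> y \<Longrightarrow> y \<le> 1 \<Longrightarrow> 4/10 < 1 + x * y"
    "e2 \<le> x \<Longrightarrow> 0 \<le> y \<Longrightarrow> y \<le> golden_G \<Longrightarrow> 4/10 < 1 + x * y" for x y
    using gen 1 2 3 by blast+
qed

lemma fiber_integrals:
  shows "\<alpha> - 2 \<le> x \<Longrightarrow> (\<integral>\<^sup>+y. ennreal (1 / (1 + x * y)\<^sup>2) * indicator {0..\<theta>} y \<partial>lborel) = ennreal (kern \<theta> x)"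
    and "\<alpha> - 2 \<le> x \<Longrightarrow> 0 \<le> kern \<theta> x"
    and "e1 \<le> x \<Longrightarrow> (\<integral>\<^sup>+y. ennreal (1 / (1 + x * y)\<^sup>2) * indicator {\<theta>..1} y \<partial>lborel) = ennreal (kern 1 x - kern \<theta> x)"
    and "e1 \<le> x \<Longrightarrow> kern \<theta> x \<le> kern 1 x"
    and "e2 \<le> x \<Longrightarrow> (\<integral>\<^sup>+y. ennreal (1 / (1 + x * y)\<^sup>2) * indicator {1..golden_G} y \<partial>lborel) = ennreal (kern golden_G x - kern 1 x)"
    and "e2 \<le> x \<Longrightarrow> kern 1 x \<le> kern golden_G x"
proof -
  have k0: "kern 0 x = 0" by (simp add: kern_def)
  note fp = fiber_pos[of x]
  have pos: "\<alpha> - 2 \<le> x \<Longrightarrow> 0 \<le> y \<Longrightarrow> y \<le> \<theta> \<Longrightarrow> 0 < 1 + x * y"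
    "e1 \<le> x \<Longrightarrow> \<theta> \<le> y \<Longrightarrow> y \<le> 1 \<Longrightarrow> 0 < 1 + x * y"
    "e2 \<le> x \<Longrightarrow> 1 \<le> y \<Longrightarrow> y \<le> golden_G \<Longrightarrow> 0 < 1 + x * y" for y
    using fp[of y] \<theta>_bounds by fastforce+
  have le: "0 \<le> \<theta>" "\<theta> \<le> 1" "1 \<le> golden_G" using \<theta>_bounds golden_bounds by auto
  show "(\<integral>\<^sup>+y. ennreal (1 / (1 + x * y)\<^sup>2) * indicator {0..\<theta>} y \<partial>lborel) = ennreal (kern \<theta> x)"
    "0 \<le> kern \<theta> x" if "\<alpha> - 2 \<le> x"
    using kern_integral_fiber[OF le(1) pos(1)[OF that]] k0 by simp_all
  show "(\<integral>\<^sup>+y. ennreal (1 / (1 + x * y)\<^sup>2) * indicator {\<theta>..1} y \<partial>lborel) = ennreal (kern 1 x - kern \<theta> x)"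
    "kern \<theta> x \<le> kern 1 x" if "e1 \<le> x"
    using kern_integral_fiber[OF le(2) pos(2)[OF that]] by blast+
  show "(\<integral>\<^sup>+y. ennreal (1 / (1 + x * y)\<^sup>2) * indicator {1..golden_G} y \<partial>lborel) = ennreal (kern golden_G x - kern 1 x)"
    "kern 1 x \<le> kern golden_G x" if "e2 \<le> x"
    using kern_integral_fiber[OF le(3) pos(3)[OF that]] by blast+
qed

lemma invariant_density_nonneg: "0 \<le> invariant_density x"
  unfolding invariant_density_def using fiber_integrals(2,4,6)[of x] by auto

lemma invariant_density_outside: "\<not> (\<alpha> - 2 \<le> x \<and> x < \<alpha>) \<Longrightarrow> invariant_density x = 0"
  unfolding invariant_density_def using e_bounds by auto

lemma invariant_density_le: "invariant_density x \<le> 10"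
proof -
  \<comment> \<open>Numerators below 4/10, at most 1 and at most 2 over a denominator above 4/10;
    the three bounds add up to less than 10.\<close>
  have k: "\<alpha> - 2 \<le> x \<Longrightarrow> kern \<theta> x \<le> 1" "e1 \<le> x \<Longrightarrow> kern 1 x \<le> 25/10" "e2 \<le> x \<Longrightarrow> kern golden_G x \<le> 5"
    using fiber_pos(1)[of x \<theta>] fiber_pos(2)[of x 1] fiber_pos(3)[of x golden_G] \<theta>_bounds golden_bounds
    by (auto simp: kern_def divide_le_eq mult.commute)
  have k0: "e1 \<le> x \<Longrightarrow> 0 \<le> kern \<theta> x" "e2 \<le> x \<Longrightarrow> 0 \<le> kern 1 x"
    using fiber_integrals(2)[of x] e_bounds fiber_pos(3)[of x 1] golden_bounds by (auto simp: kern_def)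
  show ?thesis unfolding invariant_density_def using k k0 by (auto simp: less_imp_le)
qed

lemma measurable_invariant_density[measurable]: "invariant_density \<in> borel_measurable borel"
  unfolding invariant_density_def[abs_def] kern_def[abs_def] by measurable

text \<open>The lines x = e1, y = \<theta> and y = 1 are null and left open. At \<alpha> = g one has
  e1 = \<alpha>, so the middle rectangle is empty; at \<alpha> = G one has e2 = \<alpha>, so the top
  one is empty, and e1 = \<alpha> - 2 merges the two lower ones.\<close>

lemma \<Omega>_iff:
  assumes "x \<noteq> e1" "y \<noteq> \<theta>" "y \<noteq> 1"
  shows "(x, y) \<in> \<Omega>\<^sub>\<alpha> \<alpha> \<longleftrightarrow> (\<alpha> - 2 \<le> x \<and> x < \<alpha> \<and> 0 \<le> y \<and> y \<le> \<theta>)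
    \<or> (e1 < x \<and> x < \<alpha> \<and> \<theta> \<le> y \<and> y \<le> 1) \<or> (e2 \<le> x \<and> x < \<alpha> \<and> 1 \<le> y \<and> y < golden_G)"
proof -
  have gG: "golden_g \<noteq> golden_G" by (simp add: golden_G_eq)
  have ginv: "1 / golden_g = 1 + golden_g" using golden_g_sq golden_bounds by (simp add: field_simps)
  have Ginv: "1 / golden_G = golden_g" using \<theta>_inverse(2) by simp
  have th2: "1 / \<theta> = 2 + golden_g" using \<theta>_inverse(1) by simp
  consider "\<alpha> = golden_g" | "\<alpha> = golden_G" | "golden_g < \<alpha>" "\<alpha> < golden_G"
    using \<alpha>_mem by force
  then show ?thesis
  proof cases
    case 1
    have E1: "e1 = \<alpha>" using ginv unfolding e1_def unfolding 1 by simp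
    have E2: "e2 = (golden_g - 1) / (2 - golden_g)"
      using golden_bounds unfolding e2_def unfolding 1 by (simp add: field_simps)
    show ?thesis using assms unfolding \<Omega>\<^sub>\<alpha>_def E1 E2 unfolding 1 by auto
  next
    case 2
    have E1: "e1 = \<alpha> - 2" using Ginv unfolding e1_def unfolding 2 by (simp add: golden_G_eq)
    have E2: "e2 = \<alpha>" using th2 unfolding e2_def unfolding 2 by (simp add: golden_G_eq)
    show ?thesis using assms gG \<theta>_bounds unfolding \<Omega>\<^sub>\<alpha>_def E1 E2 unfolding 2 by auto
  next
    case 3
    have "(\<alpha> - golden_g) * (\<alpha> + golden_G) > 0" using 3 golden_bounds by (intro mult_pos_pos) auto
    then have "1 < \<alpha> * \<alpha> + \<alpha>" using golden_g_sq by (simp add: golden_G_eq algebra_simps)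
    then have e1: "e1 < \<alpha>" using \<alpha>_bounds by (simp add: e1_def field_simps)
    have "(golden_G - \<alpha>) * (\<alpha> + golden_g) > 0" using 3 golden_bounds by (intro mult_pos_pos) auto
    then have "\<alpha> * \<alpha> < \<alpha> + 1" using golden_g_sq by (simp add: golden_G_eq algebra_simps)
    then have e2: "e2 < \<alpha>" using \<alpha>_bounds by (simp add: e2_def field_simps)
    have nz: "\<alpha> \<noteq> 0" "\<alpha> - 2 \<noteq> 0" "\<bar>\<alpha>\<bar> = \<alpha>" "\<bar>\<alpha> - 2\<bar> = 2 - \<alpha>" using \<alpha>_bounds by auto
    have "d\<^sub>\<alpha> \<alpha> \<alpha> = 1"
      using e1 e_bounds nz by (intro d_unique) (auto simp: e1_def)
    then have p1: "\<phi>\<^sub>\<alpha> \<alpha> \<alpha> = e1" using nz by (simp add: \<phi>\<^sub>\<alpha>_def e1_def)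
    have "d\<^sub>\<alpha> \<alpha> (\<alpha> - 2) = 1"
      using e2 e_bounds nz by (intro d_unique) (auto simp: e2_def)
    then have p2: "\<phi>\<^sub>\<alpha> \<alpha> (\<alpha> - 2) = e2" using nz by (simp add: \<phi>\<^sub>\<alpha>_def e2_def)
    have "2 - golden_G = \<theta>" by (simp add: golden_G_eq)
    then show ?thesis using 3 assms unfolding \<Omega>\<^sub>\<alpha>_def p1 p2 I\<^sub>\<alpha>_def by auto
  qed
qed

lemma sets_\<Omega>: "\<Omega>\<^sub>\<alpha> \<alpha> \<in> sets (borel \<Otimes>\<^sub>M borel)"
  unfolding \<Omega>\<^sub>\<alpha>_def I\<^sub>\<alpha>_def by auto

lemma fiber_mass:
  assumes "x \<noteq> e1"
  shows "(\<integral>\<^sup>+y. ennreal (1 / (1 + x * y)\<^sup>2) * indicator (\<Omega>\<^sub>\<alpha> \<alpha>) (x, y) \<partial>lborel) = ennreal (invariant_density x)"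
proof -
  define f where "f y = ennreal (1 / (1 + x * y)\<^sup>2)" for y
  have [measurable]: "f \<in> borel_measurable borel" unfolding f_def by measurable
  define c1 c2 c3 :: ennreal where
    "c1 = (if \<alpha> - 2 \<le> x \<and> x < \<alpha> then 1 else 0)"
    "c2 = (if e1 < x \<and> x < \<alpha> then 1 else 0)"
    "c3 = (if e2 \<le> x \<and> x < \<alpha> then 1 else 0)"
  have "AE y in lborel. y \<noteq> \<theta> \<and> y \<noteq> 1 \<and> y \<noteq> golden_G"
    by (intro AE_conjI AE_lborel_singleton)
  then have "AE y in lborel. f y * indicator (\<Omega>\<^sub>\<alpha> \<alpha>) (x, y)
      = c1 * (f y * indicator {0..\<theta>} y) + c2 * (f y * indicator {\<theta>..1} y)
        + c3 * (f y * indicator {1..golden_G} y)"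
  proof eventually_elim
    case (elim y)
    then show ?case
      using \<theta>_bounds golden_bounds
      by (auto simp: indicator_def \<Omega>_iff[OF assms] c1_c2_c3_def)
  qed
  then have "(\<integral>\<^sup>+y. f y * indicator (\<Omega>\<^sub>\<alpha> \<alpha>) (x, y) \<partial>lborel)
      = (\<integral>\<^sup>+y. c1 * (f y * indicator {0..\<theta>} y) + c2 * (f y * indicator {\<theta>..1} y)
        + c3 * (f y * indicator {1..golden_G} y) \<partial>lborel)"
    by (rule nn_integral_cong_AE)
  also have "\<dots> = c1 * (\<integral>\<^sup>+y. f y * indicator {0..\<theta>} y \<partial>lborel) + c2 * (\<integral>\<^sup>+y. f y * indicator {\<theta>..1} y \<partial>lborel)
        + c3 * (\<integral>\<^sup>+y. f y * indicator {1..golden_G} y \<partial>lborel)"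
    by (simp add: nn_integral_add nn_integral_cmult)
  also have "\<dots> = ennreal (invariant_density x)"
  proof -
    have t: "c1 * (\<integral>\<^sup>+y. f y * indicator {0..\<theta>} y \<partial>lborel) = ennreal (if \<alpha> - 2 \<le> x \<and> x < \<alpha> then kern \<theta> x else 0)"
      "c2 * (\<integral>\<^sup>+y. f y * indicator {\<theta>..1} y \<partial>lborel) = ennreal (if e1 < x \<and> x < \<alpha> then kern 1 x - kern \<theta> x else 0)"
      "c3 * (\<integral>\<^sup>+y. f y * indicator {1..golden_G} y \<partial>lborel) = ennreal (if e2 \<le> x \<and> x < \<alpha> then kern golden_G x - kern 1 x else 0)"
      using fiber_integrals(1,3,5)[of x] by (auto simp: f_def c1_c2_c3_def)
    show ?thesis
      unfolding t invariant_density_def using fiber_integrals(2,4,6)[of x] by (subst ennreal_plus[symmetric]; auto)+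
  qed
  finally show ?thesis by (simp add: f_def)
qed

lemma emeasure_\<nu>_density:
  assumes "E \<in> sets (restrict_space borel (I\<^sub>\<alpha> \<alpha>))"
  shows "emeasure (\<nu>\<^sub>\<alpha> \<alpha>) E
    = ennreal (1 / (3 * ln golden_G)) * (\<integral>\<^sup>+x. ennreal (invariant_density x) * indicator E x \<partial>lborel)"
proof -
  have EI: "E \<subseteq> I\<^sub>\<alpha> \<alpha>" and [measurable]: "E \<in> sets borel"
    using assms by (auto simp: sets_restrict_space I\<^sub>\<alpha>_def)
  note [measurable] = sets_\<Omega>
  let ?S = "{(x, y) \<in> \<Omega>\<^sub>\<alpha> \<alpha>. x \<in> E}"
  let ?f = "\<lambda>(x, y). ennreal (1 / (1 + x * y)\<^sup>2)"
  have S_eq: "?S = \<Omega>\<^sub>\<alpha> \<alpha> \<inter> (E \<times> UNIV)" by auto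
  have S[measurable]: "?S \<in> sets (borel \<Otimes>\<^sub>M borel)" unfolding S_eq by measurable
  have \<Omega>b: "\<Omega>\<^sub>\<alpha> \<alpha> \<in> sets borel" by (rule sets_\<Omega>[unfolded borel_prod])
  have Sr: "?S \<in> sets (restrict_space lborel (\<Omega>\<^sub>\<alpha> \<alpha>))"
    using \<Omega>b S[unfolded borel_prod] by (subst sets_restrict_space_iff) auto
  have fm: "?f \<in> borel_measurable (borel \<Otimes>\<^sub>M borel)" by measurable
  then have fm': "?f \<in> borel_measurable (lborel :: (real \<times> real) measure)" by (simp add: borel_prod)
  have "emeasure (\<mu>\<^sub>\<alpha> \<alpha>) ?S = (\<integral>\<^sup>+p. ?f p * indicator ?S p \<partial>restrict_space lborel (\<Omega>\<^sub>\<alpha> \<alpha>))"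
    unfolding \<mu>\<^sub>\<alpha>_def using Sr fm'
    by (subst emeasure_density) (auto intro: measurable_restrict_space1)
  also have "\<dots> = (\<integral>\<^sup>+p. ?f p * indicator ?S p * indicator (\<Omega>\<^sub>\<alpha> \<alpha>) p \<partial>lborel)"
    using \<Omega>b by (subst nn_integral_restrict_space) auto
  also have "\<dots> = (\<integral>\<^sup>+p. ?f p * indicator ?S p \<partial>lborel)"
    by (intro nn_integral_cong) (auto split: split_indicator)
  also have "\<dots> = (\<integral>\<^sup>+p. ?f p * indicator ?S p \<partial>(lborel \<Otimes>\<^sub>M lborel))"
    by (simp add: lborel_prod)
  also have "\<dots> = (\<integral>\<^sup>+x. (\<integral>\<^sup>+y. ?f (x, y) * indicator ?S (x, y) \<partial>lborel) \<partial>lborel)"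
    by (rule lborel.nn_integral_fst[symmetric]) (use fm S in measurable)
  also have "\<dots> = (\<integral>\<^sup>+x. ennreal (invariant_density x) * indicator E x \<partial>lborel)"
  proof (rule nn_integral_cong_AE)
    have "AE x in lborel. x \<noteq> e1" by (rule AE_lborel_singleton)
    then show "AE x in lborel. (\<integral>\<^sup>+y. ?f (x, y) * indicator ?S (x, y) \<partial>lborel) = ennreal (invariant_density x) * indicator E x"
    proof eventually_elim
      case (elim x)
      have "(\<integral>\<^sup>+y. ?f (x, y) * indicator ?S (x, y) \<partial>lborel)
        = (\<integral>\<^sup>+y. ennreal (1 / (1 + x * y)\<^sup>2) * indicator (\<Omega>\<^sub>\<alpha> \<alpha>) (x, y) \<partial>lborel) * indicator E x"
        by (auto intro!: nn_integral_cong split: split_indicator)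
      then show ?case using fiber_mass[OF elim] by simp
    qed
  qed
  finally show ?thesis
    using emeasure_\<nu>\<^sub>\<alpha>[OF \<alpha>_mem assms] by (simp add: normalized_\<mu>\<^sub>\<alpha>_def)
qed

text \<open>The antiderivatives ln (1 + b x) telescope over the three layers at the right end
  \<alpha>, leaving ln (1 + G \<alpha>). By the corner factorisations everything cancels except -3
  ln g, and 1/g = G.\<close>

lemma \<nu>_total: "(\<integral>\<^sup>+x. ennreal (invariant_density x) * indicator (I\<^sub>\<alpha> \<alpha>) x \<partial>lborel) = ennreal (3 * ln golden_G)"
proof -
  let ?A = "\<lambda>x. ennreal (kern \<theta> x) * indicator {\<alpha> - 2..\<alpha>} x"
  let ?B = "\<lambda>x. ennreal (kern 1 x - kern \<theta> x) * indicator {e1..\<alpha>} x"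
  let ?C = "\<lambda>x. ennreal (kern golden_G x - kern 1 x) * indicator {e2..\<alpha>} x"
  have [measurable]: "kern b \<in> borel_measurable borel" for b
    unfolding kern_def[abs_def] by measurable
  have p1: "0 < 1 + \<theta> * x" if "\<alpha> - 2 \<le> x" for x
    using fiber_pos(1)[OF that, of \<theta>] \<theta>_bounds by (simp add: mult.commute)
  have p2: "0 < 1 + 1 * x" if "e1 \<le> x \<or> e2 \<le> x" for x
    using fiber_pos(2)[of x 1] fiber_pos(3)[of x 1] golden_bounds that by auto
  have p3: "0 < 1 + golden_G * x" if "e2 \<le> x" for x
    using fiber_pos(3)[OF that, of golden_G] golden_bounds by (simp add: mult.commute)
  have m: "kern \<theta> \<in> borel_measurable borel" "(\<lambda>x. kern 1 x - kern \<theta> x) \<in> borel_measurable borel"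
    "(\<lambda>x. kern golden_G x - kern 1 x) \<in> borel_measurable borel" by measurable
  have D1: "((\<lambda>x. ln (1 + \<theta> * x)) has_real_derivative kern \<theta> x) (at x)" if "\<alpha> - 2 \<le> x" for x
    by (rule kern_antiderivative[OF p1[OF that]])
  have D2: "((\<lambda>x. ln (1 + 1 * x) - ln (1 + \<theta> * x)) has_real_derivative kern 1 x - kern \<theta> x) (at x)" if "e1 \<le> x" for x
    using that e_bounds by (intro DERIV_diff kern_antiderivative p1 p2) auto
  have D3: "((\<lambda>x. ln (1 + golden_G * x) - ln (1 + 1 * x)) has_real_derivative kern golden_G x - kern 1 x) (at x)" if "e2 \<le> x" for x
    using that e_bounds by (intro DERIV_diff kern_antiderivative p2 p3) auto
  have l1: "\<alpha> - 2 \<le> \<alpha>" by simp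
  have k2: "0 \<le> kern 1 x - kern \<theta> x" if "e1 \<le> x" for x using fiber_integrals(4)[OF that] by simp
  have k3: "0 \<le> kern golden_G x - kern 1 x" if "e2 \<le> x" for x using fiber_integrals(6)[OF that] by simp
  have iA: "(\<integral>\<^sup>+x. ?A x \<partial>lborel) = ennreal (ln (1 + \<theta> * \<alpha>) - ln (1 + \<theta> * (\<alpha> - 2)))"
    by (rule nn_integral_FTC_increasing(1)[OF m(1) l1 D1 fiber_integrals(2)])
  have nA: "0 \<le> ln (1 + \<theta> * \<alpha>) - ln (1 + \<theta> * (\<alpha> - 2))"
    by (rule nn_integral_FTC_increasing(2)[OF m(1) l1 D1 fiber_integrals(2)])
  have iB: "(\<integral>\<^sup>+x. ?B x \<partial>lborel) = ennreal ((ln (1 + 1 * \<alpha>) - ln (1 + \<theta> * \<alpha>)) - (ln (1 + 1 * e1) - ln (1 + \<theta> * e1)))"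
    by (rule nn_integral_FTC_increasing(1)[OF m(2) e_bounds(2) D2 k2])
  have nB: "0 \<le> (ln (1 + 1 * \<alpha>) - ln (1 + \<theta> * \<alpha>)) - (ln (1 + 1 * e1) - ln (1 + \<theta> * e1))"
    by (rule nn_integral_FTC_increasing(2)[OF m(2) e_bounds(2) D2 k2])
  have iC: "(\<integral>\<^sup>+x. ?C x \<partial>lborel) = ennreal ((ln (1 + golden_G * \<alpha>) - ln (1 + 1 * \<alpha>)) - (ln (1 + golden_G * e2) - ln (1 + 1 * e2)))"
    by (rule nn_integral_FTC_increasing(1)[OF m(3) e_bounds(4) D3 k3])
  have nC: "0 \<le> (ln (1 + golden_G * \<alpha>) - ln (1 + 1 * \<alpha>)) - (ln (1 + golden_G * e2) - ln (1 + 1 * e2))"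
    by (rule nn_integral_FTC_increasing(2)[OF m(3) e_bounds(4) D3 k3])
  have "AE x in lborel. x \<noteq> e1 \<and> x \<noteq> \<alpha>" by (intro AE_conjI AE_lborel_singleton)
  then have "AE x in lborel. ennreal (invariant_density x) * indicator (I\<^sub>\<alpha> \<alpha>) x = ?A x + ?B x + ?C x"
  proof eventually_elim
    case (elim x)
    have t: "?A x = ennreal (if \<alpha> - 2 \<le> x \<and> x < \<alpha> then kern \<theta> x else 0)"
      "?B x = ennreal (if e1 < x \<and> x < \<alpha> then kern 1 x - kern \<theta> x else 0)"
      "?C x = ennreal (if e2 \<le> x \<and> x < \<alpha> then kern golden_G x - kern 1 x else 0)"
      using elim by (auto simp: indicator_def)
    have "?A x + ?B x + ?C x = ennreal (invariant_density x)"
      unfolding t invariant_density_def using fiber_integrals(2,4,6)[of x] by (subst ennreal_plus[symmetric]; auto)+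
    then show ?case using invariant_density_outside[of x] by (auto simp: I\<^sub>\<alpha>_def indicator_def)
  qed
  then have "(\<integral>\<^sup>+x. ennreal (invariant_density x) * indicator (I\<^sub>\<alpha> \<alpha>) x \<partial>lborel) = (\<integral>\<^sup>+x. ?A x + ?B x + ?C x \<partial>lborel)"
    by (rule nn_integral_cong_AE)
  also have "\<dots> = (\<integral>\<^sup>+x. ?A x \<partial>lborel) + (\<integral>\<^sup>+x. ?B x \<partial>lborel) + (\<integral>\<^sup>+x. ?C x \<partial>lborel)"
    by (simp add: nn_integral_add)
  also have "\<dots> = ennreal ((ln (1 + \<theta> * \<alpha>) - ln (1 + \<theta> * (\<alpha> - 2)))
      + ((ln (1 + 1 * \<alpha>) - ln (1 + \<theta> * \<alpha>)) - (ln (1 + 1 * e1) - ln (1 + \<theta> * e1)))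
      + ((ln (1 + golden_G * \<alpha>) - ln (1 + 1 * \<alpha>)) - (ln (1 + golden_G * e2) - ln (1 + 1 * e2))))"
    unfolding iA iB iC using nA nB nC
    by (simp only: ennreal_plus add_nonneg_nonneg)
  also have "\<dots> = ennreal (3 * ln golden_G)"
  proof -
    have pos: "0 < golden_g" "0 < golden_g + \<alpha>" "0 < \<alpha>" "0 < 2 - \<alpha>" using golden_bounds \<alpha>_bounds by auto
    have "ln (1 + \<theta> * (\<alpha> - 2)) = 2 * ln golden_g + ln (golden_g + \<alpha>)"
      unfolding e_golden_identities using pos by (simp add: ln_mult ln_realpow)
    moreover have "ln (1 + 1 * e1) = - ln \<alpha>" using pos by (simp add: e_golden_identities ln_div)
    moreover have "ln (1 + 1 * e2) = - ln (2 - \<alpha>)" using pos by (simp add: e_golden_identities ln_div)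
    moreover have "ln (1 + \<theta> * e1) = ln golden_g + ln (golden_g + \<alpha>) - ln \<alpha>"
      unfolding e_golden_identities using pos by (simp add: ln_mult ln_div)
    moreover have "ln (1 + golden_G * \<alpha>) = ln (golden_g + \<alpha>) - ln golden_g"
      unfolding e_golden_identities using pos by (simp add: ln_div)
    moreover have "ln (1 + golden_G * e2) = ln golden_g + ln (golden_g + \<alpha>) - ln (2 - \<alpha>)"
      unfolding e_golden_identities using pos by (simp add: ln_mult ln_div)
    moreover have "ln golden_G = - ln golden_g"
    proof -
      have "golden_G * golden_g = 1" using golden_g_sq by (simp add: golden_G_eq algebra_simps)
      then have "ln (golden_G * golden_g) = 0" by simp
      then show ?thesis using golden_bounds by (simp add: ln_mult)
    qed
    ultimately show ?thesis by simp
  qed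
  finally show ?thesis .
qed

section \<open>The Perron-Frobenius equation\<close>

text \<open>
  The contribution of the two preimages \<open>\<plusminus>1 / t\<close> of \<open>z\<close> with digit \<open>k\<close>, where \<open>t = z + k\<close>, to the
  transfer operator.
\<close>

definition transfer :: "real \<Rightarrow> real" where
  "transfer t = (if 0 < t then (invariant_density (1 / t) + invariant_density (- 1 / t)) / t\<^sup>2 else 0)"

text \<open>The part that the digit \<open>k\<close> passes on to the digit \<open>k + 2\<close> in the telescoping sum.\<close>

definition shifted :: "real \<Rightarrow> real" where
  "shifted t = (if \<alpha> < 1 \<and> \<alpha> \<le> (1 - \<alpha>) * t then 1 / (t + \<theta>) - 1 / (t + 1) else 0)
    + (if 1 < \<alpha> \<and> 2 - \<alpha> < (\<alpha> - 1) * t then 1 / (t + 1) - 1 / (t + 2 - \<theta>) else 0)"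

lemma transfer_nonneg: "0 \<le> transfer t"
  unfolding transfer_def using invariant_density_nonneg by auto

text \<open>The interval conditions on 1/t and -1/t are multiplied by t; they become linear and can
  be compared at t and t - 2. Replacing G by 2 - \<theta> aligns the fractions in the same
  way.\<close>

lemma transfer_eq:
  assumes "0 < t"
  shows "transfer t =
      (if 1 < \<alpha> * t then 1 / t - 1 / (t + \<theta>) else 0)
    + (if (1 - \<alpha>) * t < \<alpha> \<and> 1 < \<alpha> * t then 1 / (t + \<theta>) - 1 / (t + 1) else 0)
    + (if (\<alpha> - 1) * t \<le> 2 - \<alpha> \<and> 1 < \<alpha> * t then 1 / (t + 1) - 1 / (t + 2 - \<theta>) else 0)
    + (if 1 \<le> (2 - \<alpha>) * t then 1 / (t - \<theta>) - 1 / t else 0)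
    + (if \<alpha> < (\<alpha> - 1) * t then 1 / (t - 1) - 1 / (t - \<theta>) else 0)
    + (if 2 - \<alpha> \<le> (1 - \<alpha>) * t then 1 / (t - 2 + \<theta>) - 1 / (t - 1) else 0)"
proof -
  have \<alpha>: "0 < \<alpha>" "0 < 2 - \<alpha>" using \<alpha>_bounds by auto
  have iff: "1 / t < \<alpha> \<longleftrightarrow> 1 < \<alpha> * t" "\<alpha> - 2 \<le> - 1 / t \<longleftrightarrow> 1 \<le> (2 - \<alpha>) * t"
    "e1 < 1 / t \<longleftrightarrow> (1 - \<alpha>) * t < \<alpha>" "e2 \<le> 1 / t \<longleftrightarrow> (\<alpha> - 1) * t \<le> 2 - \<alpha>"
    "e1 < - 1 / t \<longleftrightarrow> \<alpha> < (\<alpha> - 1) * t" "e2 \<le> - 1 / t \<longleftrightarrow> 2 - \<alpha> \<le> (1 - \<alpha>) * t"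
    using assms \<alpha> by (auto simp: e1_def e2_def field_simps)
  have triv: "\<alpha> - 2 \<le> 1 / t" "- 1 / t < \<alpha>"
  proof -
    have "0 < 1 / t" "- 1 / t < 0" using assms by auto
    then show "\<alpha> - 2 \<le> 1 / t" "- 1 / t < \<alpha>" using \<alpha> by linarith+
  qed
  have ne: "\<alpha> - 2 \<le> - 1 / t \<Longrightarrow> t \<noteq> \<theta>" "e1 < - 1 / t \<Longrightarrow> t \<noteq> 1 \<and> t \<noteq> \<theta>"
    "e2 \<le> - 1 / t \<Longrightarrow> t \<noteq> 1 \<and> t \<noteq> golden_G"
    using fiber_pos(1)[of "- 1 / t" \<theta>] fiber_pos(2)[of "- 1 / t" 1] fiber_pos(2)[of "- 1 / t" \<theta>]
      fiber_pos(3)[of "- 1 / t" 1] fiber_pos(3)[of "- 1 / t" golden_G] \<theta>_bounds golden_bounds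
    by (auto simp: divide_simps split: if_splits)
  have p: "invariant_density (1 / t) / t\<^sup>2 = (if 1 / t < \<alpha> then 1 / t - 1 / (t + \<theta>) else 0)
      + (if e1 < 1 / t \<and> 1 / t < \<alpha> then 1 / (t + \<theta>) - 1 / (t + 1) else 0)
      + (if e2 \<le> 1 / t \<and> 1 / t < \<alpha> then 1 / (t + 1) - 1 / (t + golden_G) else 0)"
    unfolding invariant_density_def using triv kern_branch_pos[OF assms, of \<theta>] kern_branch_pos[OF assms, of 1]
      kern_branch_pos[OF assms, of golden_G] \<theta>_bounds golden_bounds
    by (simp add: add_divide_distrib diff_divide_distrib)
  have n: "invariant_density (- 1 / t) / t\<^sup>2 = (if \<alpha> - 2 \<le> - 1 / t then 1 / (t - \<theta>) - 1 / t else 0)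
      + (if e1 < - 1 / t then 1 / (t - 1) - 1 / (t - \<theta>) else 0)
      + (if e2 \<le> - 1 / t then 1 / (t - golden_G) - 1 / (t - 1) else 0)"
    unfolding invariant_density_def using triv ne kern_branch_neg[OF assms, of \<theta>] kern_branch_neg[OF assms, of 1]
      kern_branch_neg[OF assms, of golden_G]
    by (simp add: add_divide_distrib diff_divide_distrib)
  have G: "t + golden_G = t + 2 - \<theta>" "t - golden_G = t - 2 + \<theta>" by (simp_all add: golden_G_eq)
  show ?thesis
    using assms unfolding transfer_def add_divide_distrib p n iff G by simp
qed

text \<open>As t > 1 + \<alpha>, both 1/t and -1/t lie in the interval. The remaining conditions on
  -1/t are the negated conditions on the positive preimage with t - 2 in place of t: for instance 2
  - \<alpha> \<le> (1 - \<alpha>) t iff \<alpha> \<le> (1 - \<alpha>) (t - 2). For \<alpha> < 1 only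
  the first summand of \<open>shifted\<close> can occur, for \<alpha> > 1 only the second.\<close>

lemma transfer_telescope:
  assumes z: "\<alpha> - 2 < z" and t: "z + 3 \<le> t"
  shows "transfer t = (1 / (t - \<theta>) + shifted (t - 2)) - (1 / (t + 2 - \<theta>) + shifted t)"
proof -
  have t0: "0 < t" and t1: "1 + \<alpha> < t" using z t \<alpha>_bounds by linarith+
  have "\<alpha> * (1 + \<alpha>) < \<alpha> * t" using t1 \<alpha>_bounds by (intro mult_strict_left_mono) auto
  then have c1: "1 < \<alpha> * t" using \<alpha>_bounds by (simp add: algebra_simps)
  have "(2 - \<alpha>) * (1 + \<alpha>) < (2 - \<alpha>) * t" using t1 \<alpha>_bounds by (intro mult_strict_left_mono) auto
  then have c2: "1 \<le> (2 - \<alpha>) * t" using \<alpha>_bounds by (simp add: algebra_simps)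
  consider "\<alpha> < 1" | "\<alpha> = 1" | "1 < \<alpha>" by linarith
  then show ?thesis
  proof cases
    case 1
    have "(\<alpha> - 1) * t \<le> 0" "(\<alpha> - 1) * t = - ((1 - \<alpha>) * t)"
      using 1 t0 by (auto simp: algebra_simps mult_le_0_iff intro: mult_right_mono)
    moreover have "2 - \<alpha> \<le> (1 - \<alpha>) * t \<longleftrightarrow> \<alpha> \<le> (1 - \<alpha>) * (t - 2)" by (simp add: algebra_simps)
    ultimately show ?thesis
      unfolding transfer_eq[OF t0] shifted_def using c1 c2 1 \<alpha>_bounds by (auto simp: not_less not_le)
  next
    case 2
    then show ?thesis
      unfolding transfer_eq[OF t0] shifted_def using c1 c2 by auto
  next
    case 3
    have "(1 - \<alpha>) * t \<le> 0" "(1 - \<alpha>) * t = - ((\<alpha> - 1) * t)"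
      using 3 t0 by (auto simp: algebra_simps mult_le_0_iff intro: mult_right_mono)
    moreover have "\<alpha> < (\<alpha> - 1) * t \<longleftrightarrow> 2 - \<alpha> < (\<alpha> - 1) * (t - 2)" by (simp add: algebra_simps)
    ultimately show ?thesis
      unfolding transfer_eq[OF t0] shifted_def using c1 c2 3 \<alpha>_bounds by (auto simp: not_less not_le)
  qed
qed

text \<open>The digit 1 is where fullness fails. With t = z + 1, the positive preimage lies in the
  interval iff z > e1 and the negative one iff z \<ge> e2: these are the conditions of the second
  and third rectangles. The first rectangle contributes 1/(z + 3 - \<theta>), which is passed on to
  the digit 3.\<close>

lemma transfer_first:
  assumes z: "\<alpha> - 2 < z" "z < \<alpha>" "z \<noteq> e1"
  shows "transfer (z + 1) = invariant_density z - (1 / (z + 3 - \<theta>) + shifted (z + 1))"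
proof -
  define t where "t = z + 1"
  have \<alpha>: "0 < \<alpha>" "0 < 2 - \<alpha>" using \<alpha>_bounds by auto
  have zt: "z = t - 1" by (simp add: t_def)
  have e: "e1 < z \<longleftrightarrow> 1 < \<alpha> * t" "e2 \<le> z \<longleftrightarrow> 1 \<le> (2 - \<alpha>) * t" "z = e1 \<longleftrightarrow> \<alpha> * t = 1"
    using \<alpha> unfolding zt by (auto simp: e1_def e2_def field_simps)
  have k: "kern \<theta> z = 1 / (t + 2 - \<theta>)" "kern 1 z = 1 / t" "kern golden_G z = 1 / (t - \<theta>)"
  proof -
    have kern_inv: "kern b z = 1 / (1 / b + z)" if "0 < b" for b
      using that by (simp add: kern_def field_simps)
    have p: "0 < \<theta>" "0 < golden_G" using \<theta>_bounds golden_bounds by auto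
    show "kern \<theta> z = 1 / (t + 2 - \<theta>)"
      unfolding kern_inv[OF p(1)] \<theta>_inverse by (simp add: zt algebra_simps)
    show "kern 1 z = 1 / t"
      unfolding kern_inv[OF zero_less_one] by (simp add: zt)
    show "kern golden_G z = 1 / (t - \<theta>)"
      unfolding kern_inv[OF p(2)] \<theta>_inverse by (simp add: zt algebra_simps)
  qed
  have invariant_density: "invariant_density z = 1 / (t + 2 - \<theta>) + (if 1 < \<alpha> * t then 1 / t - 1 / (t + 2 - \<theta>) else 0)
      + (if 1 \<le> (2 - \<alpha>) * t then 1 / (t - \<theta>) - 1 / t else 0)"
    unfolding invariant_density_def e k using z by simp
  have t3: "z + 3 - \<theta> = t + 2 - \<theta>" by (simp add: zt)
  have nt: "\<alpha> * t \<noteq> 1" using z(3) e(3) by simp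
  have "transfer t = invariant_density z - (1 / (t + 2 - \<theta>) + shifted t)"
  proof (cases "0 < t")
    case False
    have "\<alpha> * t \<le> 0" "(2 - \<alpha>) * t \<le> 0" using False \<alpha> by (auto intro!: mult_nonneg_nonpos)
    moreover have "\<alpha> < 1 \<Longrightarrow> (1 - \<alpha>) * t \<le> 0" "1 < \<alpha> \<Longrightarrow> (\<alpha> - 1) * t \<le> 0"
      using False by (auto intro!: mult_nonneg_nonpos)
    ultimately show ?thesis
      using False \<alpha> unfolding invariant_density shifted_def transfer_def by auto
  next
    case True
    have ta: "t < 1 + \<alpha>" using z by (simp add: t_def)
    consider "\<alpha> < 1" | "\<alpha> = 1" | "1 < \<alpha>" by linarith
    then show ?thesis
    proof cases
      case 1
      have "(\<alpha> - 1) * t \<le> 0" using 1 True by (auto intro!: mult_nonpos_nonneg)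
      moreover have "(1 - \<alpha>) * t < 2 - \<alpha>"
      proof -
        have "(1 - \<alpha>) * t \<le> 1 * t" using 1 \<alpha> True by (intro mult_right_mono) auto
        moreover have "(1 - \<alpha>) * t < (1 - \<alpha>) * (1 + \<alpha>)" using 1 ta by (intro mult_strict_left_mono) auto
        moreover have "\<alpha> \<le> \<alpha> * \<alpha> + 1"
          using zero_le_power2[of "\<alpha> - 1/2"] by (simp add: power2_eq_square algebra_simps)
        ultimately show ?thesis by (simp add: algebra_simps)
      qed
      moreover have "1 < \<alpha> * t" if "\<alpha> \<le> (1 - \<alpha>) * t"
      proof -
        have "\<alpha> * \<alpha> \<le> \<alpha> * ((1 - \<alpha>) * t)" using that \<alpha> by (intro mult_left_mono) auto
        then have "(1 - \<alpha>) * 1 \<le> (1 - \<alpha>) * (\<alpha> * t)" using \<alpha>_bounds(3) by (simp add: algebra_simps)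
        then have "1 \<le> \<alpha> * t" using 1 by (subst (asm) mult_le_cancel_left_pos) auto
        then show ?thesis using nt by simp
      qed
      ultimately show ?thesis
        using \<alpha> 1 unfolding invariant_density shifted_def transfer_eq[OF True] by (auto simp: not_less not_le)
    next
      case 2
      then show ?thesis
        unfolding invariant_density shifted_def transfer_eq[OF True] by auto
    next
      case 3
      have "(1 - \<alpha>) * t \<le> 0" using 3 True by (auto intro!: mult_nonpos_nonneg)
      moreover have "(\<alpha> - 1) * t \<le> \<alpha>"
      proof -
        have "(\<alpha> - 1) * t \<le> (\<alpha> - 1) * (1 + \<alpha>)" using 3 ta by (intro mult_left_mono) auto
        then show ?thesis using \<alpha>_bounds(4) by (simp add: algebra_simps)
      qed
      moreover have "1 < \<alpha> * t" if "2 - \<alpha> < (\<alpha> - 1) * t"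
      proof -
        have "\<alpha> * (2 - \<alpha>) < \<alpha> * ((\<alpha> - 1) * t)" using that \<alpha> by (intro mult_strict_left_mono) auto
        then have "(\<alpha> - 1) * 1 < (\<alpha> - 1) * (\<alpha> * t)" using \<alpha>_bounds(4) by (simp add: algebra_simps)
        then show ?thesis using 3 by (subst (asm) mult_less_cancel_left_pos) auto
      qed
      ultimately show ?thesis
        using \<alpha> 3 unfolding invariant_density shifted_def transfer_eq[OF True] by (auto simp: not_less not_le)
    qed
  qed
  then show ?thesis by (simp only: t3 flip: t_def)
qed

lemma shifted_bounds:
  assumes "0 < t"
  shows "0 \<le> shifted t" "shifted t \<le> 1 / t"
proof -
  have a: "1 / (t + 1) \<le> 1 / (t + \<theta>)" "1 / (t + 2 - \<theta>) \<le> 1 / (t + 1)"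
    "1 / (t + \<theta>) \<le> 1 / t" "1 / (t + 1) \<le> 1 / t"
    using assms \<theta>_bounds by (simp_all add: frac_le)
  moreover have b: "0 \<le> 1 / (t + 1)" "0 \<le> 1 / (t + 2 - \<theta>)" "0 \<le> 1 / t"
    using assms \<theta>_bounds by simp_all
  ultimately have "0 \<le> 1 / (t + \<theta>) - 1 / (t + 1)" "0 \<le> 1 / (t + 1) - 1 / (t + 2 - \<theta>)"
    "1 / (t + \<theta>) - 1 / (t + 1) \<le> 1 / t" "1 / (t + 1) - 1 / (t + 2 - \<theta>) \<le> 1 / t"
    by linarith+
  with b(3) show "0 \<le> shifted t" "shifted t \<le> 1 / t"
    unfolding shifted_def by (auto simp only: split: if_split)
qed

lemma transfer_sums:
  assumes z: "\<alpha> - 2 < z" "z < \<alpha>" "z \<noteq> e1"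
  shows "(\<lambda>m. transfer (z + (2 * real m + 1))) sums invariant_density z"
proof -
  \<comment> \<open>For m > 0, \<open>Z m\<close> is what the digit 2 m - 1 passes on to the digit 2
    m + 1; \<open>Z 0\<close> is the whole density.\<close>
  define Z where "Z m = (if m = 0 then invariant_density z
    else 1 / (z + 2 * real m + 1 - \<theta>) + shifted (z + 2 * real m - 1))" for m :: nat
  have "transfer (z + (2 * real m + 1)) = Z m - Z (Suc m)" for m
  proof (cases "m = 0")
    case True
    then show ?thesis using transfer_first[OF z] by (simp add: Z_def algebra_simps)
  next
    case False
    then have "z + 3 \<le> z + (2 * real m + 1)" by (simp add: Suc_le_eq)
    from transfer_telescope[OF z(1) this] show ?thesis
      using False by (simp add: Z_def algebra_simps)
  qed
  moreover have "Z \<longlonglongrightarrow> 0"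
  proof (rule tendsto_sandwich[OF _ _ tendsto_const lim_const_over_n[of 4]])
    have b: "0 \<le> Z m \<and> Z m \<le> 4 / real m" if "4 \<le> m" for m
    proof -
      have m: "4 \<le> real m" using that by simp
      have le: "real m / 2 \<le> z + 2 * real m + 1 - \<theta>" "real m / 2 \<le> z + 2 * real m - 1"
        using m z \<alpha>_bounds \<theta>_bounds by auto
      with m have p: "0 < z + 2 * real m + 1 - \<theta>" "0 < z + 2 * real m - 1" by linarith+
      have f: "1 / (z + 2 * real m + 1 - \<theta>) \<le> 1 / (real m / 2)" "1 / (z + 2 * real m - 1) \<le> 1 / (real m / 2)"
        using le m by (intro frac_le; linarith)+
      have "0 \<le> 1 / (z + 2 * real m + 1 - \<theta>)" using p by simp
      moreover have "1 / (z + 2 * real m + 1 - \<theta>) + shifted (z + 2 * real m - 1)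
          \<le> 1 / (real m / 2) + 1 / (real m / 2)"
        by (rule add_mono[OF f(1) order_trans[OF shifted_bounds(2)[OF p(2)] f(2)]])
      moreover have "Z m = 1 / (z + 2 * real m + 1 - \<theta>) + shifted (z + 2 * real m - 1)"
        using that by (simp add: Z_def)
      ultimately show ?thesis
        using shifted_bounds(1)[OF p(2)] by simp
    qed
    show "\<forall>\<^sub>F m in sequentially. 0 \<le> Z m" "\<forall>\<^sub>F m in sequentially. Z m \<le> 4 / real m"
      by (rule eventually_mono[OF eventually_ge_at_top[of 4]]; use b in blast)+
  qed
  from telescope_sums'[OF this] have "(\<lambda>m. Z m - Z (Suc m)) sums (Z 0 - 0)" .
  ultimately show ?thesis by (simp add: Z_def)
qed

lemma measurable_transfer[measurable]: "transfer \<in> borel_measurable borel"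
  unfolding transfer_def[abs_def] by measurable

lemma measurable_\<phi>[measurable]: "\<phi>\<^sub>\<alpha> \<alpha> \<in> borel_measurable borel"
proof -
  have "\<phi>\<^sub>\<alpha> \<alpha> = (\<lambda>x. if x = 0 then 0
      else 1 / \<bar>x\<bar> - (2 * real_of_int \<lfloor>1 / (2 * \<bar>x\<bar>) + (1 - \<alpha>) / 2\<rfloor> + 1))"
    by (auto simp: fun_eq_iff \<phi>\<^sub>\<alpha>_def d\<^sub>\<alpha>_def)
  also have "\<dots> \<in> borel_measurable borel" by measurable
  finally show ?thesis .
qed

section \<open>Invariance of the measure\<close>

text \<open>Y removes the points with z + k \<le> 0, which have no preimage of digit k; there
  \<open>transfer\<close> takes its default value 0.\<close>

lemma nn_integral_H_branches:
  fixes k :: int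
  assumes [measurable]: "E \<in> sets borel" and E: "E \<subseteq> I\<^sub>\<alpha> \<alpha>"
  defines "Y \<equiv> E \<inter> {z. 0 < of_int k + z}"
  shows "(\<integral>\<^sup>+x. ennreal (invariant_density x) * indicator {x. 0 < of_int 1 * x \<and> 1 / \<bar>x\<bar> - of_int k \<in> Y} x
      + ennreal (invariant_density x) * indicator {x. 0 < of_int (-1) * x \<and> 1 / \<bar>x\<bar> - of_int k \<in> Y} x \<partial>lborel)
    = (\<integral>\<^sup>+z. ennreal (transfer (z + of_int k)) * indicator E z \<partial>lborel)"
proof -
  have [measurable]: "Y \<in> sets borel" unfolding Y_def by measurable
  have pos: "0 < of_int k + z" if "z \<in> Y" for z using that by (simp add: Y_def)
  have b: "(\<integral>\<^sup>+x. ennreal (invariant_density x) * indicator {x. 0 < of_int s * x \<and> 1 / \<bar>x\<bar> - of_int k \<in> Y} x \<partial>lborel)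
      = (\<integral>\<^sup>+z. ennreal (invariant_density (of_int s / (of_int k + z))) * ennreal (1 / (of_int k + z)\<^sup>2) * indicator Y z \<partial>lborel)"
    if "\<bar>s\<bar> = 1" for s :: int
    by (rule nn_integral_branch[OF _ _ that pos]) measurable
  have m1: "\<bar>- 1 :: int\<bar> = 1" by simp
  have "(\<integral>\<^sup>+x. ennreal (invariant_density x) * indicator {x. 0 < of_int 1 * x \<and> 1 / \<bar>x\<bar> - of_int k \<in> Y} x
      + ennreal (invariant_density x) * indicator {x. 0 < of_int (-1) * x \<and> 1 / \<bar>x\<bar> - of_int k \<in> Y} x \<partial>lborel)
    = (\<integral>\<^sup>+z. ennreal (invariant_density (of_int 1 / (of_int k + z))) * ennreal (1 / (of_int k + z)\<^sup>2) * indicator Y z \<partial>lborel)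
    + (\<integral>\<^sup>+z. ennreal (invariant_density (of_int (-1) / (of_int k + z))) * ennreal (1 / (of_int k + z)\<^sup>2) * indicator Y z \<partial>lborel)"
    unfolding b[OF abs_one, symmetric] b[OF m1, symmetric] by (rule nn_integral_add) measurable
  also have "\<dots> = (\<integral>\<^sup>+z. ennreal (invariant_density (of_int 1 / (of_int k + z))) * ennreal (1 / (of_int k + z)\<^sup>2) * indicator Y z
    + ennreal (invariant_density (of_int (-1) / (of_int k + z))) * ennreal (1 / (of_int k + z)\<^sup>2) * indicator Y z \<partial>lborel)"
    by (rule nn_integral_add[symmetric]) measurable
  also have "\<dots> = (\<integral>\<^sup>+z. ennreal (transfer (z + of_int k)) * indicator E z \<partial>lborel)"
  proof (rule nn_integral_cong)
    fix z :: real
    show "ennreal (invariant_density (of_int 1 / (of_int k + z))) * ennreal (1 / (of_int k + z)\<^sup>2) * indicator Y z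
      + ennreal (invariant_density (of_int (-1) / (of_int k + z))) * ennreal (1 / (of_int k + z)\<^sup>2) * indicator Y z
      = ennreal (transfer (z + of_int k)) * indicator E z"
    proof (cases "z \<in> Y")
      case True
      then have "0 < z + of_int k" "z \<in> E" by (auto simp: Y_def)
      then show ?thesis
        using True invariant_density_nonneg by (simp add: transfer_def add.commute add_divide_distrib flip: ennreal_mult ennreal_plus)
    next
      case False
      then have "z \<notin> E \<or> transfer (z + of_int k) = 0" by (auto simp: Y_def transfer_def add.commute)
      then show ?thesis using False by auto
    qed
  qed
  finally show ?thesis .
qed

text \<open>Sign and digit partition the nonzero points, so for each x at most one set
  \<open>A s m\<close> counts: s is the sign of x, and 2 m + 1 is its digit.\<close>

lemma invariant_density_preimage_eq_suminf:
  assumes E: "E \<subseteq> I\<^sub>\<alpha> \<alpha>" and x: "x \<noteq> 0"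
  defines "A \<equiv> \<lambda>(s::int) (m::nat). {x. 0 < of_int s * x \<and>
    1 / \<bar>x\<bar> - of_int (2 * int m + 1) \<in> E \<inter> {z. 0 < of_int (2 * int m + 1) + z}}"
  shows "ennreal (invariant_density x) * indicator (\<phi>\<^sub>\<alpha> \<alpha> -` E \<inter> I\<^sub>\<alpha> \<alpha>) x
    = (\<Sum>m. ennreal (invariant_density x) * indicator (A 1 m) x + ennreal (invariant_density x) * indicator (A (-1) m) x)"
proof (cases "x \<in> I\<^sub>\<alpha> \<alpha>")
  case False
  then have "invariant_density x = 0" using invariant_density_outside[of x] by (auto simp: I\<^sub>\<alpha>_def)
  then show ?thesis by simp
next
  case True
  define m0 where "m0 = nat ((d\<^sub>\<alpha> \<alpha> x - 1) div 2)"
  have d: "d\<^sub>\<alpha> \<alpha> x = 2 * int m0 + 1"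
    using d_pos[OF True x] d_odd[of x] by (auto simp: m0_def elim!: oddE)
  have inA: "x \<in> A s m \<longleftrightarrow> 0 < of_int s * x \<and> m = m0 \<and> \<phi>\<^sub>\<alpha> \<alpha> x \<in> E" for s m
  proof
    assume a: "x \<in> A s m"
    then have e: "1 / \<bar>x\<bar> - of_int (2 * int m + 1) \<in> E" and s: "0 < of_int s * x" by (auto simp: A_def)
    then have "1 / \<bar>x\<bar> - of_int (2 * int m + 1) \<in> I\<^sub>\<alpha> \<alpha>" using E by blast
    then have "d\<^sub>\<alpha> \<alpha> x = 2 * int m + 1" by (intro d_unique x) (auto simp: I\<^sub>\<alpha>_def)
    then show "0 < of_int s * x \<and> m = m0 \<and> \<phi>\<^sub>\<alpha> \<alpha> x \<in> E"
      using e s d \<phi>_eq[OF x] by simp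
  next
    assume "0 < of_int s * x \<and> m = m0 \<and> \<phi>\<^sub>\<alpha> \<alpha> x \<in> E"
    moreover have "0 < 1 / \<bar>x\<bar>" using x by simp
    ultimately show "x \<in> A s m" using d \<phi>_eq[OF x] by (auto simp: A_def)
  qed
  define c where "c = ennreal (invariant_density x) * indicator (\<phi>\<^sub>\<alpha> \<alpha> -` E \<inter> I\<^sub>\<alpha> \<alpha>) x"
  have "ennreal (invariant_density x) * indicator (A 1 m) x + ennreal (invariant_density x) * indicator (A (-1) m) x
      = (if m = m0 then c else 0)" for m
    using x True unfolding indicator_def inA by (cases "0 < x") (auto simp: c_def)
  then have "(\<lambda>m. ennreal (invariant_density x) * indicator (A 1 m) x + ennreal (invariant_density x) * indicator (A (-1) m) x) sums c"
    using sums_single[of m0 "\<lambda>_. c"] by simp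
  then show ?thesis unfolding c_def by (rule sums_unique)
qed

lemma invariant_density_invariant:
  assumes [measurable]: "E \<in> sets borel" and E: "E \<subseteq> I\<^sub>\<alpha> \<alpha>"
  shows "(\<integral>\<^sup>+x. ennreal (invariant_density x) * indicator (\<phi>\<^sub>\<alpha> \<alpha> -` E \<inter> I\<^sub>\<alpha> \<alpha>) x \<partial>lborel)
    = (\<integral>\<^sup>+x. ennreal (invariant_density x) * indicator E x \<partial>lborel)"
proof -
  let ?A = "\<lambda>(s::int) (m::nat). {x. 0 < of_int s * x \<and>
    1 / \<bar>x\<bar> - of_int (2 * int m + 1) \<in> E \<inter> {z. 0 < of_int (2 * int m + 1) + z}}"
  have "(\<integral>\<^sup>+x. ennreal (invariant_density x) * indicator (\<phi>\<^sub>\<alpha> \<alpha> -` E \<inter> I\<^sub>\<alpha> \<alpha>) x \<partial>lborel)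
      = (\<integral>\<^sup>+x. (\<Sum>m. ennreal (invariant_density x) * indicator (?A 1 m) x + ennreal (invariant_density x) * indicator (?A (-1) m) x) \<partial>lborel)"
    by (rule nn_integral_cong_AE[OF eventually_mono[OF AE_lborel_singleton[of 0]]])
      (rule invariant_density_preimage_eq_suminf[OF E])
  also have "\<dots> = (\<Sum>m. \<integral>\<^sup>+x. ennreal (invariant_density x) * indicator (?A 1 m) x + ennreal (invariant_density x) * indicator (?A (-1) m) x \<partial>lborel)"
    by (rule nn_integral_suminf) measurable
  also have "\<dots> = (\<Sum>m. \<integral>\<^sup>+z. ennreal (transfer (z + of_int (2 * int m + 1))) * indicator E z \<partial>lborel)"
    by (intro suminf_cong nn_integral_H_branches assms)
  also have "\<dots> = (\<integral>\<^sup>+z. (\<Sum>m. ennreal (transfer (z + of_int (2 * int m + 1))) * indicator E z) \<partial>lborel)"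
    by (rule nn_integral_suminf[symmetric]) measurable
  also have "\<dots> = (\<integral>\<^sup>+z. ennreal (invariant_density z) * indicator E z \<partial>lborel)"
  proof (rule nn_integral_cong_AE)
    have "AE z in lborel. z \<noteq> e1 \<and> z \<noteq> \<alpha> - 2" by (intro AE_conjI AE_lborel_singleton)
    then show "AE z in lborel. (\<Sum>m. ennreal (transfer (z + of_int (2 * int m + 1))) * indicator E z)
        = ennreal (invariant_density z) * indicator E z"
    proof eventually_elim
      case (elim z)
      show ?case
      proof (cases "z \<in> E")
        case True
        then have "\<alpha> - 2 < z" "z < \<alpha>" "z \<noteq> e1" using E elim by (auto simp: I\<^sub>\<alpha>_def less_le)
        from transfer_sums[OF this]
        have "(\<Sum>m. ennreal (transfer (z + (2 * real m + 1)))) = ennreal (invariant_density z)"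
          by (intro suminf_ennreal_eq transfer_nonneg)
        then show ?thesis using True by simp
      qed simp
    qed
  qed
  finally show ?thesis .
qed

lemma space_\<nu>: "space (\<nu>\<^sub>\<alpha> \<alpha>) = I\<^sub>\<alpha> \<alpha>"
  by (simp add: \<nu>\<^sub>\<alpha>_def space_restrict_space)

lemma sets_\<nu>: "sets (\<nu>\<^sub>\<alpha> \<alpha>) = sets (restrict_space borel (I\<^sub>\<alpha> \<alpha>))"
  by (simp add: \<nu>\<^sub>\<alpha>_def)

lemma sets_\<nu>_iff: "E \<in> sets (\<nu>\<^sub>\<alpha> \<alpha>) \<longleftrightarrow> E \<in> sets borel \<and> E \<subseteq> I\<^sub>\<alpha> \<alpha>"
  unfolding sets_\<nu> by (subst sets_restrict_space_iff) (auto simp: I\<^sub>\<alpha>_def)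

lemma \<phi>_maps_I: "x \<in> I\<^sub>\<alpha> \<alpha> \<Longrightarrow> \<phi>\<^sub>\<alpha> \<alpha> x \<in> I\<^sub>\<alpha> \<alpha>"
  using \<phi>\<^sub>\<alpha>_in_I\<^sub>\<alpha>[of x \<alpha>] \<alpha>_bounds by (cases "x = 0") (auto simp: \<phi>\<^sub>\<alpha>_def I\<^sub>\<alpha>_def)

lemma measurable_\<phi>_\<nu>: "\<phi>\<^sub>\<alpha> \<alpha> \<in> measurable (\<nu>\<^sub>\<alpha> \<alpha>) (\<nu>\<^sub>\<alpha> \<alpha>)"
proof -
  have "\<phi>\<^sub>\<alpha> \<alpha> \<in> measurable (restrict_space borel (I\<^sub>\<alpha> \<alpha>)) (restrict_space borel (I\<^sub>\<alpha> \<alpha>))"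
    using \<phi>_maps_I by (intro measurable_restrict_space2 measurable_restrict_space1) (auto simp: space_restrict_space)
  then show ?thesis by (simp add: measurable_cong_sets[OF sets_\<nu> sets_\<nu>])
qed

lemma ln_G_pos: "0 < ln golden_G"
  using golden_bounds by simp

theorem \<nu>_measure_preserving: "measure_preserving (\<nu>\<^sub>\<alpha> \<alpha>) (\<phi>\<^sub>\<alpha> \<alpha>)"
  unfolding measure_preserving_def
proof (intro conjI measurable_\<phi>_\<nu>)
  have I: "I\<^sub>\<alpha> \<alpha> \<in> sets (restrict_space borel (I\<^sub>\<alpha> \<alpha>))"
    using sets_\<nu>_iff[of "I\<^sub>\<alpha> \<alpha>"] by (simp add: sets_\<nu> I\<^sub>\<alpha>_def)
  show "prob_space (\<nu>\<^sub>\<alpha> \<alpha>)"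
  proof
    show "emeasure (\<nu>\<^sub>\<alpha> \<alpha>) (space (\<nu>\<^sub>\<alpha> \<alpha>)) = 1"
      unfolding space_\<nu> emeasure_\<nu>_density[OF I] \<nu>_total
      using ln_G_pos by (subst ennreal_mult[symmetric]) auto
  qed
  show "distr (\<nu>\<^sub>\<alpha> \<alpha>) (\<nu>\<^sub>\<alpha> \<alpha>) (\<phi>\<^sub>\<alpha> \<alpha>) = \<nu>\<^sub>\<alpha> \<alpha>"
  proof (rule measure_eqI)
    fix E assume "E \<in> sets (distr (\<nu>\<^sub>\<alpha> \<alpha>) (\<nu>\<^sub>\<alpha> \<alpha>) (\<phi>\<^sub>\<alpha> \<alpha>))"
    then have E: "E \<in> sets (\<nu>\<^sub>\<alpha> \<alpha>)" by simp
    then have pre: "\<phi>\<^sub>\<alpha> \<alpha> -` E \<inter> I\<^sub>\<alpha> \<alpha> \<in> sets (\<nu>\<^sub>\<alpha> \<alpha>)"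
      using measurable_sets[OF measurable_\<phi>_\<nu> E] by (simp add: space_\<nu>)
    have "emeasure (distr (\<nu>\<^sub>\<alpha> \<alpha>) (\<nu>\<^sub>\<alpha> \<alpha>) (\<phi>\<^sub>\<alpha> \<alpha>)) E = emeasure (\<nu>\<^sub>\<alpha> \<alpha>) (\<phi>\<^sub>\<alpha> \<alpha> -` E \<inter> I\<^sub>\<alpha> \<alpha>)"
      using emeasure_distr[OF measurable_\<phi>_\<nu> E] by (simp add: space_\<nu>)
    also have "\<dots> = emeasure (\<nu>\<^sub>\<alpha> \<alpha>) E"
    proof -
      have "E \<in> sets borel" "E \<subseteq> I\<^sub>\<alpha> \<alpha>" using E by (simp_all add: sets_\<nu>_iff)
      from invariant_density_invariant[OF this] show ?thesis
        unfolding emeasure_\<nu>_density[OF E[unfolded sets_\<nu>]] emeasure_\<nu>_density[OF pre[unfolded sets_\<nu>]]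
        by (rule arg_cong)
    qed
    finally show "emeasure (distr (\<nu>\<^sub>\<alpha> \<alpha>) (\<nu>\<^sub>\<alpha> \<alpha>) (\<phi>\<^sub>\<alpha> \<alpha>)) E = emeasure (\<nu>\<^sub>\<alpha> \<alpha>) E" .
  qed simp
qed

lemma \<nu>_le_lborel:
  assumes "E \<in> sets (\<nu>\<^sub>\<alpha> \<alpha>)"
  shows "emeasure (\<nu>\<^sub>\<alpha> \<alpha>) E \<le> ennreal (10 / (3 * ln golden_G)) * emeasure lborel E"
proof -
  have E: "E \<in> sets borel" using assms by (simp add: sets_\<nu>_iff)
  have "(\<integral>\<^sup>+x. ennreal (invariant_density x) * indicator E x \<partial>lborel) \<le> (\<integral>\<^sup>+x. ennreal 10 * indicator E x \<partial>lborel)"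
    using invariant_density_le by (intro nn_integral_mono mult_right_mono ennreal_leI) auto
  also have "\<dots> = ennreal 10 * emeasure lborel E" using E by (simp add: nn_integral_cmult)
  finally have le: "(\<integral>\<^sup>+x. ennreal (invariant_density x) * indicator E x \<partial>lborel) \<le> ennreal 10 * emeasure lborel E" .
  have c: "ennreal (1 / (3 * ln golden_G)) * ennreal 10 = ennreal (10 / (3 * ln golden_G))"
    using ln_G_pos by (subst ennreal_mult[symmetric]) auto
  have "emeasure (\<nu>\<^sub>\<alpha> \<alpha>) E
      = ennreal (1 / (3 * ln golden_G)) * (\<integral>\<^sup>+x. ennreal (invariant_density x) * indicator E x \<partial>lborel)"
    by (rule emeasure_\<nu>_density[OF assms[unfolded sets_\<nu>]])
  also have "\<dots> \<le> ennreal (1 / (3 * ln golden_G)) * (ennreal 10 * emeasure lborel E)"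
    by (rule mult_left_mono[OF le]) simp
  finally show ?thesis unfolding mult.assoc[symmetric] c .
qed

end

section \<open>Exactness\<close>

lemma emeasure_UN_comparison:
  fixes A B :: "'i \<Rightarrow> 'a set"
  assumes W: "countable W"
    and A: "\<And>w. w \<in> W \<Longrightarrow> A w \<in> sets M" "disjoint_family_on A W"
    and B: "\<And>w. w \<in> W \<Longrightarrow> B w \<in> sets M" "\<And>w. w \<in> W \<Longrightarrow> B w \<subseteq> A w"
    and le: "\<And>w. w \<in> W \<Longrightarrow> r * emeasure M (A w) \<le> emeasure M (B w)"
  shows "r * emeasure M (\<Union>w\<in>W. A w) \<le> emeasure M (\<Union>w\<in>W. B w)"
proof -
  have dB: "disjoint_family_on B W"
    using A(2) B(2) unfolding disjoint_family_on_def by blast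
  have "r * emeasure M (\<Union>w\<in>W. A w) = (\<integral>\<^sup>+w. r * emeasure M (A w) \<partial>count_space W)"
    using A W by (subst emeasure_UN_countable) (auto simp: nn_integral_cmult)
  also have "\<dots> \<le> (\<integral>\<^sup>+w. emeasure M (B w) \<partial>count_space W)"
    using le by (intro nn_integral_mono) auto
  also have "\<dots> = emeasure M (\<Union>w\<in>W. B w)"
    using B(1) dB W by (subst emeasure_UN_countable) auto
  finally show ?thesis .
qed

context odd_cf
begin

section \<open>Cylinders over short intervals\<close>

definition branches :: "nat \<Rightarrow> real set \<Rightarrow> (int \<times> int) list set" where
  "branches n K = {w. admissible w K \<and> length w = n}"

text \<open>The part of the n-th preimage of K that lies in cylinders reaching all of K.\<close>

definition covered :: "nat \<Rightarrow> real set \<Rightarrow> real set" where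
  "covered n K = (\<Union>w\<in>branches n K. inverse_branch w ` K)"

lemma countable_branches: "countable (branches n K)"
  by simp

lemma covered_disjoint: "disjoint_family_on (\<lambda>w. inverse_branch w ` K) (branches n K)"
  unfolding disjoint_family_on_def branches_def using cylinders_disjoint by blast

lemma covered_subset_Io: "covered n K \<subseteq> I\<^sub>o"
  unfolding covered_def branches_def using inverse_branch_in_Io by blast

lemma sets_covered: "K \<in> sets borel \<Longrightarrow> covered n K \<in> sets borel"
  unfolding covered_def using countable_branches
  by (intro sets.countable_UN'') (auto simp: branches_def intro: sets_inverse_branch_image)

text \<open>Prefixing the sign and digit of x to the branch through its image is the only candidate
  for a longer branch. It fails only if the image of K, which contains x, leaves the interval, and
  this image stays within 24 \<delta> (9/10)^n of x: 4 comes from the contraction, 6 from the last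
  division. The bound 1/16 keeps the denominators above 1/3.\<close>

lemma covered_step:
  assumes K: "\<And>z z'. z \<in> K \<Longrightarrow> z' \<in> K \<Longrightarrow> \<bar>z - z'\<bar> \<le> \<delta>" and \<delta>: "\<delta> \<le> 1/16"
    and x: "x \<in> I\<^sub>o" "x \<noteq> 0" and \<phi>x: "\<phi>\<^sub>\<alpha> \<alpha> x \<in> covered n K" and nx: "x \<notin> covered (Suc n) K"
  shows "x \<le> \<alpha> - 2 + 24 * \<delta> * (9/10) ^ n \<or> \<alpha> - 24 * \<delta> * (9/10) ^ n \<le> x"
proof -
  obtain w z0 where w: "admissible w K" "length w = n" and z0: "z0 \<in> K" "\<phi>\<^sub>\<alpha> \<alpha> x = inverse_branch w z0"
    using \<phi>x unfolding covered_def branches_def by blast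
  define s :: int where "s = (if 0 < x then 1 else -1)"
  define k where "k = d\<^sub>\<alpha> \<alpha> x"
  have xI: "x \<in> I\<^sub>\<alpha> \<alpha>" using x by (auto simp: I\<^sub>\<alpha>_def)
  have k: "odd k" "1 \<le> k" unfolding k_def using d_odd d_pos[OF xI x(2)] by auto
  have s: "\<bar>s\<bar> = 1" "\<bar>real_of_int s\<bar> = 1" by (auto simp: s_def)
  have y0: "of_int k + inverse_branch w z0 = 1 / \<bar>x\<bar>"
    using \<phi>_eq[OF x(2)] z0 by (simp add: k_def)
  have "\<bar>x\<bar> \<le> 81/50" using x \<alpha>_bounds by (auto simp: abs_if)
  then have y0': "50/81 \<le> of_int k + inverse_branch w z0"
    unfolding y0 using x(2) by (simp add: field_simps)
  have x_eq: "x = inverse_branch ((s, k) # w) z0"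
    by (simp add: y0 s_def)
  have "0 \<le> \<delta>" using K[OF z0(1) z0(1)] by simp
  have close: "1/3 \<le> of_int k + inverse_branch w z
      \<and> \<bar>inverse_branch ((s, k) # w) z - x\<bar> \<le> 24 * \<delta> * (9/10) ^ n" if z: "z \<in> K" for z
  proof -
    let ?y = "of_int k + inverse_branch w z" and ?u = "of_int k + inverse_branch w z0"
    have "\<bar>inverse_branch w z - inverse_branch w z0\<bar> \<le> \<bar>z - z0\<bar> * (4 * (9/10) ^ n)"
      using inverse_branch_diff_le[OF w(1) z z0(1)] w(2) by simp
    also have "\<dots> \<le> \<delta> * (4 * (9/10) ^ n)"
      using K[OF z z0(1)] by (intro mult_right_mono) auto
    finally have d: "\<bar>?y - ?u\<bar> \<le> \<delta> * (4 * (9/10) ^ n)" by simp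
    have "\<delta> * (4 * (9/10) ^ n) \<le> 1/16 * (4 * 1)"
      using \<delta> by (intro mult_mono) (auto intro: power_le_one)
    with d have "?u - ?y \<le> 1/4" by linarith
    then have y: "1/3 \<le> ?y" using y0' by linarith
    have "inverse_branch ((s, k) # w) z - x = of_int s * (?u - ?y) * (1 / (?y * ?u))"
    proof -
      have "c / a - c / b = c * (b - a) * (1 / (a * b))" if "a \<noteq> 0" "b \<noteq> 0" for a b c :: real
        using that by (simp add: field_simps)
      moreover have "?y \<noteq> 0" "?u \<noteq> 0" using y y0' by linarith+
      ultimately have "of_int s / ?y - of_int s / ?u = of_int s * (?u - ?y) * (1 / (?y * ?u))" .
      then show ?thesis unfolding x_eq inverse_branch.simps .
    qed
    then have "\<bar>inverse_branch ((s, k) # w) z - x\<bar> = \<bar>?y - ?u\<bar> * (1 / (?y * ?u))"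
      using y y0' s by (simp add: abs_mult abs_minus_commute)
    also have "\<dots> \<le> (\<delta> * (4 * (9/10) ^ n)) * 6"
    proof (rule mult_mono[OF d])
      have "1/6 \<le> ?y * ?u" using y y0' mult_mono[of "1/3" ?y "1/2" ?u] by auto
      then show "1 / (?y * ?u) \<le> 6" by (simp add: field_simps)
    qed (use \<open>0 \<le> \<delta>\<close> y y0' in auto)
    finally show ?thesis using y by (simp add: algebra_simps)
  qed
  have "\<not> admissible ((s, k) # w) K"
  proof
    assume "admissible ((s, k) # w) K"
    then have "(s, k) # w \<in> branches (Suc n) K" using w(2) by (simp add: branches_def del: admissible.simps)
    then show False using nx z0(1) x_eq unfolding covered_def by blast
  qed
  then obtain z where z: "z \<in> K" "inverse_branch ((s, k) # w) z \<notin> I\<^sub>o"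
    using w k s close by force
  with close[OF z(1)] show ?thesis by auto
qed

lemma prob_\<nu>: "prob_space (\<nu>\<^sub>\<alpha> \<alpha>)"
  using \<nu>_measure_preserving by (simp add: measure_preserving_def)

lemma measure_\<nu>_preimage:
  assumes "E \<in> sets (\<nu>\<^sub>\<alpha> \<alpha>)"
  shows "measure (\<nu>\<^sub>\<alpha> \<alpha>) ((\<phi>\<^sub>\<alpha> \<alpha> ^^ n) -` E \<inter> I\<^sub>\<alpha> \<alpha>) = measure (\<nu>\<^sub>\<alpha> \<alpha>) E"
    "(\<phi>\<^sub>\<alpha> \<alpha> ^^ n) -` E \<inter> I\<^sub>\<alpha> \<alpha> \<in> sets (\<nu>\<^sub>\<alpha> \<alpha>)"
proof -
  let ?N = "\<nu>\<^sub>\<alpha> \<alpha>" and ?T = "\<phi>\<^sub>\<alpha> \<alpha>"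
  note Tn = measure_preserving_funpow[OF \<nu>_measure_preserving, of n]
  then have m: "?T ^^ n \<in> measurable ?N ?N" by simp
  show "(?T ^^ n) -` E \<inter> I\<^sub>\<alpha> \<alpha> \<in> sets ?N"
    using measurable_sets[OF m assms] by (simp add: space_\<nu>)
  show "measure ?N ((?T ^^ n) -` E \<inter> I\<^sub>\<alpha> \<alpha>) = measure ?N E"
    using measure_distr[OF m assms] Tn by (simp add: space_\<nu>)
qed

definition density_bound :: real where "density_bound = 10 / (3 * ln golden_G)"

lemma density_bound_pos: "0 < density_bound"
  using ln_G_pos by (simp add: density_bound_def)

lemma measure_\<nu>_le:
  assumes "E \<in> sets (\<nu>\<^sub>\<alpha> \<alpha>)"
  shows "measure (\<nu>\<^sub>\<alpha> \<alpha>) E \<le> density_bound * measure lborel E"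
proof -
  interpret prob_space "\<nu>\<^sub>\<alpha> \<alpha>" by (rule prob_\<nu>)
  have "E \<subseteq> {\<alpha> - 2..\<alpha>}" using assms by (auto simp: sets_\<nu>_iff I\<^sub>\<alpha>_def)
  then have "emeasure lborel E \<le> emeasure lborel {\<alpha> - 2..\<alpha>}" by (intro emeasure_mono) auto
  then have "emeasure lborel E = ennreal (measure lborel E)"
    by (intro emeasure_eq_ennreal_measure) (auto simp: top_unique)
  then have "ennreal (measure (\<nu>\<^sub>\<alpha> \<alpha>) E) \<le> ennreal (density_bound * measure lborel E)"
    using \<nu>_le_lborel[OF assms] density_bound_pos
    by (simp add: emeasure_eq_measure density_bound_def[symmetric] ennreal_mult)
  then show ?thesis using density_bound_pos by (subst (asm) ennreal_le_iff) auto
qed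

lemma measure_\<nu>_lborel_null:
  assumes "E \<in> sets (\<nu>\<^sub>\<alpha> \<alpha>)" "emeasure lborel E = 0"
  shows "measure (\<nu>\<^sub>\<alpha> \<alpha>) E = 0"
proof -
  have "measure lborel E = 0" using assms(2) by (simp add: measure_def)
  then show ?thesis using measure_\<nu>_le[OF assms(1)] by (intro antisym) auto
qed

definition cell :: "nat \<Rightarrow> nat \<Rightarrow> real set" where
  "cell J j = {\<alpha> - 2 + 2 * real j / real J <..< \<alpha> - 2 + 2 * real (Suc j) / real J}"

lemma cell_subset: "j < J \<Longrightarrow> cell J j \<subseteq> I\<^sub>o"
proof -
  assume j: "j < J"
  have "2 * real (Suc j) / real J \<le> 2" "0 \<le> 2 * real j / real J" using j by (auto simp: field_simps)
  then show ?thesis unfolding cell_def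
    by (intro subsetI) (simp only: greaterThanLessThan_iff, linarith)
qed

lemma cells_cover:
  assumes J: "0 < J"
  shows "I\<^sub>\<alpha> \<alpha> - (\<Union>j<J. cell J j) \<subseteq> (\<lambda>j. \<alpha> - 2 + 2 * real j / real J) ` {..J}"
proof
  fix x assume x: "x \<in> I\<^sub>\<alpha> \<alpha> - (\<Union>j<J. cell J j)"
  define u where "u = (x - (\<alpha> - 2)) * real J / 2"
  have "0 \<le> x - (\<alpha> - 2)" "x - (\<alpha> - 2) < 2" using x by (auto simp: I\<^sub>\<alpha>_def)
  then have u: "0 \<le> u" "u < real J" using J by (auto simp: u_def)
  define j where "j = nat \<lfloor>u\<rfloor>"
  have "real j = of_int \<lfloor>u\<rfloor>" using u(1) by (simp add: j_def)
  then have j: "real j \<le> u" "u < real (Suc j)" by linarith+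
  have jJ: "j < J" using j u by linarith
  have x_eq: "x = \<alpha> - 2 + 2 * u / real J" using J by (simp add: u_def)
  show "x \<in> (\<lambda>j. \<alpha> - 2 + 2 * real j / real J) ` {..J}"
  proof (cases "u = real j")
    case True
    then show ?thesis using jJ x_eq by auto
  next
    case False
    then have "2 * real j / real J < 2 * u / real J" "2 * u / real J < 2 * real (Suc j) / real J"
      using j J by (auto intro!: divide_strict_right_mono)
    then have "x \<in> cell J j" unfolding cell_def x_eq by auto
    then show ?thesis using x jJ by blast
  qed
qed

lemma sets_cell[measurable]: "cell J j \<in> sets borel"
  unfolding cell_def by simp

text \<open>
  Passing from \<open>n\<close> to \<open>n + 1\<close> loses only points whose position at the new step is within
  \<open>O (\<delta> (9/10)\<^sup>n)\<close> of an end point. By invariance the total loss is \<open>O (\<delta>)\<close>, uniformly in \<open>n\<close>.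
\<close>

lemma covered_by_cells_ge:
  assumes J: "32 \<le> J"
  shows "measure (\<nu>\<^sub>\<alpha> \<alpha>) (\<Union>j<J. covered n (cell J j))
    \<ge> 1 - 96 * density_bound / real J * (\<Sum>m<n. (9/10) ^ m)"
proof (induction n)
  case 0
  interpret prob_space "\<nu>\<^sub>\<alpha> \<alpha>" by (rule prob_\<nu>)
  have c0: "covered 0 (cell J j) = cell J j" if "j < J" for j
    using cell_subset[OF that] by (auto simp: covered_def branches_def)
  have V: "(\<Union>j<J. cell J j) \<in> sets (\<nu>\<^sub>\<alpha> \<alpha>)"
    unfolding sets_\<nu>_iff using cell_subset by (fastforce simp: I\<^sub>\<alpha>_def)
  let ?F = "(\<lambda>j. \<alpha> - 2 + 2 * real j / real J) ` {..J}"
  have "emeasure lborel (I\<^sub>\<alpha> \<alpha> - (\<Union>j<J. cell J j)) \<le> emeasure lborel ?F"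
    using cells_cover[of J] J by (intro emeasure_mono) (auto intro: borel_closed finite_imp_closed)
  also have "\<dots> = 0" by (rule emeasure_lborel_countable) (simp add: countable_finite)
  finally have "measure (\<nu>\<^sub>\<alpha> \<alpha>) (I\<^sub>\<alpha> \<alpha> - (\<Union>j<J. cell J j)) = 0"
    using V sets.compl_sets[OF V] by (intro measure_\<nu>_lborel_null) (auto simp: space_\<nu>)
  then have "measure (\<nu>\<^sub>\<alpha> \<alpha>) (\<Union>j<J. cell J j) = 1"
    using prob_compl[OF V] by (simp add: space_\<nu>)
  then show ?case using c0 by simp
next
  case (Suc n)
  interpret prob_space "\<nu>\<^sub>\<alpha> \<alpha>" by (rule prob_\<nu>)
  let ?V = "\<lambda>n. \<Union>j<J. covered n (cell J j)"
  define \<delta> where "\<delta> = 2 / real J"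
  define c where "c = 24 * \<delta> * (9/10) ^ n"
  have J0: "0 < real J" using J by simp
  have \<delta>: "\<delta> \<le> 1/16" "0 < \<delta>" using J by (auto simp: \<delta>_def field_simps)
  have c0: "0 \<le> c" using \<delta> by (simp add: c_def)
  have V: "?V n \<in> sets (\<nu>\<^sub>\<alpha> \<alpha>)" for n
    unfolding sets_\<nu>_iff using covered_subset_Io by (fastforce simp: I\<^sub>\<alpha>_def intro: sets_covered)
  \<comment> \<open>The two end zones, where \<open>covered_step\<close> admits a loss, and 0, where
    it does not apply.\<close>
  let ?E = "I\<^sub>\<alpha> \<alpha> \<inter> ({\<alpha> - 2..\<alpha> - 2 + c} \<union> {\<alpha> - c..\<alpha>} \<union> {0})"
  have E: "?E \<in> sets (\<nu>\<^sub>\<alpha> \<alpha>)" unfolding sets_\<nu>_iff by (auto simp: I\<^sub>\<alpha>_def)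
  have cell_diam: "\<bar>z - z'\<bar> \<le> \<delta>" if "z \<in> cell J j" "z' \<in> cell J j" for z z' j
  proof -
    have "2 * real (Suc j) / real J = 2 * real j / real J + \<delta>" using J0 by (simp add: \<delta>_def field_simps)
    then show ?thesis using that unfolding cell_def by (auto simp: abs_le_iff)
  qed
  have sub: "\<phi>\<^sub>\<alpha> \<alpha> -` ?V n \<inter> I\<^sub>\<alpha> \<alpha> \<subseteq> ?V (Suc n) \<union> ?E"
  proof
    fix x assume x: "x \<in> \<phi>\<^sub>\<alpha> \<alpha> -` ?V n \<inter> I\<^sub>\<alpha> \<alpha>"
    then obtain j where j: "j < J" "\<phi>\<^sub>\<alpha> \<alpha> x \<in> covered n (cell J j)" by auto
    show "x \<in> ?V (Suc n) \<union> ?E"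
    proof (cases "x = 0 \<or> x = \<alpha> - 2 \<or> x \<in> covered (Suc n) (cell J j)")
      case True
      then show ?thesis using x j c0 by auto
    next
      case False
      then have "x \<in> I\<^sub>o" using x by (auto simp: I\<^sub>\<alpha>_def)
      then have "x \<le> \<alpha> - 2 + c \<or> \<alpha> - c \<le> x"
        unfolding c_def using False j cell_diam \<delta> by (intro covered_step[of "cell J j"]) auto
      then show ?thesis using x by (auto simp: I\<^sub>\<alpha>_def)
    qed
  qed
  have "measure (\<nu>\<^sub>\<alpha> \<alpha>) (?V n) = measure (\<nu>\<^sub>\<alpha> \<alpha>) (\<phi>\<^sub>\<alpha> \<alpha> -` ?V n \<inter> I\<^sub>\<alpha> \<alpha>)"
    using measure_\<nu>_preimage(1)[OF V, of 1] by simp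
  also have "\<dots> \<le> measure (\<nu>\<^sub>\<alpha> \<alpha>) (?V (Suc n) \<union> ?E)"
    using sub V E by (intro finite_measure_mono) auto
  also have "\<dots> \<le> measure (\<nu>\<^sub>\<alpha> \<alpha>) (?V (Suc n)) + measure (\<nu>\<^sub>\<alpha> \<alpha>) ?E"
    by (rule measure_Un_le[OF V E])
  also have "measure (\<nu>\<^sub>\<alpha> \<alpha>) ?E \<le> density_bound * (2 * c)"
  proof -
    have "emeasure lborel ?E \<le> emeasure lborel ({\<alpha> - 2..\<alpha> - 2 + c} \<union> {\<alpha> - c..\<alpha>} \<union> {0})"
      by (intro emeasure_mono) auto
    also have "\<dots> \<le> emeasure lborel {\<alpha> - 2..\<alpha> - 2 + c} + emeasure lborel {\<alpha> - c..\<alpha>} + emeasure lborel {0 :: real}"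
      by (intro order_trans[OF emeasure_subadditive] add_mono emeasure_subadditive order_refl) auto
    also have "\<dots> = ennreal (2 * c)" using c0 by (simp flip: ennreal_plus)
    finally have "measure lborel ?E \<le> 2 * c"
      unfolding measure_def using c0 by (intro enn2real_leI) auto
    then show ?thesis
      using measure_\<nu>_le[OF E] density_bound_pos by (meson mult_left_mono order_trans less_imp_le)
  qed
  finally have "measure (\<nu>\<^sub>\<alpha> \<alpha>) (?V n) \<le> measure (\<nu>\<^sub>\<alpha> \<alpha>) (?V (Suc n)) + density_bound * (2 * c)" by simp
  \<comment> \<open>96 = 2 * 24 * 2: two ends, the constant of \<open>covered_step\<close>, and the
    cell length 2/J.\<close>
  moreover have "density_bound * (2 * c) = 96 * density_bound / real J * (9/10) ^ n"
    by (simp add: c_def \<delta>_def)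
  moreover have "(\<Sum>m<Suc n. (9/10::real) ^ m) = (\<Sum>m<n. (9/10) ^ m) + (9/10) ^ n" by simp
  ultimately show ?case using Suc by (simp only: distrib_left)
qed

section \<open>Cylinders over the whole interval\<close>

lemma inverse_branch_image_pos:
  assumes v: "admissible v K" and K: "K \<in> sets borel" "emeasure lborel K \<noteq> 0"
  shows "emeasure lborel (inverse_branch v ` K) \<noteq> 0"
proof
  assume z: "emeasure lborel (inverse_branch v ` K) = 0"
  note [measurable] = K(1)
  have "emeasure lborel (inverse_branch v ` K)
      = (\<integral>\<^sup>+z. ennreal ((branch_root_deriv v z)\<^sup>2) * indicator K z \<partial>lborel)"
    using nn_integral_inverse_branch_image[OF v order_refl K(1), of "\<lambda>_. 1"]
      sets_inverse_branch_image[OF v order_refl K(1)] by simp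
  then have "AE z in lborel. ennreal ((branch_root_deriv v z)\<^sup>2) * indicator K z = 0"
    using z by (subst (asm) eq_commute) (simp add: nn_integral_0_iff_AE)
  then have "AE z in lborel. z \<notin> K"
  proof eventually_elim
    case (elim z)
    then show ?case using branch_root_deriv_pos[OF v, of z] by (auto simp: indicator_def split: if_splits)
  qed
  then have "emeasure lborel K = 0"
    by (subst (asm) AE_iff_measurable[OF _ refl]) (use K in auto)
  then show False using K(2) by simp
qed

lemma emeasure_eq_measure_Io: "E \<subseteq> I\<^sub>o \<Longrightarrow> emeasure lborel E = ennreal (measure lborel E)"
  using Io_finite_measure[of E] by (intro emeasure_eq_ennreal_measure) auto

text \<open>For each n some cell keeps a fixed share of the mass. A full branch into that cell,
  appended to all branches over it, fills a fixed fraction of their cylinders by bounded distortion.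
  The length of the appended word depends on the cell, so the order reached is some N \<ge>
  n.\<close>

lemma full_branches_cover:
  obtains c where "0 < c" "\<And>n. \<exists>N\<ge>n. c \<le> measure lborel (covered N I\<^sub>o)"
proof -
  \<comment> \<open>The total loss is at most 96 * 10 * \<open>density_bound\<close> / J, which this
    J makes at most 1/2.\<close>
  define J where "J = max 32 (nat \<lceil>1920 * density_bound\<rceil>)"
  have J: "32 \<le> J" "1920 * density_bound \<le> real J"
    unfolding J_def by (auto simp: le_nat_iff) linarith
  have J0: "0 < real J" using J by simp
  have "\<exists>v. admissible v I\<^sub>o \<and> inverse_branch v ` I\<^sub>o \<subseteq> cell J j" if "j < J" for j
  proof -
    have "2 * real j / real J < 2 * real (Suc j) / real J" using J0 by (simp add: divide_strict_right_mono)
    then show ?thesis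
      using full_branch_in_interval[of "\<alpha> - 2 + 2 * real j / real J" "\<alpha> - 2 + 2 * real (Suc j) / real J"]
        cell_subset[OF that] unfolding cell_def by (metis add_strict_left_mono)
  qed
  then obtain v where v: "\<And>j. j < J \<Longrightarrow> admissible (v j) I\<^sub>o"
    "\<And>j. j < J \<Longrightarrow> inverse_branch (v j) ` I\<^sub>o \<subseteq> cell J j"
    by metis
  define Q where "Q j = inverse_branch (v j) ` I\<^sub>o" for j
  have Q: "Q j \<in> sets borel" "Q j \<subseteq> cell J j" "Q j \<subseteq> I\<^sub>o" if "j < J" for j
    using v[OF that] cell_subset[OF that] sets_inverse_branch_image[OF v(1)[OF that] order_refl]
    by (auto simp: Q_def)
  have Qpos: "0 < measure lborel (Q j)" if "j < J" for j
  proof -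
    have "emeasure lborel (Q j) \<noteq> 0"
      unfolding Q_def by (rule inverse_branch_image_pos[OF v(1)[OF that]]) (auto simp: ennreal_eq_0_iff)
    then have "measure lborel (Q j) \<noteq> 0"
      using emeasure_eq_measure_Io[OF Q(3)[OF that]] by auto
    then show ?thesis by (simp add: zero_less_measure_iff)
  qed
  \<comment> \<open>Half of the mass shared among J cells, converted to Lebesgue measure.\<close>
  define c0 where "c0 = 1 / (2 * real J * density_bound)"
  have c0: "0 < c0" using J0 density_bound_pos by (simp add: c0_def)
  \<comment> \<open>The fraction of a cylinder that the appended branch fills: exp 640 from the
    comparison of images, 2 as a bound for the length of a cell.\<close>
  define r where "r j = measure lborel (Q j) / (exp 640 * 2)" for j
  define c where "c = Min ((\<lambda>j. r j * c0) ` {..<J})"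
  have cpos: "0 < c"
    unfolding c_def using J Qpos c0 by (subst Min_gr_iff) (auto simp: r_def lessThan_empty_iff)
  have "\<exists>N\<ge>n. c \<le> measure lborel (covered N I\<^sub>o)" for n
  proof -
    interpret prob_space "\<nu>\<^sub>\<alpha> \<alpha>" by (rule prob_\<nu>)
    have cov: "covered n (cell J j) \<in> sets (\<nu>\<^sub>\<alpha> \<alpha>)" for j
      unfolding sets_\<nu>_iff using covered_subset_Io by (fastforce simp: I\<^sub>\<alpha>_def intro: sets_covered)
    have "96 * density_bound / real J * (\<Sum>m<n. (9/10) ^ m) \<le> 96 * density_bound / real J * 10"
      using sum_geometric_le[of n] density_bound_pos by (intro mult_left_mono) auto
    also have "\<dots> \<le> 1/2" using J J0 by (simp add: field_simps)
    finally have "1/2 \<le> measure (\<nu>\<^sub>\<alpha> \<alpha>) (\<Union>j<J. covered n (cell J j))"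
      using covered_by_cells_ge[OF J(1), of n] by linarith
    also have "\<dots> \<le> (\<Sum>j<J. measure (\<nu>\<^sub>\<alpha> \<alpha>) (covered n (cell J j)))"
      using cov by (intro finite_measure_subadditive_finite) auto
    also have "\<dots> \<le> (\<Sum>j<J. density_bound * measure lborel (covered n (cell J j)))"
      by (intro sum_mono measure_\<nu>_le cov)
    finally have half: "1/2 \<le> (\<Sum>j<J. density_bound * measure lborel (covered n (cell J j)))" .
    have "\<exists>j<J. c0 \<le> measure lborel (covered n (cell J j))"
    proof (rule ccontr)
      assume "\<not> ?thesis"
      then have "(\<Sum>j<J. density_bound * measure lborel (covered n (cell J j))) < (\<Sum>j<J. density_bound * c0)"
        using density_bound_pos J by (intro sum_strict_mono) (auto simp: lessThan_empty_iff)
      also have "\<dots> = 1/2" using J0 density_bound_pos by (simp add: c0_def)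
      finally show False using half by simp
    qed
    then obtain j where j: "j < J" and cj: "c0 \<le> measure lborel (covered n (cell J j))" by blast
    let ?K = "cell J j"
    define N where "N = n + length (v j)"
    have "ennreal (measure lborel ?K) \<le> ennreal 2"
      using emeasure_mono[OF cell_subset[OF j], of lborel] emeasure_eq_measure_Io[OF cell_subset[OF j]] by simp
    then have "measure lborel ?K \<le> 2" by (subst (asm) ennreal_le_iff) auto
    have br: "ennreal (r j) * emeasure lborel (inverse_branch w ` ?K) \<le> emeasure lborel (inverse_branch w ` Q j)"
      if w: "w \<in> branches n ?K" for w
    proof -
      have w: "admissible w ?K" using w by (simp add: branches_def)
      have "measure lborel (Q j) * measure lborel (inverse_branch w ` ?K)
          \<le> exp 640 * (measure lborel (inverse_branch w ` Q j) * measure lborel ?K)"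
        by (rule inverse_branch_image_comparison[OF w Q(2,1)[OF j] order_refl]) simp
      also have "\<dots> \<le> exp 640 * (measure lborel (inverse_branch w ` Q j) * 2)"
        using \<open>measure lborel ?K \<le> 2\<close> by (intro mult_left_mono) auto
      finally have "r j * measure lborel (inverse_branch w ` ?K) \<le> measure lborel (inverse_branch w ` Q j)"
        by (simp add: r_def field_simps)
      moreover have "inverse_branch w ` ?K \<subseteq> I\<^sub>o" "inverse_branch w ` Q j \<subseteq> I\<^sub>o"
        using inverse_branch_in_Io[OF w] Q[OF j] by blast+
      ultimately show ?thesis
        by (simp add: emeasure_eq_measure_Io r_def flip: ennreal_mult)
    qed
    have "ennreal (r j) * emeasure lborel (covered n ?K) \<le> emeasure lborel (\<Union>w\<in>branches n ?K. inverse_branch w ` Q j)"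
      unfolding covered_def
    proof (rule emeasure_UN_comparison[OF countable_branches _ covered_disjoint _ _ br])
      fix w assume "w \<in> branches n ?K"
      then have w: "admissible w ?K" by (simp add: branches_def)
      show "inverse_branch w ` ?K \<in> sets lborel" "inverse_branch w ` Q j \<in> sets lborel"
        using sets_inverse_branch_image[OF w order_refl] sets_inverse_branch_image[OF w Q(2,1)[OF j]] by auto
      show "inverse_branch w ` Q j \<subseteq> inverse_branch w ` ?K" using Q[OF j] by blast
    qed auto
    also have "\<dots> \<le> emeasure lborel (covered N I\<^sub>o)"
    proof (rule emeasure_mono)
      show "(\<Union>w\<in>branches n ?K. inverse_branch w ` Q j) \<subseteq> covered N I\<^sub>o"
      proof
        fix x assume "x \<in> (\<Union>w\<in>branches n ?K. inverse_branch w ` Q j)"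
        then obtain w z where w: "admissible w ?K" "length w = n" and z: "z \<in> I\<^sub>o"
          and x: "x = inverse_branch w (inverse_branch (v j) z)"
          by (auto simp: branches_def Q_def)
        have "w @ v j \<in> branches N I\<^sub>o"
          using admissible_append[OF w(1) v(1)[OF j] v(2)[OF j]] w by (simp add: branches_def N_def)
        moreover have "x = inverse_branch (w @ v j) z" using x by (simp add: inverse_branch_append)
        ultimately show "x \<in> covered N I\<^sub>o" using z unfolding covered_def by blast
      qed
    qed (use sets_covered[of I\<^sub>o N] in simp)
    finally have "r j * measure lborel (covered n ?K) \<le> measure lborel (covered N I\<^sub>o)"
      using covered_subset_Io[of n ?K] covered_subset_Io[of N I\<^sub>o]
      by (simp add: emeasure_eq_measure_Io r_def flip: ennreal_mult)
    moreover have "r j * c0 \<le> r j * measure lborel (covered n ?K)"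
      using cj by (intro mult_left_mono) (auto simp: r_def)
    moreover have "c \<le> r j * c0" unfolding c_def using j by (intro Min_le) auto
    ultimately show ?thesis by (intro exI[of _ N]) (auto simp: N_def)
  qed
  with cpos show ?thesis by (rule that)
qed

section \<open>Triviality of the tail\<close>

lemma compact_inner_approximation:
  assumes "A \<in> sets borel" "A \<subseteq> I\<^sub>\<alpha> \<alpha>" "0 < e"
  obtains T where "compact T" "T \<subseteq> A" "emeasure lborel (A - T) < ennreal e"
proof -
  have "A \<in> sets lebesgue" using assms by simp
  from sets_lebesgue_inner_closed[OF this assms(3)] obtain T where
    T: "closed T" "T \<subseteq> A" "emeasure lebesgue (A - T) < ennreal e" by metis
  have "bounded A" by (rule bounded_subset[OF bounded_closed_interval[of "\<alpha> - 2" \<alpha>]])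
    (use assms in \<open>auto simp: I\<^sub>\<alpha>_def\<close>)
  then have "compact T" using T by (meson bounded_subset compact_eq_bounded_closed)
  moreover have "A - T \<in> sets lborel" using assms T by auto
  then have "emeasure lborel (A - T) < ennreal e" using T by simp
  ultimately show ?thesis using T that by blast
qed

theorem \<nu>_exact: "exact_transformation (\<nu>\<^sub>\<alpha> \<alpha>) (\<phi>\<^sub>\<alpha> \<alpha>)"
  unfolding exact_transformation_def
proof (rule ballI, rule ccontr)
  interpret prob_space "\<nu>\<^sub>\<alpha> \<alpha>" by (rule prob_\<nu>)
  let ?N = "\<nu>\<^sub>\<alpha> \<alpha>" and ?T = "\<phi>\<^sub>\<alpha> \<alpha>" and ?I = "I\<^sub>\<alpha> \<alpha>"
  fix A assume tail: "A \<in> tail_sigma_algebra ?N ?T"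
    and "\<not> (emeasure ?N A = 0 \<or> emeasure ?N (space ?N - A) = 0)"
  then have pos: "0 < measure ?N A" "0 < measure ?N (?I - A)"
    by (auto simp: emeasure_eq_measure space_\<nu> zero_less_measure_iff)
  have "\<exists>B. B \<in> sets ?N \<and> A = (?T ^^ n) -` B \<inter> ?I" for n
    using tail unfolding tail_sigma_algebra_def space_\<nu> by blast
  then obtain B where B: "\<And>n. B n \<in> sets ?N" "\<And>n. A = (?T ^^ n) -` B n \<inter> ?I" by metis
  have A: "A \<in> sets ?N" using measure_\<nu>_preimage(2)[OF B(1)] B(2) by metis
  have Ab: "A \<in> sets borel" "A \<subseteq> ?I" "?I - A \<in> sets borel"
    using A sets.compl_sets[OF A] by (auto simp: sets_\<nu>_iff space_\<nu>)
  \<comment> \<open>By invariance \<open>B n\<close> and its complement have the measures of A and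
    of its complement; the bounded density turns this into a Lebesgue lower bound independent of
    n.\<close>
  define m where "m = min (measure ?N A) (measure ?N (?I - A)) / density_bound"
  have m: "0 < m" using pos density_bound_pos by (simp add: m_def)
  have lb: "m \<le> measure lborel (E \<inter> I\<^sub>o)"
    if E: "E \<in> sets ?N" and ge: "min (measure ?N A) (measure ?N (?I - A)) \<le> measure ?N E" for E
  proof -
    have Eb: "E \<in> sets borel" "E \<subseteq> ?I" using E by (auto simp: sets_\<nu>_iff)
    have "emeasure lborel E = emeasure lborel (E \<inter> I\<^sub>o)"
    proof (rule emeasure_eq_AE)
      have "AE x in lborel. x \<noteq> \<alpha> - 2" by (rule AE_lborel_singleton)
      then show "AE x in lborel. x \<in> E \<longleftrightarrow> x \<in> E \<inter> I\<^sub>o"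
        by eventually_elim (use Eb in \<open>auto simp: I\<^sub>\<alpha>_def\<close>)
    qed (use Eb in auto)
    then have "measure lborel E = measure lborel (E \<inter> I\<^sub>o)" by (simp add: measure_def)
    then show ?thesis
      using measure_\<nu>_le[OF E] ge density_bound_pos unfolding m_def by (simp add: divide_le_eq mult.commute)
  qed
  have BI: "?I - B n \<in> sets ?N" for n using sets.compl_sets[OF B(1)] by (simp add: space_\<nu>)
  have m1: "m \<le> measure lborel (B n \<inter> I\<^sub>o)" for n
    using measure_\<nu>_preimage(1)[OF B(1), of n n] B(2)[of n] by (intro lb B) auto
  have m2: "m \<le> measure lborel ((?I - B n) \<inter> I\<^sub>o)" for n
  proof (rule lb[OF BI])
    have "(?T ^^ n) x \<in> ?I" if "x \<in> ?I" for x
      using that by (induction n) (auto intro: \<phi>_maps_I)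
    then have "(?T ^^ n) -` (?I - B n) \<inter> ?I = ?I - A" using B(2)[of n] by auto
    then show "min (measure ?N A) (measure ?N (?I - A)) \<le> measure ?N (?I - B n)"
      using measure_\<nu>_preimage(1)[OF BI, of n n] by simp
  qed
  obtain c where c: "0 < c" and full: "\<And>n. \<exists>N\<ge>n. c \<le> measure lborel (covered N I\<^sub>o)"
    using full_branches_cover by metis
  define r where "r = m / (exp 640 * 2)"
  have r: "0 < r" using m by (simp add: r_def)
  \<comment> \<open>The two approximation errors add up to at most 2 e = r c / 2, while the set they
    must contain has measure at least r c.\<close>
  define e where "e = r * c / 4"
  have e: "0 < e" using r c by (simp add: e_def)
  obtain S where S: "compact S" "S \<subseteq> A" "emeasure lborel (A - S) < ennreal e"
    using compact_inner_approximation[OF Ab(1,2) e] .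
  obtain S' where S': "compact S'" "S' \<subseteq> ?I - A" "emeasure lborel (?I - A - S') < ennreal e"
    using compact_inner_approximation[OF Ab(3) _ e] by blast
  have "S \<inter> S' = {}" using S S' by blast
  then obtain \<rho> where \<rho>: "0 < \<rho>" "\<And>x y. x \<in> S \<Longrightarrow> y \<in> S' \<Longrightarrow> \<rho> \<le> dist x y"
    using separate_compact_closed[OF S(1) compact_imp_closed[OF S'(1)]] by blast
  obtain n0 where "(9/10::real) ^ n0 < \<rho> / 8"
    using real_arch_pow_inv[of "\<rho> / 8" "9/10"] \<rho> by auto
  moreover obtain N where N: "n0 \<le> N" "c \<le> measure lborel (covered N I\<^sub>o)" using full by blast
  moreover have "(9/10::real) ^ N \<le> (9/10) ^ n0" using N by (intro power_decreasing) auto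
  \<comment> \<open>A cylinder of order N has diameter at most 2 * 4 (9/10)^N, now below the
    distance of the two compact sets.\<close>
  ultimately have N8: "8 * (9/10) ^ N < \<rho>" by linarith
  let ?R = "S \<union> S'"
  have Sb: "S \<in> sets borel" "S' \<in> sets borel" using S(1) S'(1) by (auto intro: borel_compact)
  then have R: "?R \<in> sets borel" by simp
  have br: "ennreal r * emeasure lborel (inverse_branch w ` I\<^sub>o) \<le> emeasure lborel (inverse_branch w ` I\<^sub>o - ?R)"
    if "w \<in> branches N I\<^sub>o" for w
  proof -
    have w: "admissible w I\<^sub>o" "length w = N" using that by (auto simp: branches_def)
    let ?C = "inverse_branch w ` I\<^sub>o"
    have C: "?C \<subseteq> I\<^sub>o" "?C \<in> sets borel"
      using inverse_branch_in_Io[OF w(1)] sets_inverse_branch_image[OF w(1) order_refl] by auto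
    have diam: "\<bar>x - y\<bar> < \<rho>" if xy: "x \<in> ?C" "y \<in> ?C" for x y
    proof -
      obtain z z' where z: "z \<in> I\<^sub>o" "z' \<in> I\<^sub>o" "x = inverse_branch w z" "y = inverse_branch w z'"
        using xy by blast
      have "\<bar>x - y\<bar> \<le> \<bar>z - z'\<bar> * (4 * (9/10) ^ N)"
        using inverse_branch_diff_le[OF w(1) z(1,2)] z w by simp
      also have "\<dots> \<le> 2 * (4 * (9/10) ^ N)" using z(1,2) by (intro mult_right_mono) auto
      finally show ?thesis using N8 by simp
    qed
    have pre: "inverse_branch w z \<in> A \<longleftrightarrow> z \<in> B N" if z: "z \<in> I\<^sub>o" for z
      using \<phi>_funpow_inverse_branch[OF w(1) z] w(2) B(2)[of N] inverse_branch_in_Io[OF w(1) z]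
      by (auto simp: I\<^sub>\<alpha>_def)
    have part: "r * measure lborel ?C \<le> measure lborel (?C - ?R)"
      if X: "X \<in> sets borel" "X \<subseteq> I\<^sub>o" "m \<le> measure lborel X" "inverse_branch w ` X \<subseteq> ?C - ?R" for X
    proof -
      have "m * measure lborel ?C \<le> measure lborel X * measure lborel ?C"
        using X by (intro mult_right_mono) auto
      also have "\<dots> \<le> exp 640 * (measure lborel (inverse_branch w ` X) * measure lborel I\<^sub>o)"
        by (rule inverse_branch_image_comparison[OF w(1) X(2,1) order_refl]) simp
      finally have "r * measure lborel ?C \<le> measure lborel (inverse_branch w ` X)"
        by (simp add: r_def field_simps)
      also have "\<dots> \<le> measure lborel (?C - ?R)"
        using X(4) C R Io_finite_measure[of "?C - ?R"] sets_inverse_branch_image[OF w(1) X(2,1)]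
        by (intro measure_mono_fmeasurable) (auto simp: fmeasurable_def)
      finally show ?thesis .
    qed
    \<comment> \<open>If the cylinder misses S, the image of \<open>B N\<close> lies in A and so
      misses both compact sets; if it misses S', the same holds for the image of the complement.
      Either image fills at least the fraction r of the cylinder.\<close>
    have "?C \<inter> S = {} \<or> ?C \<inter> S' = {}"
      using diam \<rho>(2) by (fastforce simp: dist_real_def)
    then have "r * measure lborel ?C \<le> measure lborel (?C - ?R)"
    proof
      assume d: "?C \<inter> S = {}"
      show ?thesis
      proof (rule part[of "B N \<inter> I\<^sub>o"])
        show "inverse_branch w ` (B N \<inter> I\<^sub>o) \<subseteq> ?C - ?R"
          using pre d S'(2) by blast
      qed (use B(1)[of N] m1 in \<open>auto simp: sets_\<nu>_iff\<close>)
    next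
      assume d: "?C \<inter> S' = {}"
      show ?thesis
      proof (rule part[of "(?I - B N) \<inter> I\<^sub>o"])
        show "inverse_branch w ` ((?I - B N) \<inter> I\<^sub>o) \<subseteq> ?C - ?R"
          using pre d S(2) by blast
      qed (use BI[of N] m2 in \<open>auto simp: sets_\<nu>_iff\<close>)
    qed
    moreover have "?C - ?R \<subseteq> I\<^sub>o" using C by blast
    ultimately show ?thesis
      using C(1) r by (simp add: emeasure_eq_measure_Io flip: ennreal_mult)
  qed
  have "ennreal (r * c) \<le> ennreal r * emeasure lborel (covered N I\<^sub>o)"
    using N r c covered_subset_Io by (simp add: emeasure_eq_measure_Io mult_left_mono flip: ennreal_mult)
  also have "\<dots> \<le> emeasure lborel (\<Union>w\<in>branches N I\<^sub>o. inverse_branch w ` I\<^sub>o - ?R)"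
    unfolding covered_def
  proof (rule emeasure_UN_comparison[OF countable_branches _ covered_disjoint _ _ br])
    fix w assume "w \<in> branches N I\<^sub>o"
    then have "admissible w I\<^sub>o" by (simp add: branches_def)
    from sets_inverse_branch_image[OF this order_refl]
    show "inverse_branch w ` I\<^sub>o \<in> sets lborel" "inverse_branch w ` I\<^sub>o - ?R \<in> sets lborel"
      using R by auto
  qed auto
  \<comment> \<open>What is left of the cylinders avoids both compact sets, hence lies in the two
    small differences.\<close>
  also have "\<dots> \<le> emeasure lborel ((A - S) \<union> (?I - A - S'))"
  proof (rule emeasure_mono)
    have "(\<Union>w\<in>branches N I\<^sub>o. inverse_branch w ` I\<^sub>o - ?R) \<subseteq> ?I - ?R"
      using covered_subset_Io[of N I\<^sub>o] unfolding covered_def I\<^sub>\<alpha>_def by fastforce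
    then show "(\<Union>w\<in>branches N I\<^sub>o. inverse_branch w ` I\<^sub>o - ?R) \<subseteq> (A - S) \<union> (?I - A - S')"
      by blast
  qed (use Ab Sb in simp)
  also have "\<dots> \<le> emeasure lborel (A - S) + emeasure lborel (?I - A - S')"
    by (rule emeasure_subadditive) (use Ab Sb in simp_all)
  also have "\<dots> \<le> ennreal e + ennreal e"
    using S S' by (intro add_mono) auto
  also have "\<dots> = ennreal (2 * e)" using e by (simp flip: ennreal_plus)
  finally have "r * c \<le> 2 * e" using e by (simp add: ennreal_le_iff)
  moreover have "0 < r * c" using r c by simp
  ultimately show False unfolding e_def by linarith
qed

end

theorem theorem16:
  fixes \<alpha> :: real
  assumes "\<alpha> \<in> {golden_g..golden_G}"
  shows "measure_preserving (\<nu>\<^sub>\<alpha> \<alpha>) (\<phi>\<^sub>\<alpha> \<alpha>) \<and>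
         exact_transformation (\<nu>\<^sub>\<alpha> \<alpha>) (\<phi>\<^sub>\<alpha> \<alpha>) \<and>
         mixing_of_all_orders (\<nu>\<^sub>\<alpha> \<alpha>) (\<phi>\<^sub>\<alpha> \<alpha>)"
proof -
  interpret odd_cf \<alpha> by unfold_locales (rule assms)
  show ?thesis
    using \<nu>_measure_preserving \<nu>_exact exact_imp_mixing_of_all_orders by blast
qed

end
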